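(* Let $n\ge 2$, let $X=\mathbb A^n$ and $S=\mathbb A^1$ over $\mathbb C$, and let $f:X\to S$ be a non-constant polynomial map with at most isolated singularities (i.e. the set $\mathrm{Sing}\,f$ of critical points of $f$ in $X$ is finite). Then, as submodules of the algebraic Gauss-Manin system $G_f$, $$G_f^{(0)}=\mathrm{Ker}\Bigl(G_f\to\bigoplus_{x\in\mathrm{Sing}\,f}\mathcal G_{f,x}/\mathcal G_{f,x}^{(0)}\Bigr).$$
   Context: $t$ is the coordinate of $S$; $\Omega^p=\Gamma(X,\Omega_X^p)$ denotes algebraic differential forms. The algebraic Gauss-Manin system $G_f$ is the module of global sections of $\mathcal G_f=\mathcal H^0 f_+\mathcal O_X$ ($f_+$ the direct image of algebraic left $\mathcal D$-modules); explicitly $$G_f=\Omega^n[\partial_t]\big/\{\,d\eta-\partial_t(df\wedge\eta):\eta\in\Omega^{n-1}[\partial_t]\,\},$$ where $d$ and $df\wedge$ act on coefficients, $\partial_t$ acts by $\omega\partial_t^j\mapsto\omega\partial_t^{j+1}$ and $t(\omega\partial_t^j)=f\omega\,\partial_t^j-j\,\omega\,\partial_t^{j-1}$. The algebraic Brieskorn module is $G_f^{(0)}=\Omega^n/df\wedge d\Omega^{n-2}$; the natural map $\omega\mapsto\omega\partial_t^0$ is injective and identifies it with a $\mathbb C[t]$-submodule of $G_f$. For $x\in\mathrm{Sing}\,f$, the local analytic Brieskorn lattice is $\mathcal G_{f,x}^{(0)}=\Omega^n_{X^{\mathrm{an}},x}/df\wedge d\Omega^{n-2}_{X^{\mathrm{an}},x}$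 with $t$ acting by multiplication by $f$; it has the injective operator $\partial_t^{-1}$, $\partial_t^{-1}[d\eta]=[df\wedge\eta]$. The local analytic Gauss-Manin system $\mathcal G_{f,x}$ is the localization of $\mathcal G_{f,x}^{(0)}$ by $\partial_t^{-1}$. The map $G_f\to\mathcal G_{f,x}$ sends the class of $\omega\partial_t^j$ to $\partial_t^j[\omega_x]$, with $\omega_x$ the germ of $\omega$ at $x$. *)

theory Defs
  imports
    "HOL-Analysis.Analysis"
    "HOL-Library.Function_Algebras"
    "HOL-Computational_Algebra.Polynomial"
    "HOL-Algebra.FiniteProduct"
    "HOL-Algebra.Product_Groups"
begin

section \<open>Functions on affine space\<close>

text \<open>
  \<open>X = \<complex>\<^sup>n\<close> is \<^typ>\<open>complex ^ 'n\<close> with \<open>n = CARD('n)\<close>; the linear order on \<^typ>\<open>'n\<close> only fixes the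
  signs of the monomials \<open>dx\<^sub>I\<close>. A regular function on \<open>X\<close> is identified with the polynomial
  function it defines, which loses nothing since \<open>\<complex>\<close> is infinite.
\<close>

type_synonym 'n cspace = "(complex, 'n) vec"

definition polyfun :: "('n::finite cspace \<Rightarrow> complex) set" where
  "polyfun = {g. \<exists>(A :: ('n \<Rightarrow> nat) set) c. finite A \<and>
      g = (\<lambda>z. \<Sum>\<alpha>\<in>A. c \<alpha> * (\<Prod>i\<in>UNIV. (z $ i) ^ \<alpha> i))}"

text \<open>Frechet differentiability with a \<open>\<complex>\<close>-linear derivative.\<close>

definition cdiff_at :: "('n::finite cspace \<Rightarrow> complex) \<Rightarrow> 'n cspace \<Rightarrow> bool" where
  "cdiff_at g z \<longleftrightarrow> (\<exists>a. (g has_derivative (\<lambda>h. \<Sum>i\<in>UNIV. a i * h $ i)) (at z))"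

definition holomorphic_near :: "'n::finite cspace \<Rightarrow> ('n cspace \<Rightarrow> complex) \<Rightarrow> bool" where
  "holomorphic_near x g \<longleftrightarrow> (\<forall>\<^sub>F z in nhds x. cdiff_at g z)"

definition pd :: "'n::finite \<Rightarrow> ('n cspace \<Rightarrow> complex) \<Rightarrow> 'n cspace \<Rightarrow> complex" where
  "pd i g z = deriv (\<lambda>s. g (z + axis i s)) 0"

definition Sing :: "('n::finite cspace \<Rightarrow> complex) \<Rightarrow> 'n cspace set" where
  "Sing f = {x. \<forall>i. pd i f x = 0}"

section \<open>Differential forms\<close>

text \<open>
  The form \<open>\<Sum>\<^sub>I \<omega> I dx\<^sub>I\<close>, where for \<open>I = {i\<^sub>1 < \<dots> < i\<^sub>p}\<close> one puts
  \<open>dx\<^sub>I = dx\<^sub>i\<^sub>1 \<and> \<dots> \<and> dx\<^sub>i\<^sub>p\<close>, is represented by its coefficients; \<open>p\<close>-forms are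
  supported on the index sets of cardinality \<open>p\<close>. The group structure is the pointwise one.
\<close>

type_synonym 'n form = "'n set \<Rightarrow> 'n cspace \<Rightarrow> complex"

text \<open>\<open>dx\<^sub>i \<and> dx\<^sub>J = ins_sign i I \<cdot> dx\<^sub>I\<close> for \<open>I = {i} \<union> J\<close>, \<open>i \<notin> J\<close>.\<close>

definition ins_sign :: "'n::{finite,linorder} \<Rightarrow> 'n set \<Rightarrow> complex" where
  "ins_sign i I = (-1) ^ card {j \<in> I. j < i}"

definition ext_d :: "'n::{finite,linorder} form \<Rightarrow> 'n form" where
  "ext_d \<omega> = (\<lambda>I z. \<Sum>i\<in>I. ins_sign i I * pd i (\<omega> (I - {i})) z)"

definition df_wedge :: "('n cspace \<Rightarrow> complex) \<Rightarrow> 'n::{finite,linorder} form \<Rightarrow> 'n form" where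
  "df_wedge f \<omega> = (\<lambda>I z. \<Sum>i\<in>I. ins_sign i I * pd i f z * \<omega> (I - {i}) z)"

definition alg_forms :: "nat \<Rightarrow> 'n::{finite,linorder} form set" where
  "alg_forms p = {\<omega>. \<forall>I. if card I = p then \<omega> I \<in> polyfun else \<omega> I = 0}"

text \<open>Representatives of germs at \<open>x\<close> of holomorphic \<open>p\<close>-forms.\<close>

definition an_forms :: "'n cspace \<Rightarrow> nat \<Rightarrow> 'n::{finite,linorder} form set" where
  "an_forms x p = {\<omega>. \<forall>I. if card I = p then holomorphic_near x (\<omega> I) else \<omega> I = 0}"

definition germ_eq :: "'n cspace \<Rightarrow> 'n::{finite,linorder} form \<Rightarrow> 'n form \<Rightarrow> bool" where
  "germ_eq x \<omega> \<omega>' \<longleftrightarrow> (\<forall>\<^sub>F z in nhds x. \<forall>I. \<omega> I z = \<omega>' I z)"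

section \<open>Groups and localization\<close>

text \<open>
  Abelian groups are written multiplicatively, to have the quotients, direct sums and kernels
  of HOL-Algebra.
\<close>

definition add_grp :: "'a::ab_group_add set \<Rightarrow> 'a monoid" where
  "add_grp M = \<lparr>carrier = M, mult = (+), one = 0\<rparr>"

text \<open>The map induced on cosets by a map that is constant on each of them.\<close>

definition induced :: "('a \<Rightarrow> 'b) \<Rightarrow> 'a set \<Rightarrow> 'b" where
  "induced \<phi> C = the_elem (\<phi> ` C)"

text \<open>
  Localization of an abelian group by an endomorphism \<open>\<sigma>\<close>: the pair \<open>(a, k)\<close> stands for
  \<open>\<sigma>\<^sup>-\<^sup>k a\<close>.
\<close>

definition loc_rel :: "('a, 'm) monoid_scheme \<Rightarrow> ('a \<Rightarrow> 'a) \<Rightarrow> (('a \<times> nat) \<times> ('a \<times> nat)) set" where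
  "loc_rel G \<sigma> = {((a, k), (b, l)). a \<in> carrier G \<and> b \<in> carrier G \<and>
      (\<exists>m. (\<sigma> ^^ (m + l)) a = (\<sigma> ^^ (m + k)) b)}"

definition frac :: "('a, 'm) monoid_scheme \<Rightarrow> ('a \<Rightarrow> 'a) \<Rightarrow> 'a \<Rightarrow> nat \<Rightarrow> ('a \<times> nat) set" where
  "frac G \<sigma> a k = loc_rel G \<sigma> `` {(a, k)}"

definition localization :: "('a, 'm) monoid_scheme \<Rightarrow> ('a \<Rightarrow> 'a) \<Rightarrow> ('a \<times> nat) set monoid" where
  "localization G \<sigma> =
    \<lparr>carrier = (carrier G \<times> UNIV) // loc_rel G \<sigma>,
     mult = (\<lambda>A B. \<Union>(a, k)\<in>A. \<Union>(b, l)\<in>B. frac G \<sigma> ((\<sigma> ^^ l) a \<otimes>\<^bsub>G\<^esub> (\<sigma> ^^ k) b) (k + l)),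
     one = frac G \<sigma> \<one>\<^bsub>G\<^esub> 0\<rparr>"

text \<open>The inverse of the automorphism of the localization induced by \<open>\<sigma>\<close>.\<close>

definition loc_inv :: "('a, 'm) monoid_scheme \<Rightarrow> ('a \<Rightarrow> 'a) \<Rightarrow> ('a \<times> nat) set \<Rightarrow> ('a \<times> nat) set" where
  "loc_inv G \<sigma> A = (\<Union>(a, k)\<in>A. frac G \<sigma> a (Suc k))"

section \<open>The algebraic Gauss-Manin system and Brieskorn module\<close>

text \<open>
  An element of \<open>\<Omega>\<^sup>p[\<partial>\<^sub>t]\<close> is a polynomial in the indeterminate \<open>\<partial>\<^sub>t\<close> whose coefficients are
  \<open>p\<close>-forms; multiplication by \<open>\<partial>\<^sub>t\<close> is \<open>pCons 0\<close>.
\<close>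

definition alg_forms_dt :: "nat \<Rightarrow> 'n::{finite,linorder} form poly set" where
  "alg_forms_dt p = {P. \<forall>j. coeff P j \<in> alg_forms p}"

definition gm_rel :: "('n cspace \<Rightarrow> complex) \<Rightarrow> 'n::{finite,linorder} form poly set" where
  "gm_rel f = {map_poly ext_d \<eta> - pCons 0 (map_poly (df_wedge f) \<eta>) | \<eta>.
      \<eta> \<in> alg_forms_dt (CARD('n) - 1)}"

definition gauss_manin ::
    "('n cspace \<Rightarrow> complex) \<Rightarrow> 'n::{finite,linorder} form poly set monoid" where
  "gauss_manin f = add_grp (alg_forms_dt CARD('n)) Mod gm_rel f"

definition brieskorn_rel :: "('n cspace \<Rightarrow> complex) \<Rightarrow> 'n::{finite,linorder} form set" where
  "brieskorn_rel f = {df_wedge f (ext_d \<eta>) | \<eta>. \<eta> \<in> alg_forms (CARD('n) - 2)}"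

definition brieskorn ::
    "('n cspace \<Rightarrow> complex) \<Rightarrow> 'n::{finite,linorder} form set monoid" where
  "brieskorn f = add_grp (alg_forms CARD('n)) Mod brieskorn_rel f"

definition brieskorn_to_gm ::
    "('n cspace \<Rightarrow> complex) \<Rightarrow> 'n::{finite,linorder} form set \<Rightarrow> 'n form poly set" where
  "brieskorn_to_gm f =
    induced (\<lambda>\<omega>. gm_rel f #>\<^bsub>add_grp (alg_forms_dt CARD('n))\<^esub> [:\<omega>:])"

section \<open>The local analytic Brieskorn lattice and Gauss-Manin system\<close>

text \<open>
  Representatives of germs are divided out by \<open>df \<and> d\<Omega>\<^sup>n\<^sup>-\<^sup>2\<close> and by the forms vanishing near
  \<open>x\<close> in one step.
\<close>

definition loc_brieskorn_rel ::
    "('n cspace \<Rightarrow> complex) \<Rightarrow> 'n cspace \<Rightarrow> 'n::{finite,linorder} form set" where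
  "loc_brieskorn_rel f x = {\<omega> \<in> an_forms x CARD('n).
      \<exists>\<eta> \<in> an_forms x (CARD('n) - 2). germ_eq x \<omega> (df_wedge f (ext_d \<eta>))}"

definition loc_brieskorn ::
    "('n cspace \<Rightarrow> complex) \<Rightarrow> 'n cspace \<Rightarrow> 'n::{finite,linorder} form set monoid" where
  "loc_brieskorn f x = add_grp (an_forms x CARD('n)) Mod loc_brieskorn_rel f x"

definition loc_class ::
    "('n cspace \<Rightarrow> complex) \<Rightarrow> 'n cspace \<Rightarrow> 'n::{finite,linorder} form \<Rightarrow> 'n form set" where
  "loc_class f x \<omega> = loc_brieskorn_rel f x #>\<^bsub>add_grp (an_forms x CARD('n))\<^esub> \<omega>"

text \<open>\<open>\<partial>\<^sub>t\<^sup>-\<^sup>1 [d\<eta>] = [df \<and> \<eta>]\<close>; by the holomorphic Poincare lemma every class is of the form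
  \<open>[d\<eta>]\<close>, and \<open>[df \<and> \<eta>]\<close> depends on \<open>[d\<eta>]\<close> only.\<close>

definition dt_inv ::
    "('n cspace \<Rightarrow> complex) \<Rightarrow> 'n cspace \<Rightarrow> 'n::{finite,linorder} form set \<Rightarrow> 'n form set" where
  "dt_inv f x c = (THE c'. \<exists>\<eta> \<in> an_forms x (CARD('n) - 1).
      c = loc_class f x (ext_d \<eta>) \<and> c' = loc_class f x (df_wedge f \<eta>))"

definition loc_gauss_manin ::
    "('n cspace \<Rightarrow> complex) \<Rightarrow> 'n cspace \<Rightarrow>
      ('n::{finite,linorder} form set \<times> nat) set monoid" where
  "loc_gauss_manin f x = localization (loc_brieskorn f x) (dt_inv f x)"

definition loc_dt ::
    "('n cspace \<Rightarrow> complex) \<Rightarrow> 'n cspace \<Rightarrow>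
      ('n::{finite,linorder} form set \<times> nat) set \<Rightarrow> ('n form set \<times> nat) set" where
  "loc_dt f x = loc_inv (loc_brieskorn f x) (dt_inv f x)"

definition lattice_to_loc_gm ::
    "('n cspace \<Rightarrow> complex) \<Rightarrow> 'n cspace \<Rightarrow>
      'n::{finite,linorder} form set \<Rightarrow> ('n form set \<times> nat) set" where
  "lattice_to_loc_gm f x c = frac (loc_brieskorn f x) (dt_inv f x) c 0"

definition loc_lattice ::
    "('n cspace \<Rightarrow> complex) \<Rightarrow> 'n cspace \<Rightarrow>
      ('n::{finite,linorder} form set \<times> nat) set set" where
  "loc_lattice f x = lattice_to_loc_gm f x ` carrier (loc_brieskorn f x)"

section \<open>From the algebraic to the local Gauss-Manin systems\<close>

text \<open>The product is the sum of the \<open>\<partial>\<^sub>t\<^sup>j [\<omega>\<^sub>j]\<close> over the coefficients \<open>\<omega>\<^sub>j\<close>, in multiplicative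
  notation.\<close>

definition gm_to_loc_gm ::
    "('n cspace \<Rightarrow> complex) \<Rightarrow> 'n cspace \<Rightarrow>
      'n::{finite,linorder} form poly set \<Rightarrow> ('n form set \<times> nat) set" where
  "gm_to_loc_gm f x = induced (\<lambda>P. \<Otimes>\<^bsub>loc_gauss_manin f x\<^esub>j\<in>{..degree P}.
      (loc_dt f x ^^ j) (lattice_to_loc_gm f x (loc_class f x (coeff P j))))"

definition polar_parts ::
    "('n cspace \<Rightarrow> complex) \<Rightarrow>
      ('n cspace \<Rightarrow> ('n::{finite,linorder} form set \<times> nat) set set) monoid" where
  "polar_parts f = sum_group (Sing f) (\<lambda>x. loc_gauss_manin f x Mod loc_lattice f x)"

definition gm_to_polar_parts ::
    "('n cspace \<Rightarrow> complex) \<Rightarrow> 'n::{finite,linorder} form poly set \<Rightarrow>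
      ('n cspace \<Rightarrow> ('n form set \<times> nat) set set)" where
  "gm_to_polar_parts f u =
    (\<lambda>x\<in>Sing f. loc_lattice f x #>\<^bsub>loc_gauss_manin f x\<^esub> gm_to_loc_gm f x u)"

end

theory Submission
  imports Defs
    "HOL-Complex_Analysis.Cauchy_Integral_Formula"
    "HOL-Computational_Algebra.Fundamental_Theorem_Algebra"
begin

text \<open>
  Write \<open>\<sigma>\<close> for \<open>\<partial>\<^sub>t\<^sup>-\<^sup>1\<close>. That \<open>G\<^sub>f\<^sup>(\<^sup>0\<^sup>)\<close> maps to the local lattices is clear from the definitions. For the
  converse, let \<open>u = \<Sum>\<^sub>j\<^sub>\<le>\<^sub>k \<omega>\<^sub>j \<partial>\<^sub>t\<^sup>j\<close> with \<open>k > 0\<close> be a class that lies in the lattice at every critical point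
  \<open>x\<close>. Since \<open>\<sigma>\<close> is injective on the lattice at \<open>x\<close>, this forces \<open>[\<omega>\<^sub>k]\<close> to lie in the image of \<open>\<sigma>\<close>,
  that is, \<open>\<omega>\<^sub>k \<in> df \<and> \<Omega>\<^sup>n\<^sup>-\<^sup>1\<close> for holomorphic germs at \<open>x\<close>. Then \<open>\<omega>\<^sub>k = df \<and> \<eta>\<close> for a polynomial form
  \<open>\<eta>\<close>, and \<open>\<omega>\<^sub>k \<partial>\<^sub>t\<^sup>k = d\<eta> \<partial>\<^sub>t\<^sup>k\<^sup>-\<^sup>1\<close> in \<open>G\<^sub>f\<close> lowers the degree in \<open>\<partial>\<^sub>t\<close> (\<open>degree_reduction\<close>).
  Descending to \<open>k = 0\<close> shows that \<open>u\<close> is the class of a form. Four facts carry this argument.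

  The operator \<open>\<sigma>\<close> is well defined by the Poincare lemma for germs in degrees \<open>n\<close> and \<open>n - 1\<close>
  (\<open>poincare_lemma\<close>), proved with the cone over the point \<open>x\<close>.

  The operator \<open>\<sigma>\<close> is injective because the Koszul complex of the partial derivatives of \<open>f\<close> is exact in
  degree \<open>n - 1\<close> on holomorphic germs (\<open>koszul_exact\<close>). As in the depth sensitivity of the Koszul complex,
  it is enough that the ideal generated by the partial derivatives contains \<^emph>\<open>some\<close> regular sequence of
  length \<open>n\<close>. The powers \<open>(z\<^sub>j - x\<^sub>j)\<^bsup>v j\<^esup>\<close> form one, since differentiating and integrating along one
  coordinate divides by that coordinate and is linear over the functions of the other coordinates
  (\<open>coord_regular\<close>).

  For suitable exponents these powers belong to the ideal by the Nullstellensatz for polynomials over \<open>\<complex>\<close>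
  (\<open>nullstellensatz\<close>), which holds because \<open>\<complex>\<close> is uncountable while the polynomials have countable dimension.

  Finally, a polynomial which lies in the ideal of the partial derivatives locally analytically at every
  critical point lies in it globally (\<open>jacobian_local_global\<close>). The analytic coefficients are truncated
  modulo high powers of the coordinates; the error is a polynomial in the ideal of these
  powers, which the Nullstellensatz absorbs into the Jacobian ideal up to a factor that does not vanish at
  the point.
\<close>

section \<open>Holomorphic functions of several variables\<close>

lemma norm_axis: "norm (axis i x :: ('b::real_normed_vector,'n::finite) vec) = norm x"
proof -
  have "norm (axis i x :: ('b,'n) vec) = L2_set (\<lambda>k. if k = i then norm x else 0) UNIV"
    unfolding norm_vec_def by (rule L2_set_cong) (auto simp: axis_def)
  also have "\<dots> = norm x" by (simp add: L2_set_def if_distrib[of "\<lambda>x. x^2"] cong: if_cong)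
  finally show ?thesis .
qed

lemma bounded_linear_axis: "bounded_linear (axis i :: 'b::real_normed_vector \<Rightarrow> ('b,'n::finite) vec)"
proof (rule bounded_linear_intro[of _ 1])
  fix x y :: 'b and r :: real
  show "axis i (x + y) = (axis i x + axis i y :: ('b,'n) vec)" by (simp add: vec_eq_iff axis_def)
  show "axis i (r *\<^sub>R x) = (r *\<^sub>R axis i x :: ('b,'n) vec)" by (simp add: vec_eq_iff axis_def)
  show "norm (axis i x :: ('b,'n) vec) \<le> norm x * 1"
    by (simp add: norm_axis)
qed

lemma slice_deriv:
  assumes "(g has_derivative (\<lambda>h. \<Sum>k\<in>UNIV. a k * h $ k)) (at (z + axis i s))"
  shows "((\<lambda>s. g (z + axis i s)) has_field_derivative a i) (at s)"
proof -
  have 1: "((\<lambda>s. z + axis i s) has_derivative (\<lambda>s. axis i s)) (at s)"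
    by (auto intro!: derivative_eq_intros bounded_linear_imp_has_derivative[OF bounded_linear_axis])
  have "((\<lambda>s. g (z + axis i s)) has_derivative (\<lambda>h. \<Sum>k\<in>UNIV. a k * axis i h $ k)) (at s)"
    using diff_chain_at[OF 1] assms by (auto simp: o_def)
  moreover have "(\<Sum>k\<in>UNIV. a k * axis i h $ k) = a i * h" for h
    by (simp add: axis_def if_distrib[of "(*) _"] if_distribR cong: if_cong)
  ultimately show ?thesis by (simp add: has_field_derivative_def)
qed

lemma has_derivative_pd:
  fixes z :: "'n::finite cspace"
  assumes "(g has_derivative (\<lambda>h. \<Sum>k\<in>UNIV. a k * h $ k)) (at z)"
  shows "pd i g z = a i"
proof -
  have "axis i (0::complex) = (0 :: 'n cspace)" by (simp add: axis_def vec_eq_iff)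
  then show ?thesis
    unfolding pd_def using assms by (intro DERIV_imp_deriv slice_deriv) (simp only: add_0_right)
qed

lemma cdiff_atD:
  assumes "cdiff_at g z"
  shows "(g has_derivative (\<lambda>h. \<Sum>k\<in>UNIV. pd k g z * h $ k)) (at z)"
proof -
  obtain a where a: "(g has_derivative (\<lambda>h. \<Sum>k\<in>UNIV. a k * h $ k)) (at z)"
    using assms by (auto simp: cdiff_at_def)
  show ?thesis using a by (simp add: has_derivative_pd[OF a])
qed

lemma cdiff_slice:
  assumes "cdiff_at g (z + axis i s)"
  shows "((\<lambda>s. g (z + axis i s)) has_field_derivative pd i g (z + axis i s)) (at s)"
  by (rule slice_deriv[OF cdiff_atD[OF assms]])

lemma cdiff_at_imp_continuous: "cdiff_at g z \<Longrightarrow> isCont g z"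
  using has_derivative_continuous cdiff_atD by blast

lemma pd_eventually_cong:
  assumes "\<forall>\<^sub>F z in nhds z. g z = h z"
  shows "pd i g z = pd i h z"
proof -
  have "((\<lambda>s. z + axis i s) \<longlongrightarrow> z + axis i 0) (nhds 0)"
    using linear_continuous_at[OF bounded_linear_axis, of 0 i]
    by (intro tendsto_add tendsto_const) (simp add: continuous_at tendsto_nhds_iff)
  then have "filterlim (\<lambda>s. z + axis i s) (nhds z) (nhds 0)"
    by (simp add: axis_def zero_vec_def[symmetric])
  then have "\<forall>\<^sub>F s in nhds 0. g (z + axis i s) = h (z + axis i s)"
    using assms by (rule eventually_compose_filterlim[rotated])
  then show ?thesis unfolding pd_def by (rule deriv_cong_ev) simp
qed

lemma cdiff_at_cong:
  assumes "\<forall>\<^sub>F z in nhds z. g z = h z" "cdiff_at g z"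
  shows "cdiff_at h z"
proof -
  have e: "\<forall>\<^sub>F z in at z. g z = h z" and "g z = h z"
    using assms(1) by (simp_all add: eventually_nhds_conv_at)
  obtain a where "(g has_derivative (\<lambda>h. \<Sum>k\<in>UNIV. a k * h $ k)) (at z)"
    using assms(2) by (auto simp: cdiff_at_def)
  from has_derivative_transform_eventually[OF this e \<open>g z = h z\<close>] show ?thesis
    by (auto simp: cdiff_at_def)
qed

text \<open>
  Differentiation under the integral sign, for integrals over a path of coordinatewise affine
  substitutions. Cauchy's formula, the cone operator and division by a coordinate are all of this form.
\<close>

lemma pd_integral:
  fixes g :: "'n::finite cspace \<Rightarrow> complex" and v :: "real \<Rightarrow> 'n cspace" and lam :: "real \<Rightarrow> 'n \<Rightarrow> complex"
  assumes g: "\<And>z. z \<in> U \<Longrightarrow> cdiff_at g z" and cont: "\<And>i. continuous_on U (pd i g)"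
    and w: "continuous_on {0..1} w" and v: "continuous_on {0..1} v"
    and lam: "\<And>k. continuous_on {0..1} (\<lambda>t. lam t k)"
    and V: "open V" "z \<in> V"
    and maps: "\<And>t z. t \<in> {0..1} \<Longrightarrow> z \<in> V \<Longrightarrow> v t + (\<chi> k. lam t k * z $ k) \<in> U"
  defines "\<phi> \<equiv> \<lambda>t z. v t + (\<chi> k. lam t k * z $ k)"
  shows "cdiff_at (\<lambda>z. integral {0..1} (\<lambda>t. w t * g (\<phi> t z))) z"
    and "pd i (\<lambda>z. integral {0..1} (\<lambda>t. w t * g (\<phi> t z))) z =
      integral {0..1} (\<lambda>t. w t * lam t i * pd i g (\<phi> t z))"
proof -
  obtain r where r: "r > 0" "ball z r \<subseteq> V" using V open_contains_ball by blast
  define B where "B = ball z r"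
  define proj :: "'n \<Rightarrow> 'n cspace \<Rightarrow>\<^sub>L complex" where "proj i = Blinfun (\<lambda>h. h $ i)" for i
  have proj: "blinfun_apply (proj i) h = h $ i" for i h
    by (simp add: proj_def bounded_linear_Blinfun_apply bounded_linear_vec_nth)
  define D where "D z t = (\<Sum>i\<in>UNIV. blinfun_mult_right (w t * lam t i * pd i g (\<phi> t z)) o\<^sub>L proj i)" for z t
  have D: "blinfun_apply (D z t) h = (\<Sum>i\<in>UNIV. (w t * lam t i * pd i g (\<phi> t z)) * h $ i)" for z t h
    by (simp add: D_def blinfun.sum_left proj)
  have lin: "bounded_linear (\<lambda>h :: 'n cspace. \<chi> k. lam t k * h $ k)" for t
    unfolding linear_conv_bounded_linear[symmetric]
    by (rule linearI) (simp_all add: vec_eq_iff algebra_simps)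
  have phi: "(\<phi> t has_derivative (\<lambda>h. \<chi> k. lam t k * h $ k)) (at y)" for t y
    unfolding \<phi>_def by (auto intro!: derivative_eq_intros bounded_linear_imp_has_derivative[OF lin])
  have contphi': "continuous_on (B \<times> {0..1}) (\<lambda>p. v (snd p) + (\<chi> k. lam (snd p) k * fst p $ k))"
  proof -
    have c1: "continuous_on (B \<times> {0..1}) (\<lambda>p. v (snd p))"
      by (rule continuous_on_compose2[OF v]) (auto intro: continuous_intros)
    have c2: "continuous_on (B \<times> {0..1}) (\<lambda>p. lam (snd p) k)" for k
      by (rule continuous_on_compose2[OF lam]) (auto intro: continuous_intros)
    show ?thesis by (intro continuous_intros c1 c2)
  qed
  then have contphi: "continuous_on (B \<times> {0..1}) (\<lambda>p. \<phi> (snd p) (fst p))"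
    by (simp add: \<phi>_def)
  have phiU: "\<phi> (snd p) (fst p) \<in> U" if "p \<in> B \<times> {0..1}" for p
    using that maps r unfolding \<phi>_def B_def by auto
  have wc: "continuous_on (B \<times> {0..1}) (\<lambda>p. w (snd p))"
    by (rule continuous_on_compose2[OF w]) (auto intro: continuous_intros)
  have lc: "continuous_on (B \<times> {0..1}) (\<lambda>p. lam (snd p) i)" for i
    by (rule continuous_on_compose2[OF lam]) (auto intro: continuous_intros)
  have gU: "continuous_on U g"
    using g cdiff_at_imp_continuous continuous_at_imp_continuous_on by blast
  have gc: "continuous_on (B \<times> {0..1}) (\<lambda>p. g (\<phi> (snd p) (fst p)))"
    by (rule continuous_on_compose2[OF gU contphi]) (use phiU in auto)
  have pc: "continuous_on (B \<times> {0..1}) (\<lambda>p. pd i g (\<phi> (snd p) (fst p)))" for i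
    by (rule continuous_on_compose2[OF cont contphi]) (use phiU in auto)
  have dc: "continuous_on (B \<times> cbox 0 1) (\<lambda>(z, t). D z t)"
    unfolding D_def case_prod_beta cbox_interval
    by (intro continuous_on_sum bounded_bilinear.continuous_on[OF bounded_bilinear_blinfun_compose]
        bounded_linear.continuous_on[OF bounded_linear_blinfun_mult_right] continuous_on_mult wc lc pc continuous_on_const)
  have fx: "((\<lambda>z. w t * g (\<phi> t z)) has_derivative blinfun_apply (D y t)) (at y within B)"
    if "y \<in> B" "t \<in> cbox 0 1" for y t
  proof -
    have "cdiff_at g (\<phi> t y)" using g phiU[of "(y,t)"] that by auto
    from diff_chain_at[OF phi[of t y] cdiff_atD[OF this]]
    have "((\<lambda>z. g (\<phi> t z)) has_derivative (\<lambda>h. \<Sum>k\<in>UNIV. pd k g (\<phi> t y) * (lam t k * h $ k))) (at y)"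
      by (simp add: o_def)
    from has_derivative_mult_right[OF this, of "w t"]
    have "((\<lambda>z. w t * g (\<phi> t z)) has_derivative blinfun_apply (D y t)) (at y)"
      by (simp add: D[abs_def] sum_distrib_left mult_ac)
    then show ?thesis by (rule has_derivative_at_withinI)
  qed
  have int2: "(\<lambda>t. w t * g (\<phi> t y)) integrable_on cbox 0 1" if "y \<in> B" for y
  proof -
    have "continuous_on {0..1} (\<lambda>t. g (\<phi> (snd (y,t)) (fst (y,t))))"
      by (rule continuous_on_compose2[OF gc]) (auto intro: continuous_intros that)
    then show ?thesis
      unfolding cbox_interval by (intro integrable_continuous_real continuous_on_mult w) simp
  qed
  have intD: "(\<lambda>t. D z t) integrable_on {0..1}"
  proof -
    have "continuous_on {0..1} (\<lambda>t. case (z,t) of (z,t) \<Rightarrow> D z t)"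
      by (rule continuous_on_compose2[OF dc]) (use r in \<open>auto intro!: continuous_intros simp: B_def\<close>)
    then show ?thesis by (intro integrable_continuous_real) simp
  qed
  have int3: "(\<lambda>t. w t * lam t i * pd i g (\<phi> t z)) integrable_on {0..1}" for i
  proof -
    have "continuous_on {0..1} (\<lambda>t. pd i g (\<phi> (snd (z,t)) (fst (z,t))))"
      by (rule continuous_on_compose2[OF pc]) (use r in \<open>auto intro!: continuous_intros simp: B_def\<close>)
    then show ?thesis
      by (intro integrable_continuous_real continuous_on_mult w lam) simp
  qed
  have "((\<lambda>z. integral (cbox 0 1) (\<lambda>t. w t * g (\<phi> t z))) has_derivative
      blinfun_apply (integral (cbox 0 1) (D z))) (at z within B)"
    by (rule leibniz_rule[OF fx int2 dc]) (use r in \<open>auto simp: B_def\<close>)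
  then have *: "((\<lambda>z. integral {0..1} (\<lambda>t. w t * g (\<phi> t z))) has_derivative
      blinfun_apply (integral {0..1} (D z))) (at z)"
    by (subst (asm) at_within_open) (use r in \<open>auto simp: B_def\<close>)
  have "blinfun_apply (integral {0..1} (D z)) h =
      (\<Sum>i\<in>UNIV. integral {0..1} (\<lambda>t. w t * lam t i * pd i g (\<phi> t z)) * h $ i)" for h
  proof -
    have "blinfun_apply (integral {0..1} (D z)) h = integral {0..1} (\<lambda>t. blinfun_apply (D z t) h)"
      by (rule blinfun_apply_integral[OF intD])
    also have "\<dots> = (\<Sum>i\<in>UNIV. integral {0..1} (\<lambda>t. w t * lam t i * pd i g (\<phi> t z) * h $ i))"
      unfolding D by (intro integral_sum) (auto intro!: integrable_on_mult_left int3)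
    finally show ?thesis by simp
  qed
  then have **: "((\<lambda>z. integral {0..1} (\<lambda>t. w t * g (\<phi> t z))) has_derivative
     (\<lambda>h. \<Sum>i\<in>UNIV. integral {0..1} (\<lambda>t. w t * lam t i * pd i g (\<phi> t z)) * h $ i)) (at z)"
    using * by presburger
  show "cdiff_at (\<lambda>z. integral {0..1} (\<lambda>t. w t * g (\<phi> t z))) z"
    unfolding cdiff_at_def by (rule exI, rule **)
  show "pd i (\<lambda>z. integral {0..1} (\<lambda>t. w t * g (\<phi> t z))) z =
      integral {0..1} (\<lambda>t. w t * lam t i * pd i g (\<phi> t z))"
    using has_derivative_pd[OF **] by simp
qed

lemma pd_Cauchy:
  fixes g :: "'n::finite cspace \<Rightarrow> complex"
  assumes g: "\<And>s. norm s \<le> \<rho> \<Longrightarrow> cdiff_at g (z + axis i s)" and "\<rho> > 0"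
  shows "pd i g z = integral {0..1} (\<lambda>t. inverse (\<rho> * exp (2 * of_real pi * \<i> * of_real t)) *
     g (axis i (\<rho> * exp (2 * of_real pi * \<i> * of_real t)) + z))"
proof -
  let ?e = "\<lambda>t. \<rho> * exp (2 * of_real pi * \<i> * of_real t)"
  define h where "h s = g (z + axis i s)" for s
  have d: "(h has_field_derivative pd i g (z + axis i s)) (at s)" if "norm s \<le> \<rho>" for s
    unfolding h_def using cdiff_slice[OF g[OF that]] .
  have "continuous_on (cball 0 \<rho>) h"
    by (intro continuous_at_imp_continuous_on ballI DERIV_isCont) (use d in force)
  moreover have "h holomorphic_on ball 0 \<rho>"
    by (subst holomorphic_on_open) (use d less_imp_le in \<open>auto, blast\<close>)
  ultimately have "contour_integral (circlepath 0 \<rho>) (\<lambda>u. h u / (u - 0)^2) = (2 * pi * \<i>) * deriv h 0"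
    by (rule Cauchy_contour_integral_circlepath_2) (use assms in auto)
  also have "contour_integral (circlepath 0 \<rho>) (\<lambda>u. h u / (u - 0)^2) =
     integral {0..1} (\<lambda>t. (2 * pi * \<i>) * (inverse (?e t) * g (axis i (?e t) + z)))"
    unfolding contour_integral_integral vector_derivative_circlepath unfolding h_def circlepath
    by (rule Henstock_Kurzweil_Integration.integral_cong) (use \<open>\<rho> > 0\<close> in \<open>simp add: field_simps power2_eq_square\<close>)
  finally show ?thesis unfolding pd_def h_def by simp
qed

text \<open>
  Cauchy's formula writes \<open>pd i g\<close> as an integral of \<open>g\<close> over translates, and \<open>g\<close> is continuous;
  this breaks the circularity between the existence of \<open>pd i g\<close> and the continuity needed to
  differentiate under the integral.
\<close>

lemma continuous_on_pd:
  fixes g :: "'n::finite cspace \<Rightarrow> complex"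
  assumes U: "open U" and g: "\<And>z. z \<in> U \<Longrightarrow> cdiff_at g z"
  shows "continuous_on U (pd i g)"
proof -
  have "isCont (pd i g) z" if "z \<in> U" for z
  proof -
    obtain r where r: "r > 0" "ball z r \<subseteq> U" using openE[OF U \<open>z \<in> U\<close>] by blast
    define \<rho> where "\<rho> = r/2"
    have mem: "axis i s + y \<in> U" if "y \<in> ball z \<rho>" "norm s \<le> \<rho>" for y s
    proof -
      have "dist z (axis i s + y) \<le> dist z y + norm (axis i s :: 'n cspace)"
        by (metis add.commute add_diff_cancel_left' dist_norm dist_triangle dist_commute)
      then show ?thesis using that r by (auto simp: \<rho>_def norm_axis subset_iff)
    qed
    have gU: "continuous_on U g"
      using g cdiff_at_imp_continuous continuous_at_imp_continuous_on by blast
    let ?e = "\<lambda>t. \<rho> * exp (2 * of_real pi * \<i> * of_real t)"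
    have ne: "norm (?e t) = \<rho>" for t
      using r by (simp add: norm_mult \<rho>_def)
    have "continuous_on (ball z \<rho>) (\<lambda>y. integral (cbox 0 1) (\<lambda>t. inverse (?e t) * g (axis i (?e t) + y)))"
    proof (rule integral_continuous_on_param, unfold case_prod_beta, intro continuous_on_mult)
      show "continuous_on (ball z \<rho> \<times> cbox 0 1) (\<lambda>p. inverse (?e (snd p)))"
        using r by (intro continuous_intros) (auto simp: \<rho>_def)
      show "continuous_on (ball z \<rho> \<times> cbox 0 1) (\<lambda>p. g (axis i (?e (snd p)) + fst p))"
        by (rule continuous_on_compose2[OF gU])
          (auto intro!: continuous_intros bounded_linear.continuous_on[OF bounded_linear_axis] mem simp: ne simp del: norm_mult)
    qed
    moreover have "integral (cbox 0 1) (\<lambda>t. inverse (?e t) * g (axis i (?e t) + y)) = pd i g y" if "y \<in> ball z \<rho>" for y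
      using r by (subst pd_Cauchy[of \<rho>]) (auto intro!: g mem[OF that] simp: \<rho>_def add.commute[of y])
    ultimately have "continuous_on (ball z \<rho>) (pd i g)"
      by (rule continuous_on_eq)
    then show ?thesis using r by (simp add: continuous_on_eq_continuous_at \<rho>_def)
  qed
  then show ?thesis by (simp add: continuous_at_imp_continuous_on)
qed

text \<open>
  Differentiate Cauchy's formula for \<open>pd i g\<close> under the integral; the result is Cauchy's formula
  for \<open>pd j g\<close>, which also gives the symmetry of second derivatives.
\<close>

lemma cdiff_pd:
  fixes g :: "'n::finite cspace \<Rightarrow> complex"
  assumes U: "open U" and g: "\<And>z. z \<in> U \<Longrightarrow> cdiff_at g z" and z: "z \<in> U"
  shows "cdiff_at (pd i g) z"
    and "(\<And>y. y \<in> U \<Longrightarrow> cdiff_at (pd j g) y) \<Longrightarrow> pd j (pd i g) z = pd i (pd j g) z"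
proof -
  obtain r where r: "r > 0" "ball z r \<subseteq> U" using U z open_contains_ball by blast
  define \<rho> where "\<rho> = r/2"
  have mem: "axis i s + y \<in> U" if "y \<in> ball z \<rho>" "norm s \<le> \<rho>" for y s
  proof -
    have "dist z (axis i s + y) \<le> dist z y + norm (axis i s :: 'n cspace)"
      by (metis add.commute add_diff_cancel_left' dist_norm dist_triangle dist_commute)
    then show ?thesis using that r by (auto simp: \<rho>_def norm_axis subset_iff)
  qed
  let ?e = "\<lambda>t. \<rho> * exp (2 * of_real pi * \<i> * of_real t)"
  have ne: "norm (?e t) = \<rho>" for t
    using r by (simp add: norm_mult \<rho>_def)
  have eq: "pd i h y = integral {0..1} (\<lambda>t. inverse (?e t) * h (axis i (?e t) + y))"
    if "y \<in> ball z \<rho>" "\<And>y. y \<in> U \<Longrightarrow> cdiff_at h y" for y h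
    using r by (subst pd_Cauchy[of \<rho>]) (auto intro!: that mem[OF that(1)] simp: \<rho>_def add.commute[of y])
  have ev: "\<forall>\<^sub>F y in nhds z. integral {0..1} (\<lambda>t. inverse (?e t) * g (axis i (?e t) + y)) = pd i g y"
    by (rule eventually_nhds_in_open[THEN eventually_mono, of "ball z \<rho>"])
      (use r eq g in \<open>auto simp: \<rho>_def\<close>)
  have w: "continuous_on {0..1} (\<lambda>t. inverse (?e t))"
    using r by (intro continuous_intros) (auto simp: \<rho>_def)
  have v: "continuous_on {0..1} (\<lambda>t. axis i (?e t) :: 'n cspace)"
    by (auto intro!: continuous_intros bounded_linear.continuous_on[OF bounded_linear_axis])
  have mp: "axis i (?e t) + (\<chi> k. 1 * y $ k) \<in> U" if "t \<in> {0..1}" "y \<in> ball z \<rho>" for t y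
    using mem[OF that(2), of "?e t"] ne by simp
  have zb: "z \<in> ball z \<rho>" using r by (auto simp: \<rho>_def)
  note P = pd_integral[OF g continuous_on_pd[OF U g] w v continuous_on_const open_ball zb mp]
  show "cdiff_at (pd i g) z"
    using P(1) by (intro cdiff_at_cong[OF ev]) (simp add: vec_lambda_eta)
  assume pj: "\<And>y. y \<in> U \<Longrightarrow> cdiff_at (pd j g) y"
  have "pd j (pd i g) z = integral {0..1} (\<lambda>t. inverse (?e t) * pd j g (axis i (?e t) + z))"
    using P(2)[of j] by (subst pd_eventually_cong[OF ev, symmetric]) (simp add: vec_lambda_eta)
  also have "\<dots> = pd i (pd j g) z"
    using eq[OF zb pj] by simp
  finally show "pd j (pd i g) z = pd i (pd j g) z" .
qed

lemma pd_commute: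
  assumes "open U" "\<And>z. z \<in> U \<Longrightarrow> cdiff_at g z" "z \<in> U"
  shows "pd j (pd i g) z = pd i (pd j g) z"
  using assms by (intro cdiff_pd(2)[of U] cdiff_pd(1)[of U])

lemma has_derivative_imp_cdiff:
  assumes "(g has_derivative (\<lambda>h. \<Sum>k\<in>UNIV. a k * h $ k)) (at z)"
  shows "cdiff_at g z \<and> pd i g z = a i"
  using assms has_derivative_pd[OF assms] unfolding cdiff_at_def by blast

lemma cdiff_const: "cdiff_at (\<lambda>z. c) z \<and> pd i (\<lambda>z. c) z = 0"
  by (rule has_derivative_imp_cdiff[where a = "\<lambda>_. 0"]) simp

lemma sum_delta_mult:
  fixes a :: "'n::finite \<Rightarrow> complex"
  shows "(\<Sum>k\<in>UNIV. (if k = j then 1 else 0) * a k) = a j"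
proof -
  have "(\<Sum>k\<in>UNIV. (if k = j then 1 else 0) * a k) = (\<Sum>k\<in>UNIV. if k = j then a k else 0)"
    by (rule sum.cong) auto
  then show ?thesis by simp
qed

lemma cdiff_coord:
  fixes z :: "'n::finite cspace"
  shows "cdiff_at (\<lambda>z. z $ j) z \<and> pd i (\<lambda>z. z $ j) z = (if i = j then 1 else 0)"
proof (rule has_derivative_imp_cdiff[where a = "\<lambda>k. if k = j then 1 else 0"])
  have "(\<Sum>k\<in>UNIV. (if k = j then 1 else 0) * h $ k) = h $ j" for h :: "'n cspace"
    by (rule sum_delta_mult)
  then show "((\<lambda>z. z $ j) has_derivative (\<lambda>h. \<Sum>k\<in>UNIV. (if k = j then 1 else 0) * h $ k)) (at z)"
    by (simp add: bounded_linear_imp_has_derivative bounded_linear_vec_nth)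
qed

lemma cdiff_add:
  assumes "cdiff_at g z" "cdiff_at h z"
  shows "cdiff_at (\<lambda>z. g z + h z) z \<and> pd i (\<lambda>z. g z + h z) z = pd i g z + pd i h z"
  by (rule has_derivative_imp_cdiff[where a = "\<lambda>k. pd k g z + pd k h z"])
    (use has_derivative_add[OF assms[THEN cdiff_atD]] in \<open>simp add: algebra_simps sum.distrib\<close>)

lemma cdiff_mult:
  assumes "cdiff_at g z" "cdiff_at h z"
  shows "cdiff_at (\<lambda>z. g z * h z) z \<and> pd i (\<lambda>z. g z * h z) z = g z * pd i h z + pd i g z * h z"
  by (rule has_derivative_imp_cdiff[where a = "\<lambda>k. g z * pd k h z + pd k g z * h z"])
    (use has_derivative_mult[OF assms[THEN cdiff_atD]] in
      \<open>simp add: algebra_simps sum.distrib sum_distrib_left sum_distrib_right\<close>)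

lemma cdiff_cmult:
  assumes "cdiff_at g z"
  shows "cdiff_at (\<lambda>z. c * g z) z \<and> pd i (\<lambda>z. c * g z) z = c * pd i g z"
  using cdiff_mult[of "\<lambda>_. c" z g i] cdiff_const[of c z i] assms by simp

lemma cdiff_diff:
  assumes "cdiff_at g z" "cdiff_at h z"
  shows "cdiff_at (\<lambda>z. g z - h z) z \<and> pd i (\<lambda>z. g z - h z) z = pd i g z - pd i h z"
  using cdiff_add[OF assms(1), of "\<lambda>z. (-1) * h z" i] cdiff_cmult[OF assms(2), of "-1" i] by simp

lemma cdiff_sum:
  assumes "\<And>k. k \<in> A \<Longrightarrow> cdiff_at (g k) z"
  shows "cdiff_at (\<lambda>z. \<Sum>k\<in>A. g k z) z \<and> pd i (\<lambda>z. \<Sum>k\<in>A. g k z) z = (\<Sum>k\<in>A. pd i (g k) z)"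
  using assms
proof (induction A rule: infinite_finite_induct)
  case (insert k A)
  then show ?case using cdiff_add[of "g k" z "\<lambda>z. \<Sum>k\<in>A. g k z" i] by simp
qed (simp_all add: cdiff_const)

lemma cdiff_inverse:
  assumes "cdiff_at g z" "g z \<noteq> 0"
  shows "cdiff_at (\<lambda>z. inverse (g z)) z"
proof -
  have "((\<lambda>z. inverse (g z)) has_derivative (\<lambda>h. - (inverse (g z) * (\<Sum>k\<in>UNIV. pd k g z * h $ k) * inverse (g z)))) (at z)"
    using Deriv.has_derivative_inverse[OF assms(2) cdiff_atD[OF assms(1)]] .
  also have "(\<lambda>h. - (inverse (g z) * (\<Sum>k\<in>UNIV. pd k g z * h $ k) * inverse (g z))) =
      (\<lambda>h. \<Sum>k\<in>UNIV. (- inverse (g z) * pd k g z * inverse (g z)) * h $ k)"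
    by (simp add: sum_distrib_left sum_distrib_right sum_negf mult_ac)
  finally show ?thesis by (rule conjunct1[OF has_derivative_imp_cdiff])
qed

section \<open>Germs\<close>

lemma holomorphic_near_ball:
  "holomorphic_near x g \<longleftrightarrow> (\<exists>r>0. \<forall>z\<in>ball x r. cdiff_at g z)"
  unfolding holomorphic_near_def eventually_nhds_metric by (auto simp: dist_commute)

lemma holomorphic_near_const [simp, intro]: "holomorphic_near x (\<lambda>z. c)"
  by (simp add: holomorphic_near_def cdiff_const)

lemma holomorphic_near_zero [simp, intro]: "holomorphic_near x 0"
  using holomorphic_near_const[of x 0] by (simp add: zero_fun_def)

lemma holomorphic_near_coord [intro]: "holomorphic_near x (\<lambda>z. z $ j)"
  by (simp add: holomorphic_near_def cdiff_coord)

lemma holomorphic_near_add [intro]: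
  "holomorphic_near x g \<Longrightarrow> holomorphic_near x h \<Longrightarrow> holomorphic_near x (\<lambda>z. g z + h z)"
  unfolding holomorphic_near_def by (erule (1) eventually_elim2) (simp add: cdiff_add)

lemma holomorphic_near_diff [intro]:
  "holomorphic_near x g \<Longrightarrow> holomorphic_near x h \<Longrightarrow> holomorphic_near x (\<lambda>z. g z - h z)"
  unfolding holomorphic_near_def by (erule (1) eventually_elim2) (simp add: cdiff_diff)

lemma holomorphic_near_mult [intro]:
  "holomorphic_near x g \<Longrightarrow> holomorphic_near x h \<Longrightarrow> holomorphic_near x (\<lambda>z. g z * h z)"
  unfolding holomorphic_near_def by (erule (1) eventually_elim2) (simp add: cdiff_mult)

lemma holomorphic_near_power [intro]:
  "holomorphic_near x g \<Longrightarrow> holomorphic_near x (\<lambda>z. g z ^ k)"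
  by (induction k) auto

lemma holomorphic_near_sum [intro]:
  "(\<And>k. k \<in> A \<Longrightarrow> holomorphic_near x (g k)) \<Longrightarrow> holomorphic_near x (\<lambda>z. \<Sum>k\<in>A. g k z)"
  by (induction A rule: infinite_finite_induct) auto

lemma holomorphic_near_inverse:
  assumes "holomorphic_near x g" "g x \<noteq> 0"
  shows "holomorphic_near x (\<lambda>z. inverse (g z))" "\<forall>\<^sub>F z in nhds x. g z \<noteq> 0"
proof -
  have "isCont g x"
    using assms(1) eventually_nhds_x_imp_x cdiff_at_imp_continuous unfolding holomorphic_near_def by blast
  then have "(g \<longlongrightarrow> g x) (nhds x)" by (simp add: isCont_def tendsto_nhds_iff)
  then show ev: "\<forall>\<^sub>F z in nhds x. g z \<noteq> 0"
    using assms(2) tendsto_imp_eventually_ne by blast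
  show "holomorphic_near x (\<lambda>z. inverse (g z))"
    using assms(1) ev unfolding holomorphic_near_def by eventually_elim (rule cdiff_inverse)
qed

lemma holomorphic_near_pd [intro]:
  assumes "holomorphic_near x g"
  shows "holomorphic_near x (pd i g)"
proof -
  obtain r where r: "r > 0" "\<And>z. z \<in> ball x r \<Longrightarrow> cdiff_at g z"
    using assms unfolding holomorphic_near_ball by blast
  have "cdiff_at (pd i g) z" if "z \<in> ball x r" for z
    by (rule cdiff_pd(1)[of "ball x r", OF open_ball r(2) that])
  then show ?thesis using r(1) unfolding holomorphic_near_ball by blast
qed

lemma pd_commute_near:
  assumes "holomorphic_near x g"
  shows "\<forall>\<^sub>F z in nhds x. pd i (pd j g) z = pd j (pd i g) z"
proof -
  obtain r where r: "r > 0" "\<And>z. z \<in> ball x r \<Longrightarrow> cdiff_at g z"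
    using assms unfolding holomorphic_near_ball by blast
  have "\<forall>\<^sub>F z in nhds x. z \<in> ball x r" using r by (intro eventually_nhds_in_open) auto
  then show ?thesis
    by eventually_elim (rule pd_commute[of "ball x r", OF open_ball r(2)])
qed

lemma pd_cong_near:
  assumes "\<forall>\<^sub>F z in nhds x. g z = h z"
  shows "\<forall>\<^sub>F z in nhds x. pd i g z = pd i h z"
proof -
  have "\<forall>\<^sub>F y in nhds x. \<forall>\<^sub>F z in nhds y. g z = h z"
    using assms by (simp add: eventually_eventually)
  then show ?thesis by eventually_elim (rule pd_eventually_cong)
qed

section \<open>Scaling the coordinates around a point\<close>

definition rescale :: "'n cspace \<Rightarrow> ('n \<Rightarrow> complex) \<Rightarrow> 'n::finite cspace \<Rightarrow> 'n cspace" where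
  "rescale x l z = x + (\<chi> k. l k * (z $ k - x $ k))"

lemma rescale_nth [simp]: "rescale x l z $ k = x $ k + l k * (z $ k - x $ k)"
  by (simp add: rescale_def)

lemma rescale_one [simp]: "rescale x (\<lambda>_. 1) z = z"
  by (simp add: vec_eq_iff)

lemma rescale_zero [simp]: "rescale x (\<lambda>_. 0) z = x"
  by (simp add: vec_eq_iff)

lemma rescale_ball:
  assumes "\<And>k. norm (l k) \<le> 1" "z \<in> ball x r"
  shows "rescale x l z \<in> ball x r"
proof -
  have "norm (rescale x l z - x) \<le> norm (z - x)"
    by (rule norm_le_componentwise_cart) (use assms(1) in \<open>auto simp: norm_mult intro: mult_left_le_one_le\<close>)
  then show ?thesis using assms(2) by (simp add: dist_norm norm_minus_commute)
qed

text \<open>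
  The integral operators below average over substitutions which move no coordinate away from that of
  \<open>x\<close>, so they preserve the functions that are holomorphic on a ball around \<open>x\<close>.
\<close>

lemma rescale_integral:
  fixes lam :: "real \<Rightarrow> 'n::finite \<Rightarrow> complex"
  assumes g: "\<And>z. z \<in> ball x r \<Longrightarrow> cdiff_at g z" and w: "continuous_on {0..1} w"
    and lam: "\<And>k. continuous_on {0..1} (\<lambda>t. lam t k)"
    and le: "\<And>t k. t \<in> {0..1} \<Longrightarrow> norm (lam t k) \<le> 1" and z: "z \<in> ball x r"
  shows "cdiff_at (\<lambda>z. integral {0..1} (\<lambda>t. w t * g (rescale x (lam t) z))) z"
    and "pd i (\<lambda>z. integral {0..1} (\<lambda>t. w t * g (rescale x (lam t) z))) z =
      integral {0..1} (\<lambda>t. w t * lam t i * pd i g (rescale x (lam t) z))"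
proof -
  define v where "v t = x - (\<chi> k. lam t k * x $ k)" for t
  have eq: "v t + (\<chi> k. lam t k * z $ k) = rescale x (lam t) z" for t z
    by (simp add: v_def vec_eq_iff algebra_simps)
  have v: "continuous_on {0..1} v" unfolding v_def by (intro continuous_intros lam)
  have mp: "v t + (\<chi> k. lam t k * z $ k) \<in> ball x r" if "t \<in> {0..1}" "z \<in> ball x r" for t z
    unfolding eq by (rule rescale_ball[OF le]) (use that in auto)
  have pc: "continuous_on (ball x r) (pd i g)" for i
    by (rule continuous_on_pd[OF open_ball]) (rule g)
  note P = pd_integral[where U = "ball x r" and V = "ball x r" and v = v and lam = lam and w = w and g = g, OF _ pc w v lam open_ball z mp, unfolded eq]
  show "cdiff_at (\<lambda>z. integral {0..1} (\<lambda>t. w t * g (rescale x (lam t) z))) z" by (rule P(1)) (rule g)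
  show "pd i (\<lambda>z. integral {0..1} (\<lambda>t. w t * g (rescale x (lam t) z))) z =
      integral {0..1} (\<lambda>t. w t * lam t i * pd i g (rescale x (lam t) z))" by (rule P(2)) (rule g)
qed

lemma rescale_deriv:
  fixes lam :: "real \<Rightarrow> 'n::finite \<Rightarrow> complex"
  assumes "cdiff_at g (rescale x (lam t) z)" and lam: "\<And>t. lam t = (\<lambda>k. c k + of_real t * d k)"
  shows "((\<lambda>t. g (rescale x (lam t) z)) has_vector_derivative
    (\<Sum>k\<in>UNIV. d k * (z $ k - x $ k) * pd k g (rescale x (lam t) z))) (at t within T)"
proof -
  let ?h = "\<chi> k. d k * (z $ k - x $ k)"
  have eq: "rescale x (lam t) z = rescale x c z + t *\<^sub>R ?h" for t
    unfolding lam vec_eq_iff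
    by (simp only: rescale_nth vector_add_component vector_scaleR_component vec_lambda_beta)
      (simp add: scaleR_conv_of_real algebra_simps)
  have "((\<lambda>t. rescale x c z + t *\<^sub>R ?h) has_derivative (\<lambda>s. s *\<^sub>R ?h)) (at t)"
    by (auto intro!: derivative_eq_intros)
  then have 1: "((\<lambda>t. rescale x (lam t) z) has_derivative (\<lambda>s. s *\<^sub>R ?h)) (at t)"
    unfolding eq .
  from diff_chain_at[OF 1 cdiff_atD[OF assms(1)]]
  have "((\<lambda>t. g (rescale x (lam t) z)) has_derivative
     (\<lambda>s. \<Sum>k\<in>UNIV. pd k g (rescale x (lam t) z) * (s *\<^sub>R ?h) $ k)) (at t)"
    by (simp add: o_def)
  also have "(\<lambda>s. \<Sum>k\<in>UNIV. pd k g (rescale x (lam t) z) * (s *\<^sub>R ?h) $ k) =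
    (\<lambda>s. s *\<^sub>R (\<Sum>k\<in>UNIV. d k * (z $ k - x $ k) * pd k g (rescale x (lam t) z)))"
    by (simp only: vector_scaleR_component vec_lambda_beta scaleR_sum_right)
      (simp add: scaleR_conv_of_real mult_ac)
  finally have "((\<lambda>t. g (rescale x (lam t) z)) has_vector_derivative
     (\<Sum>k\<in>UNIV. d k * (z $ k - x $ k) * pd k g (rescale x (lam t) z))) (at t)"
    unfolding has_vector_derivative_def .
  then show ?thesis by (rule has_vector_derivative_at_within)
qed

lemma
  fixes lam :: "real \<Rightarrow> 'n::finite \<Rightarrow> complex"
  assumes g: "\<And>z. z \<in> ball x r \<Longrightarrow> cdiff_at g z" and z: "z \<in> ball x r"
    and lam: "\<And>t. lam t = (\<lambda>k. c k + of_real t * d k)"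
    and le: "\<And>t k. t \<in> {0..1} \<Longrightarrow> norm (lam t k) \<le> 1"
  shows rescale_path_deriv: "t \<in> {0..1} \<Longrightarrow> ((\<lambda>t. g (rescale x (lam t) z)) has_vector_derivative
      (\<Sum>k\<in>UNIV. d k * (z $ k - x $ k) * pd k g (rescale x (lam t) z))) (at t within {0..1})"
    and rescale_path_continuous: "continuous_on {0..1} (\<lambda>t. g (rescale x (lam t) z))"
    and rescale_path_continuous_pd: "continuous_on {0..1} (\<lambda>t. pd i g (rescale x (lam t) z))"
proof -
  have mem: "rescale x (lam t) z \<in> ball x r" if "t \<in> {0..1}" for t
    by (rule rescale_ball[OF le z]) (use that in auto)
  show D: "((\<lambda>t. g (rescale x (lam t) z)) has_vector_derivative
      (\<Sum>k\<in>UNIV. d k * (z $ k - x $ k) * pd k g (rescale x (lam t) z))) (at t within {0..1})" if "t \<in> {0..1}" for t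
    by (rule rescale_deriv[OF g[OF mem[OF that]] lam])
  show "continuous_on {0..1} (\<lambda>t. g (rescale x (lam t) z))"
    using D has_vector_derivative_continuous continuous_on_eq_continuous_within by blast
  have path: "continuous_on {0..1} (\<lambda>t. rescale x (lam t) z)"
    unfolding rescale_def lam by (intro continuous_intros)
  have "continuous_on (ball x r) (pd i g)"
    by (rule continuous_on_pd[OF open_ball]) (rule g)
  then show "continuous_on {0..1} (\<lambda>t. pd i g (rescale x (lam t) z))"
    by (rule continuous_on_compose2[OF _ path]) (use mem in auto)
qed

subsection \<open>The cone operators\<close>

text \<open>
  The inverse of the operator \<open>p + 1 + \<Sum>\<^sub>i (z\<^sub>i - x\<^sub>i) \<partial>/\<partial>z\<^sub>i\<close> (see \<open>cone_int_euler\<close>).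
\<close>

definition cone_int :: "'n cspace \<Rightarrow> nat \<Rightarrow> ('n::finite cspace \<Rightarrow> complex) \<Rightarrow> 'n cspace \<Rightarrow> complex" where
  "cone_int x p g z = integral {0..1} (\<lambda>t. of_real t ^ p * g (rescale x (\<lambda>_. of_real t) z))"

lemma cone_int_holomorphic [intro]:
  assumes "holomorphic_near x g"
  shows "holomorphic_near x (cone_int x p g)"
proof -
  obtain r where r: "r > 0" "\<And>z. z \<in> ball x r \<Longrightarrow> cdiff_at g z"
    using assms unfolding holomorphic_near_ball by blast
  have "cdiff_at (cone_int x p g) z" if "z \<in> ball x r" for z
    unfolding cone_int_def
    by (rule rescale_integral(1)[of x r, OF r(2) _ _ _ that]) (auto intro!: continuous_intros)
  then show ?thesis using r(1) unfolding holomorphic_near_ball by blast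
qed

lemma pd_cone_int:
  assumes "holomorphic_near x g"
  shows "\<forall>\<^sub>F z in nhds x. pd i (cone_int x p g) z = cone_int x (Suc p) (pd i g) z"
proof -
  obtain r where r: "r > 0" "\<And>z. z \<in> ball x r \<Longrightarrow> cdiff_at g z"
    using assms unfolding holomorphic_near_ball by blast
  have "\<forall>\<^sub>F z in nhds x. z \<in> ball x r" using r by (intro eventually_nhds_in_open) auto
  then show ?thesis
  proof eventually_elim
    case (elim z)
    show ?case
      unfolding cone_int_def
      by (subst rescale_integral(2)[of x r, OF r(2) _ _ _ elim]) (auto intro!: continuous_intros simp: mult_ac)
  qed
qed

text \<open>
  The left-hand side is the integral over \<open>[0, 1]\<close> of the derivative of \<open>t \<mapsto> t\<^bsup>p + 1\<^esup> g (x + t (z - x))\<close>.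
\<close>

lemma cone_int_euler:
  assumes "holomorphic_near x g"
  shows "\<forall>\<^sub>F z in nhds x. (\<Sum>i\<in>UNIV. (z $ i - x $ i) * pd i (cone_int x p g) z) + of_nat (Suc p) * cone_int x p g z = g z"
proof -
  obtain r where r: "r > 0" "\<And>z. z \<in> ball x r \<Longrightarrow> cdiff_at g z"
    using assms unfolding holomorphic_near_ball by blast
  have "\<forall>\<^sub>F z in nhds x. z \<in> ball x r" using r by (intro eventually_nhds_in_open) auto
  moreover have "\<forall>\<^sub>F z in nhds x. \<forall>i. pd i (cone_int x p g) z = cone_int x (Suc p) (pd i g) z"
    by (intro eventually_all_finite pd_cone_int assms)
  ultimately show ?thesis
  proof eventually_elim
    case (elim z)
    define \<gamma> where "\<gamma> t = rescale x (\<lambda>_. complex_of_real t) z" for t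
    note path = rescale_path_deriv[of x r g z "\<lambda>t k. of_real t" "\<lambda>_. 0" "\<lambda>_. 1"]
      rescale_path_continuous[of x r g z "\<lambda>t k. of_real t" "\<lambda>_. 0" "\<lambda>_. 1"]
      rescale_path_continuous_pd[of x r g z "\<lambda>t k. of_real t" "\<lambda>_. 0" "\<lambda>_. 1"]
    have gd: "((\<lambda>t. g (\<gamma> t)) has_vector_derivative (\<Sum>k\<in>UNIV. (z $ k - x $ k) * pd k g (\<gamma> t))) (at t within {0..1})"
      if "t \<in> {0..1}" for t
      using path(1)[OF r(2)] that elim by (simp add: \<gamma>_def)
    have gc: "continuous_on {0..1} (\<lambda>t. g (\<gamma> t))"
      using path(2)[OF r(2)] elim by (simp add: \<gamma>_def)
    have pc: "continuous_on {0..1} (\<lambda>t. pd i g (\<gamma> t))" for i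
      using path(3)[OF r(2)] elim by (simp add: \<gamma>_def)
    have pw: "((\<lambda>t. complex_of_real t ^ Suc p) has_vector_derivative of_nat (Suc p) * complex_of_real t ^ p) (at t within T)" for t T
      by (rule has_vector_derivative_real_field[where f = "\<lambda>z. z ^ Suc p"])
        (use DERIV_power[OF DERIV_ident, where x = "complex_of_real t" and n = "Suc p" and s = UNIV] in simp)
    have "((\<lambda>t. of_real t ^ Suc p * (\<Sum>k\<in>UNIV. (z $ k - x $ k) * pd k g (\<gamma> t)) +
        (of_nat (Suc p) * complex_of_real t ^ p) * g (\<gamma> t)) has_integral
        (of_real 1 ^ Suc p * g (\<gamma> 1) - of_real 0 ^ Suc p * g (\<gamma> 0))) {0..1}"
      by (rule fundamental_theorem_of_calculus) (auto intro!: has_vector_derivative_mult pw gd simp del: power_Suc of_nat_Suc)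
    then have "integral {0..1} (\<lambda>t. of_real t ^ Suc p * (\<Sum>k\<in>UNIV. (z $ k - x $ k) * pd k g (\<gamma> t)) +
        (of_nat (Suc p) * complex_of_real t ^ p) * g (\<gamma> t)) = g z"
      by (subst integral_unique) (assumption, simp add: \<gamma>_def)
    also have "integral {0..1} (\<lambda>t. of_real t ^ Suc p * (\<Sum>k\<in>UNIV. (z $ k - x $ k) * pd k g (\<gamma> t)) +
        (of_nat (Suc p) * complex_of_real t ^ p) * g (\<gamma> t)) =
       integral {0..1} (\<lambda>t. \<Sum>k\<in>UNIV. (z $ k - x $ k) * (of_real t ^ Suc p * pd k g (\<gamma> t))) +
       integral {0..1} (\<lambda>t. of_nat (Suc p) * (complex_of_real t ^ p * g (\<gamma> t)))"
      by (subst integral_add[symmetric])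
        (auto intro!: integrable_continuous_real continuous_intros gc pc simp: sum_distrib_left mult_ac)
    also have "integral {0..1} (\<lambda>t. of_nat (Suc p) * (complex_of_real t ^ p * g (\<gamma> t))) = of_nat (Suc p) * cone_int x p g z"
      unfolding cone_int_def \<gamma>_def by (rule integral_mult_right)
    also have "integral {0..1} (\<lambda>t. \<Sum>k\<in>UNIV. (z $ k - x $ k) * (of_real t ^ Suc p * pd k g (\<gamma> t))) =
       (\<Sum>k\<in>UNIV. (z $ k - x $ k) * cone_int x (Suc p) (pd k g) z)"
      unfolding cone_int_def \<gamma>_def[symmetric]
      by (subst integral_sum) (auto intro!: integrable_continuous_real continuous_intros pc simp del: power_Suc)
    finally show ?case using elim(2) by simp
  qed
qed

text \<open>
  Integrate the derivative of \<open>g\<close> along the segment from \<open>x\<close> to \<open>z\<close>.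
\<close>

lemma hadamard:
  assumes "holomorphic_near x g"
  shows "\<forall>\<^sub>F z in nhds x. g z = g x + (\<Sum>i\<in>UNIV. (z $ i - x $ i) * cone_int x 0 (pd i g) z)"
proof -
  obtain r where r: "r > 0" "\<And>z. z \<in> ball x r \<Longrightarrow> cdiff_at g z"
    using assms unfolding holomorphic_near_ball by blast
  have "\<forall>\<^sub>F z in nhds x. z \<in> ball x r" using r by (intro eventually_nhds_in_open) auto
  then show ?thesis
  proof eventually_elim
    case (elim z)
    define \<gamma> where "\<gamma> t = rescale x (\<lambda>_. complex_of_real t) z" for t
    note path = rescale_path_deriv[of x r g z "\<lambda>t k. of_real t" "\<lambda>_. 0" "\<lambda>_. 1"]
      rescale_path_continuous[of x r g z "\<lambda>t k. of_real t" "\<lambda>_. 0" "\<lambda>_. 1"]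
      rescale_path_continuous_pd[of x r g z "\<lambda>t k. of_real t" "\<lambda>_. 0" "\<lambda>_. 1"]
    have gd: "((\<lambda>t. g (\<gamma> t)) has_vector_derivative (\<Sum>k\<in>UNIV. (z $ k - x $ k) * pd k g (\<gamma> t))) (at t within {0..1})"
      if "t \<in> {0..1}" for t
      using path(1)[OF r(2)] that elim by (simp add: \<gamma>_def)
    have pc: "continuous_on {0..1} (\<lambda>t. pd i g (\<gamma> t))" for i
      using path(3)[OF r(2)] elim by (simp add: \<gamma>_def)
    have "((\<lambda>t. \<Sum>k\<in>UNIV. (z $ k - x $ k) * pd k g (\<gamma> t)) has_integral (g (\<gamma> 1) - g (\<gamma> 0))) {0..1}"
      by (rule fundamental_theorem_of_calculus) (auto intro!: gd)
    then have "g z - g x = integral {0..1} (\<lambda>t. \<Sum>k\<in>UNIV. (z $ k - x $ k) * pd k g (\<gamma> t))"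
      by (subst integral_unique) (assumption, simp add: \<gamma>_def)
    also have "\<dots> = (\<Sum>k\<in>UNIV. (z $ k - x $ k) * cone_int x 0 (pd k g) z)"
      unfolding cone_int_def \<gamma>_def[symmetric]
      by (subst integral_sum) (auto intro!: integrable_continuous_real continuous_intros pc)
    finally show ?case by (simp add: algebra_simps)
  qed
qed

subsection \<open>Division by a coordinate\<close>

lemma holomorphic_near_restrict:
  assumes "holomorphic_near x g"
  shows "holomorphic_near x (\<lambda>z. g (rescale x (\<lambda>k. if k = j then 0 else 1) z))"
proof -
  obtain r where r: "r > 0" "\<And>z. z \<in> ball x r \<Longrightarrow> cdiff_at g z"
    using assms unfolding holomorphic_near_ball by blast
  have "cdiff_at (\<lambda>z. integral {0..1} (\<lambda>t::real. 1 * g (rescale x ((\<lambda>t k. if k = j then 0 else 1) t) z))) z" if "z \<in> ball x r" for z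
    by (rule rescale_integral(1)[of x r, OF r(2) _ _ _ that]) (auto intro!: continuous_intros)
  then show ?thesis using r(1) unfolding holomorphic_near_ball by auto
qed

text \<open>
  The operator \<open>h \<mapsto> \<integral>\<^sub>0\<^sup>1 \<partial>\<^sub>j h (\<dots>, x\<^sub>j + t (z\<^sub>j - x\<^sub>j), \<dots>) dt\<close> divides by \<open>z\<^sub>j - x\<^sub>j\<close> and is linear over
  functions of the other coordinates, so applying it to the hypothesis gives the conclusion. This is
  what makes powers of the coordinates a regular sequence.
\<close>

lemma coord_regular:
  fixes x :: "'n::finite cspace"
  assumes g: "holomorphic_near x g" and b: "\<And>i. i \<in> S \<Longrightarrow> holomorphic_near x (b i)"
    and "j \<notin> S"
    and eq: "\<forall>\<^sub>F z in nhds x. (z $ j - x $ j) * g z = (\<Sum>i\<in>S. (z $ i - x $ i) ^ v i * b i z)"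
  shows "\<exists>b'. (\<forall>i. holomorphic_near x (b' i)) \<and>
    (\<forall>\<^sub>F z in nhds x. g z = (\<Sum>i\<in>S. (z $ i - x $ i) ^ v i * b' i z))"
proof -
  have "finite S" by simp
  define b1 where "b1 i = (if i \<in> S then b i else (\<lambda>_. 0))" for i
  have b1: "holomorphic_near x (b1 i)" for i using b by (simp add: b1_def)
  define lam where "lam t k = (if k = j then complex_of_real t else 1)" for t k
  define b' where "b' i z = integral {0..1} (\<lambda>t. 1 * pd j (b1 i) (rescale x (lam t) z))" for i z
  have lamc: "continuous_on {0..1} (\<lambda>t. lam t k)" for k
    by (cases "k = j") (auto simp: lam_def intro!: continuous_intros)
  have laml: "norm (lam t k) \<le> 1" if "t \<in> {0..1}" for t k using that by (auto simp: lam_def)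
  have hol: "holomorphic_near x (b' i)" for i
  proof -
    obtain r where r: "r > 0" "\<And>z. z \<in> ball x r \<Longrightarrow> cdiff_at (pd j (b1 i)) z"
      using holomorphic_near_pd[OF b1] unfolding holomorphic_near_ball by blast
    have "cdiff_at (b' i) z" if "z \<in> ball x r" for z
      unfolding b'_def by (rule rescale_integral(1)[of x r, OF r(2) _ lamc laml that]) (auto intro!: continuous_intros)
    then show ?thesis using r(1) unfolding holomorphic_near_ball by blast
  qed
  have "\<forall>\<^sub>F z in nhds x. cdiff_at g z \<and> (\<forall>i. cdiff_at (b1 i) z) \<and>
    (z $ j - x $ j) * g z = (\<Sum>i\<in>S. (z $ i - x $ i) ^ v i * b1 i z)"
    using g b1 eq unfolding holomorphic_near_def
    by (intro eventually_conj eventually_all_finite) (auto simp: b1_def)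
  then obtain r where r0: "r > 0" "\<forall>z. dist z x < r \<longrightarrow> cdiff_at g z \<and> (\<forall>i. cdiff_at (b1 i) z) \<and>
      (z $ j - x $ j) * g z = (\<Sum>i\<in>S. (z $ i - x $ i) ^ v i * b1 i z)"
    unfolding eventually_nhds_metric by blast
  then have r: "r > 0" "\<And>z. z \<in> ball x r \<Longrightarrow> cdiff_at g z"
     "\<And>z i. z \<in> ball x r \<Longrightarrow> cdiff_at (b1 i) z"
     "\<And>z. z \<in> ball x r \<Longrightarrow> (z $ j - x $ j) * g z = (\<Sum>i\<in>S. (z $ i - x $ i) ^ v i * b1 i z)"
    by (auto simp: dist_commute)
  have "\<forall>\<^sub>F z in nhds x. z \<in> ball x r" using r by (intro eventually_nhds_in_open) auto
  then have "\<forall>\<^sub>F z in nhds x. g z = (\<Sum>i\<in>S. (z $ i - x $ i) ^ v i * b' i z)"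
  proof eventually_elim
    case (elim z)
    define \<gamma> where "\<gamma> t = rescale x (lam t) z" for t
    have mem: "\<gamma> t \<in> ball x r" if "t \<in> {0..1}" for t
      unfolding \<gamma>_def by (rule rescale_ball[OF laml]) (use that elim in auto)
    have gac: "continuous_on {0..1} \<gamma>"
      unfolding \<gamma>_def rescale_def by (intro continuous_intros lamc)
    have pc: "continuous_on {0..1} (\<lambda>t. pd j (b1 i) (\<gamma> t))" for i
      by (rule continuous_on_compose2[OF continuous_on_pd[of "ball x r", OF open_ball r(3)] gac]) (use mem in auto)
    have gd: "((\<lambda>t. g (\<gamma> t)) has_vector_derivative (z $ j - x $ j) * pd j g (\<gamma> t)) (at t within {0..1})"
      if "t \<in> {0..1}" for t
    proof -
      have "((\<lambda>t. g (\<gamma> t)) has_vector_derivative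
          (\<Sum>k\<in>UNIV. (if k = j then 1 else 0) * (z $ k - x $ k) * pd k g (\<gamma> t))) (at t within {0..1})"
        unfolding \<gamma>_def using r(2)[OF mem[OF that], unfolded \<gamma>_def]
      proof (rule rescale_deriv)
        show "lam t = (\<lambda>k. (if k = j then 0 else 1) + of_real t * (if k = j then 1 else 0))" for t
          by (auto simp: lam_def)
      qed
      then show ?thesis by (simp only: mult.assoc sum_delta_mult)
    qed
    \<comment> \<open>both sides of the hypothesis have the same derivative in direction \<open>j\<close>\<close>
    have key: "(z $ j - x $ j) * of_real t * pd j g (\<gamma> t) + g (\<gamma> t) = (\<Sum>i\<in>S. (z $ i - x $ i) ^ v i * pd j (b1 i) (\<gamma> t))"
      if t: "t \<in> {0..1}" for t
    proof -
      let ?y = "\<gamma> t"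
      have y: "?y \<in> ball x r" by (rule mem[OF t])
      have c: "cdiff_at (\<lambda>z. z $ i - x $ i) y \<and> pd j (\<lambda>z. z $ i - x $ i) y = (if j = i then 1 else 0)" for i y
        using cdiff_diff[of "\<lambda>z. z $ i" y "\<lambda>_. x $ i" j] cdiff_coord[of i y j] cdiff_const[of "x $ i" y j] by simp
      have pw: "cdiff_at (\<lambda>z. (z $ i - x $ i) ^ m) y \<and> pd j (\<lambda>z. (z $ i - x $ i) ^ m) y = 0" if "i \<noteq> j" for i m y
      proof (induction m)
        case (Suc m)
        then show ?case using cdiff_mult[of "\<lambda>z. z $ i - x $ i" y "\<lambda>z. (z $ i - x $ i) ^ m" j] c[of i y] that by simp
      qed (simp add: cdiff_const)
      have "\<forall>\<^sub>F y in nhds ?y. y \<in> ball x r" using y by (intro eventually_nhds_in_open) auto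
      then have "\<forall>\<^sub>F y in nhds ?y. (y $ j - x $ j) * g y = (\<Sum>i\<in>S. (y $ i - x $ i) ^ v i * b1 i y)"
        by eventually_elim (rule r(4))
      then have "pd j (\<lambda>y. (y $ j - x $ j) * g y) ?y = pd j (\<lambda>y. \<Sum>i\<in>S. (y $ i - x $ i) ^ v i * b1 i y) ?y"
        by (rule pd_eventually_cong)
      also have "pd j (\<lambda>y. (y $ j - x $ j) * g y) ?y = (?y $ j - x $ j) * pd j g ?y + g ?y"
        using cdiff_mult[of "\<lambda>y. y $ j - x $ j" ?y g j] c[of j ?y] r(2)[OF y] by simp
      also have "pd j (\<lambda>y. \<Sum>i\<in>S. (y $ i - x $ i) ^ v i * b1 i y) ?y = (\<Sum>i\<in>S. pd j (\<lambda>y. (y $ i - x $ i) ^ v i * b1 i y) ?y)"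
      proof (rule conjunct2[OF cdiff_sum])
        fix i assume "i \<in> S"
        then have "i \<noteq> j" using \<open>j \<notin> S\<close> by auto
        then show "cdiff_at (\<lambda>y. (y $ i - x $ i) ^ v i * b1 i y) ?y"
          using cdiff_mult[of "\<lambda>y. (y $ i - x $ i) ^ v i" ?y "b1 i"] pw r(3)[OF y] by blast
      qed
      also have "\<dots> = (\<Sum>i\<in>S. (?y $ i - x $ i) ^ v i * pd j (b1 i) ?y)"
      proof (rule sum.cong[OF refl])
        fix i assume "i \<in> S"
        then have "i \<noteq> j" using \<open>j \<notin> S\<close> by auto
        then show "pd j (\<lambda>y. (y $ i - x $ i) ^ v i * b1 i y) ?y = (?y $ i - x $ i) ^ v i * pd j (b1 i) ?y"
          using cdiff_mult[of "\<lambda>y. (y $ i - x $ i) ^ v i" ?y "b1 i" j] pw r(3)[OF y] by simp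
      qed
      also have "\<dots> = (\<Sum>i\<in>S. (z $ i - x $ i) ^ v i * pd j (b1 i) ?y)"
        using \<open>j \<notin> S\<close> by (intro sum.cong) (auto simp: \<gamma>_def lam_def)
      finally show ?thesis by (simp add: \<gamma>_def lam_def mult_ac)
    qed
    have td: "((\<lambda>t. complex_of_real t) has_vector_derivative 1) (at t within T)" for t T
      using has_vector_derivative_of_real[of "\<lambda>t. t" 1 "at t within T", OF DERIV_ident] by simp
    have "((\<lambda>t. of_real t * ((z $ j - x $ j) * pd j g (\<gamma> t)) + 1 * g (\<gamma> t)) has_integral
       (of_real 1 * g (\<gamma> 1) - of_real 0 * g (\<gamma> 0))) {0..1}"
    proof (rule fundamental_theorem_of_calculus)
      fix t :: real assume "t \<in> {0..1}"
      then show "((\<lambda>t. of_real t * g (\<gamma> t)) has_vector_derivative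
          of_real t * ((z $ j - x $ j) * pd j g (\<gamma> t)) + 1 * g (\<gamma> t)) (at t within {0..1})"
        by (rule has_vector_derivative_mult[OF td gd])
    qed simp
    then have "((\<lambda>t. \<Sum>i\<in>S. (z $ i - x $ i) ^ v i * pd j (b1 i) (\<gamma> t)) has_integral
       (of_real 1 * g (\<gamma> 1) - of_real 0 * g (\<gamma> 0))) {0..1}"
      by (rule has_integral_eq[rotated]) (use key in \<open>auto simp: mult_ac\<close>)
    moreover have "\<gamma> 1 = z" by (simp add: \<gamma>_def lam_def vec_eq_iff)
    ultimately have "integral {0..1} (\<lambda>t. \<Sum>i\<in>S. (z $ i - x $ i) ^ v i * pd j (b1 i) (\<gamma> t)) = g z"
      by (subst integral_unique) (assumption, simp)
    also have "integral {0..1} (\<lambda>t. \<Sum>i\<in>S. (z $ i - x $ i) ^ v i * pd j (b1 i) (\<gamma> t)) =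
       (\<Sum>i\<in>S. (z $ i - x $ i) ^ v i * b' i z)"
      unfolding b'_def \<gamma>_def[symmetric]
      by (subst integral_sum) (auto intro!: integrable_continuous_real continuous_intros pc)
    finally show ?case by simp
  qed
  with hol show ?thesis by blast
qed

section \<open>Polynomial functions\<close>

definition monom_fun :: "('n::finite \<Rightarrow> nat) \<Rightarrow> 'n cspace \<Rightarrow> complex" where
  "monom_fun \<alpha> z = (\<Prod>i\<in>UNIV. (z $ i) ^ \<alpha> i)"

lemma polyfun_iff:
  "g \<in> polyfun \<longleftrightarrow> (\<exists>A c. finite A \<and> g = (\<lambda>z. \<Sum>\<alpha>\<in>A. c \<alpha> * monom_fun \<alpha> z))"
  by (simp add: polyfun_def monom_fun_def)

lemma polyfun_term: "(\<lambda>z. c * monom_fun \<alpha> z) \<in> polyfun"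
  unfolding polyfun_iff by (intro exI[of _ "{\<alpha>}"] exI[of _ "\<lambda>_. c"]) auto

lemma polyfun_add [intro]:
  assumes "g \<in> polyfun" "h \<in> polyfun"
  shows "(\<lambda>z. g z + h z) \<in> polyfun"
proof -
  obtain A c where A: "finite A" "g = (\<lambda>z. \<Sum>\<alpha>\<in>A. c \<alpha> * monom_fun \<alpha> z)"
    using assms(1) unfolding polyfun_iff by blast
  obtain B d where B: "finite B" "h = (\<lambda>z. \<Sum>\<alpha>\<in>B. d \<alpha> * monom_fun \<alpha> z)"
    using assms(2) unfolding polyfun_iff by blast
  let ?c = "\<lambda>\<alpha>. if \<alpha> \<in> A then c \<alpha> else 0" and ?d = "\<lambda>\<alpha>. if \<alpha> \<in> B then d \<alpha> else 0"
  have "g z = (\<Sum>\<alpha>\<in>A \<union> B. ?c \<alpha> * monom_fun \<alpha> z)" for z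
    unfolding A(2) using A(1) B(1) by (intro sum.mono_neutral_cong_left) auto
  moreover have "h z = (\<Sum>\<alpha>\<in>A \<union> B. ?d \<alpha> * monom_fun \<alpha> z)" for z
    unfolding B(2) using A(1) B(1) by (intro sum.mono_neutral_cong_left) auto
  ultimately have "(\<lambda>z. g z + h z) = (\<lambda>z. \<Sum>\<alpha>\<in>A \<union> B. (?c \<alpha> + ?d \<alpha>) * monom_fun \<alpha> z)"
    by (simp only: distrib_right sum.distrib)
  then show ?thesis
    unfolding polyfun_iff using A(1) B(1) by (intro exI[of _ "A \<union> B"] exI[of _ "\<lambda>\<alpha>. ?c \<alpha> + ?d \<alpha>"]) auto
qed

lemma polyfun_const [simp, intro]: "(\<lambda>z. c) \<in> polyfun"
  using polyfun_term[of c "\<lambda>_. 0"] by (simp add: monom_fun_def)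

lemma polyfun_zero [simp, intro]: "0 \<in> polyfun"
  using polyfun_const[of 0] by (simp add: zero_fun_def)

lemma polyfun_coord [intro]: "(\<lambda>z. z $ j) \<in> polyfun"
proof -
  have "monom_fun (\<lambda>i. if i = j then 1 else 0) z = z $ j" for z :: "'a cspace"
  proof -
    have "monom_fun (\<lambda>i. if i = j then 1 else 0) z = (\<Prod>i\<in>UNIV. if i = j then z $ i else 1)"
      unfolding monom_fun_def by (rule prod.cong) auto
    then show ?thesis by simp
  qed
  then show ?thesis using polyfun_term[of 1 "\<lambda>i. if i = j then 1 else 0"] by simp
qed

lemma polyfun_sum [intro]:
  "(\<And>k. k \<in> A \<Longrightarrow> g k \<in> polyfun) \<Longrightarrow> (\<lambda>z. \<Sum>k\<in>A. g k z) \<in> polyfun"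
  by (induction A rule: infinite_finite_induct) auto

lemma polyfun_mult [intro]:
  assumes "g \<in> polyfun" "h \<in> polyfun"
  shows "(\<lambda>z. g z * h z) \<in> polyfun"
proof -
  obtain A c where A: "finite A" "g = (\<lambda>z. \<Sum>\<alpha>\<in>A. c \<alpha> * monom_fun \<alpha> z)"
    using assms(1) unfolding polyfun_iff by blast
  obtain B d where B: "finite B" "h = (\<lambda>z. \<Sum>\<alpha>\<in>B. d \<alpha> * monom_fun \<alpha> z)"
    using assms(2) unfolding polyfun_iff by blast
  have "(\<lambda>z. g z * h z) = (\<lambda>z. \<Sum>\<alpha>\<in>A. \<Sum>\<beta>\<in>B. (c \<alpha> * d \<beta>) * monom_fun (\<lambda>i. \<alpha> i + \<beta> i) z)"
    unfolding A(2) B(2) by (simp add: sum_product monom_fun_def power_add prod.distrib mult_ac)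
  then show ?thesis by (auto intro!: polyfun_sum polyfun_term)
qed

lemma polyfun_diff [intro]: "g \<in> polyfun \<Longrightarrow> h \<in> polyfun \<Longrightarrow> (\<lambda>z. g z - h z) \<in> polyfun"
  using polyfun_add[OF _ polyfun_mult[OF polyfun_const[of "-1"]], of g h] by simp

lemma polyfun_power [intro]: "g \<in> polyfun \<Longrightarrow> (\<lambda>z. g z ^ k) \<in> polyfun"
  by (induction k) auto

lemma polyfun_prod [intro]:
  "(\<And>k. k \<in> A \<Longrightarrow> g k \<in> polyfun) \<Longrightarrow> (\<lambda>z. \<Prod>k\<in>A. g k z) \<in> polyfun"
  by (induction A rule: infinite_finite_induct) auto

lemma polyfun_induct [consumes 1, case_names const coord add mult]:
  fixes g :: "'n::finite cspace \<Rightarrow> complex"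
  assumes "g \<in> polyfun"
    and const: "\<And>c. P (\<lambda>z. c)" and coord: "\<And>j. P (\<lambda>z. z $ j)"
    and add: "\<And>g h. g \<in> polyfun \<Longrightarrow> P g \<Longrightarrow> h \<in> polyfun \<Longrightarrow> P h \<Longrightarrow> P (\<lambda>z. g z + h z)"
    and mult: "\<And>g h. g \<in> polyfun \<Longrightarrow> P g \<Longrightarrow> h \<in> polyfun \<Longrightarrow> P h \<Longrightarrow> P (\<lambda>z. g z * h z)"
  shows "P g"
proof -
  obtain A c where A: "finite A" "g = (\<lambda>z. \<Sum>\<alpha>\<in>A. c \<alpha> * monom_fun \<alpha> z)"
    using assms(1) unfolding polyfun_iff by blast
  have pow: "P (\<lambda>z. (z $ i) ^ m)" for i m
  proof (induction m)
    case (Suc m)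
    show ?case using mult[OF polyfun_coord coord polyfun_power[OF polyfun_coord] Suc] by simp
  qed (simp add: const)
  have "P (\<lambda>z. \<Prod>i\<in>I. (z $ i) ^ \<alpha> i)" for I and \<alpha> :: "'n \<Rightarrow> nat"
    by (induction I rule: infinite_finite_induct) (auto intro!: const mult pow polyfun_prod)
  then have mon: "P (\<lambda>z. c * monom_fun \<alpha> z)" for c and \<alpha> :: "'n \<Rightarrow> nat"
    using polyfun_term[of 1 \<alpha>] by (intro mult const) (auto simp: monom_fun_def)
  show "P g" unfolding A(2) using A(1)
    by (induction A rule: finite_induct) (auto intro!: const add mon polyfun_term)
qed

lemma polyfun_cdiff: "g \<in> polyfun \<Longrightarrow> cdiff_at g z"
  by (induction rule: polyfun_induct) (simp_all add: cdiff_const cdiff_coord cdiff_add cdiff_mult)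

lemma polyfun_holomorphic_near [intro]: "g \<in> polyfun \<Longrightarrow> holomorphic_near x g"
  by (simp add: holomorphic_near_def polyfun_cdiff)

lemma polyfun_pd [intro]:
  assumes "g \<in> polyfun"
  shows "pd i g \<in> polyfun"
  using assms
proof (induction rule: polyfun_induct)
  case (const c)
  have "pd i (\<lambda>z. c) = (\<lambda>z. 0)" by (simp add: cdiff_const fun_eq_iff)
  then show ?case by (simp only: polyfun_const)
next
  case (coord j)
  have "pd i (\<lambda>z. z $ j) = (\<lambda>z. if i = j then 1 else 0)" by (simp add: cdiff_coord fun_eq_iff)
  then show ?case by (simp only: polyfun_const)
next
  case (add g h)
  then have "pd i (\<lambda>z. g z + h z) = (\<lambda>z. pd i g z + pd i h z)"
    by (simp add: fun_eq_iff cdiff_add polyfun_cdiff)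
  with add show ?case by auto
next
  case (mult g h)
  then have "pd i (\<lambda>z. g z * h z) = (\<lambda>z. g z * pd i h z + pd i g z * h z)"
    by (simp add: fun_eq_iff cdiff_mult polyfun_cdiff)
  with mult show ?case by auto
qed

lemma polyfun_restrict:
  assumes "g \<in> polyfun"
  shows "(\<lambda>z. g (rescale x l z)) \<in> polyfun"
  using assms
proof (induction rule: polyfun_induct)
  case (coord j)
  show ?case
    unfolding rescale_nth by (intro polyfun_add polyfun_mult polyfun_diff polyfun_const polyfun_coord)
next
  case (add g h)
  then show ?case by (intro polyfun_add)
next
  case (mult g h)
  then show ?case by (intro polyfun_mult)
qed simp

lemma polyfun_divide_coord:
  assumes "g \<in> polyfun"
  shows "\<exists>q\<in>polyfun. \<forall>z. g z = g (rescale x (\<lambda>k. if k = j then 0 else 1) z) + (z $ j - x $ j) * q z"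
  using assms
proof (induction rule: polyfun_induct)
  case (const c)
  show ?case by (rule bexI[of _ "\<lambda>_. 0"]) auto
next
  case (coord i)
  show ?case by (rule bexI[of _ "\<lambda>_. if i = j then 1 else 0"]) auto
next
  case (add g h)
  let ?s = "rescale x (\<lambda>k. if k = j then 0 else 1)"
  obtain p where p: "p \<in> polyfun" "\<And>z. g z = g (?s z) + (z $ j - x $ j) * p z" using add by blast
  obtain q where q: "q \<in> polyfun" "\<And>z. h z = h (?s z) + (z $ j - x $ j) * q z" using add by blast
  show ?case
  proof (rule bexI[of _ "\<lambda>z. p z + q z"], rule allI)
    fix z show "g z + h z = g (?s z) + h (?s z) + (z $ j - x $ j) * (p z + q z)"
      by (subst p(2), subst q(2)) (simp add: algebra_simps)
  qed (intro polyfun_add p q)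
next
  case (mult g h)
  let ?s = "rescale x (\<lambda>k. if k = j then 0 else 1)"
  obtain p where p: "p \<in> polyfun" "\<And>z. g z = g (?s z) + (z $ j - x $ j) * p z" using mult by blast
  obtain q where q: "q \<in> polyfun" "\<And>z. h z = h (?s z) + (z $ j - x $ j) * q z" using mult by blast
  show ?case
  proof (rule bexI[of _ "\<lambda>z. p z * h z + g (?s z) * q z"], rule allI)
    fix z
    have "g z * h z = g (?s z) * h z + (z $ j - x $ j) * p z * h z"
      by (subst p(2)) (simp add: algebra_simps)
    also have "g (?s z) * h z = g (?s z) * h (?s z) + (z $ j - x $ j) * (g (?s z) * q z)"
      by (subst q(2)) (simp add: algebra_simps)
    finally show "g z * h z = g (?s z) * h (?s z) + (z $ j - x $ j) * (p z * h z + g (?s z) * q z)"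
      by (simp add: algebra_simps)
  qed (intro polyfun_add polyfun_mult p q mult polyfun_restrict)
qed

section \<open>The Nullstellensatz\<close>

definition poly_ideal :: "('n::finite cspace \<Rightarrow> complex) set \<Rightarrow> bool" where
  "poly_ideal I \<longleftrightarrow> I \<subseteq> polyfun \<and> (\<lambda>_. 0) \<in> I \<and> (\<forall>g\<in>I. \<forall>h\<in>I. (\<lambda>z. g z + h z) \<in> I) \<and>
    (\<forall>g\<in>polyfun. \<forall>h\<in>I. (\<lambda>z. g z * h z) \<in> I)"

lemma poly_ideal_zero: "poly_ideal I \<Longrightarrow> (\<lambda>z. 0) \<in> I"
  unfolding poly_ideal_def by blast

lemma poly_ideal_mult: "poly_ideal I \<Longrightarrow> g \<in> polyfun \<Longrightarrow> h \<in> I \<Longrightarrow> (\<lambda>z. g z * h z) \<in> I"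
  unfolding poly_ideal_def by blast

lemma poly_ideal_add: "poly_ideal I \<Longrightarrow> g \<in> I \<Longrightarrow> h \<in> I \<Longrightarrow> (\<lambda>z. g z + h z) \<in> I"
  unfolding poly_ideal_def by blast

lemma poly_ideal_sum:
  assumes "poly_ideal I" "\<And>k. k \<in> A \<Longrightarrow> g k \<in> I"
  shows "(\<lambda>z. \<Sum>k\<in>A. g k z) \<in> I"
  using assms(2)
proof (induction A rule: infinite_finite_induct)
  case (insert k A)
  then have "(\<lambda>z. g k z + (\<Sum>k\<in>A. g k z)) \<in> I"
    by (intro poly_ideal_add[OF assms(1)]) auto
  then show ?case using insert by simp
qed (simp_all add: poly_ideal_zero[OF assms(1)])

lemma poly_ideal_diff: "poly_ideal I \<Longrightarrow> g \<in> I \<Longrightarrow> h \<in> I \<Longrightarrow> (\<lambda>z. g z - h z) \<in> I"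
  using poly_ideal_add[of I g "\<lambda>z. (-1) * h z"] poly_ideal_mult[of I "\<lambda>_. -1" h] by simp

definition ideal_adjoin ::
    "('n::finite cspace \<Rightarrow> complex) set \<Rightarrow> ('n cspace \<Rightarrow> complex) \<Rightarrow> ('n cspace \<Rightarrow> complex) set" where
  "ideal_adjoin K u = {w. \<exists>k\<in>K. \<exists>r\<in>polyfun. w = (\<lambda>z. k z + u z * r z)}"

lemma ideal_adjoinI:
  "k \<in> K \<Longrightarrow> r \<in> polyfun \<Longrightarrow> (\<And>z. w z = k z + u z * r z) \<Longrightarrow> w \<in> ideal_adjoin K u"
  unfolding ideal_adjoin_def by blast

lemma ideal_adjoinE:
  assumes "w \<in> ideal_adjoin K u"
  obtains k r where "k \<in> K" "r \<in> polyfun" "\<And>z. w z = k z + u z * r z"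
  using assms unfolding ideal_adjoin_def by blast

lemma poly_ideal_adjoin:
  assumes "poly_ideal K" "u \<in> polyfun"
  shows "poly_ideal (ideal_adjoin K u)" (is "poly_ideal ?L")
  unfolding poly_ideal_def
proof (intro conjI ballI subsetI)
  fix g assume "g \<in> ?L" then show "g \<in> polyfun"
    using assms unfolding poly_ideal_def ideal_adjoin_def by auto
next
  show "(\<lambda>_. 0) \<in> ?L"
    by (rule ideal_adjoinI[of "\<lambda>_. 0" _ "\<lambda>_. 0"]) (use assms poly_ideal_zero in auto)
next
  fix g h assume "g \<in> ?L" "h \<in> ?L"
  then obtain k r k' r' where kr: "k \<in> K" "r \<in> polyfun" "\<And>z. g z = k z + u z * r z"
    "k' \<in> K" "r' \<in> polyfun" "\<And>z. h z = k' z + u z * r' z"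
    by (elim ideal_adjoinE) blast
  show "(\<lambda>z. g z + h z) \<in> ?L"
    by (rule ideal_adjoinI[OF poly_ideal_add[OF assms(1) kr(1,4)] polyfun_add[OF kr(2,5)]])
      (simp add: kr(3,6) algebra_simps)
next
  fix g h :: "'a cspace \<Rightarrow> complex" assume g: "g \<in> polyfun" and "h \<in> ?L"
  then obtain k r where kr: "k \<in> K" "r \<in> polyfun" "\<And>z. h z = k z + u z * r z"
    by (elim ideal_adjoinE) blast
  show "(\<lambda>z. g z * h z) \<in> ?L"
    by (rule ideal_adjoinI[OF poly_ideal_mult[OF assms(1) g kr(1)] polyfun_mult[OF g kr(2)]])
      (simp add: kr(3) algebra_simps)
qed

text \<open>
  Used with \<open>\<phi> c\<close> recording an exponent and a degree: infinitely many \<open>c\<close> share both.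
\<close>

lemma uncountable_fiber:
  fixes \<phi> :: "complex \<Rightarrow> 'b::countable"
  shows "\<exists>y. infinite (\<phi> -` {y})"
proof (rule ccontr)
  assume "\<not> ?thesis"
  then have "countable (\<Union>y. \<phi> -` {y})"
    by (intro countable_UN) (auto intro: countable_finite)
  moreover have "(\<Union>y. \<phi> -` {y}) = UNIV" by auto
  ultimately show False using uncountable_UNIV_complex by simp
qed

lemma sum_fun_apply: "(\<Sum>k\<in>A. g k) z = (\<Sum>k\<in>A. g k z)"
  by (induction A rule: infinite_finite_induct) auto

lemma finite_bounded_exponents: "finite {\<alpha> :: 'n::finite \<Rightarrow> nat. \<forall>i. \<alpha> i \<le> D}"
proof -
  have "finite (PiE (UNIV :: 'n set) (\<lambda>_. {..D}))" by (intro finite_PiE) auto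
  also have "PiE (UNIV :: 'n set) (\<lambda>_. {..D}) = {\<alpha>. \<forall>i. \<alpha> i \<le> D}" by (auto simp: PiE_def Pi_def)
  finally show ?thesis .
qed

definition degree_le :: "nat \<Rightarrow> ('n::finite cspace \<Rightarrow> complex) set" where
  "degree_le D = {g. \<exists>d. g = (\<lambda>z. \<Sum>\<alpha>\<in>{\<alpha>. \<forall>i. \<alpha> i \<le> D}. d \<alpha> * monom_fun \<alpha> z)}"

text \<open>More polynomials than there are monomials to write them are linearly dependent.\<close>

lemma bounded_degree_dependent:
  fixes r :: "complex \<Rightarrow> 'n::finite cspace \<Rightarrow> complex"
  assumes r: "\<And>c. c \<in> C \<Longrightarrow> r c \<in> degree_le D" and C: "infinite C"
  shows "\<exists>F l. finite F \<and> F \<subseteq> C \<and> (\<exists>c\<in>F. l c \<noteq> 0) \<and> (\<forall>z. (\<Sum>c\<in>F. l c * r c z) = 0)"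
proof (cases "inj_on r C")
  case False
  then obtain a b where ab: "a \<in> C" "b \<in> C" "a \<noteq> b" "r a = r b" unfolding inj_on_def by blast
  then show ?thesis
    by (intro exI[of _ "{a,b}"] exI[of _ "\<lambda>c. if c = a then 1 else -1"]) auto
next
  case True
  define B where "B = {\<alpha> :: 'n \<Rightarrow> nat. \<forall>i. \<alpha> i \<le> D}"
  have B: "finite B" unfolding B_def by (rule finite_bounded_exponents)
  interpret fs: vector_space "\<lambda>c (g :: 'n cspace \<Rightarrow> complex) z. c * g z"
    by unfold_locales (auto simp: fun_eq_iff algebra_simps)
  have sp: "r ` C \<subseteq> fs.span (monom_fun ` B)"
  proof
    fix g assume "g \<in> r ` C"
    then obtain d where "g = (\<lambda>z. \<Sum>\<alpha>\<in>B. d \<alpha> * monom_fun \<alpha> z)"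
      using r unfolding degree_le_def B_def by blast
    also have "\<dots> = (\<Sum>\<alpha>\<in>B. (\<lambda>z. d \<alpha> * monom_fun \<alpha> z))" by (simp add: fun_eq_iff sum_fun_apply)
    also have "\<dots> \<in> fs.span (monom_fun ` B)"
      by (intro fs.span_sum fs.span_scale fs.span_base) auto
    finally show "g \<in> fs.span (monom_fun ` B)" .
  qed
  have "infinite (r ` C)" using C True finite_image_iff by blast
  then have "fs.dependent (r ` C)"
    using fs.independent_span_bound[of "monom_fun ` B" "r ` C"] B sp by auto
  then obtain T u where T: "finite T" "T \<subseteq> r ` C" "(\<Sum>v\<in>T. (\<lambda>z. u v * v z)) = 0" "\<exists>v\<in>T. u v \<noteq> 0"
    unfolding fs.dependent_explicit by blast
  obtain F where F: "F \<subseteq> C" "finite F" "T = r ` F"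
    using T(1,2) by (metis finite_subset_image)
  have "inj_on r F" using True F inj_on_subset by blast
  have "(\<Sum>c\<in>F. u (r c) * r c z) = 0" for z
  proof -
    have "(\<Sum>c\<in>F. u (r c) * r c z) = (\<Sum>v\<in>T. u v * v z)"
      unfolding F(3) by (simp add: sum.reindex[OF \<open>inj_on r F\<close>])
    also have "\<dots> = (\<Sum>v\<in>T. (\<lambda>z. u v * v z)) z"
      using \<open>finite T\<close> by (induction T rule: finite_induct) auto
    finally show ?thesis using T(3) by simp
  qed
  then show ?thesis using F T(4)
    by (intro exI[of _ F] exI[of _ "\<lambda>c. u (r c)"]) auto
qed

lemma polyfun_bounded_degree:
  assumes "g \<in> polyfun"
  shows "\<exists>D. g \<in> degree_le D"
proof -
  obtain A c where A: "finite A" "g = (\<lambda>z. \<Sum>\<alpha>\<in>A. c \<alpha> * monom_fun \<alpha> z)"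
    using assms unfolding polyfun_iff by blast
  define D where "D = Max (insert 0 (\<Union>\<alpha>\<in>A. range \<alpha>))"
  note fin = finite_bounded_exponents[of D]
  have "A \<subseteq> {\<alpha>. \<forall>i. \<alpha> i \<le> D}"
    using A(1) by (auto simp: D_def intro!: Max_ge)
  then have "g z = (\<Sum>\<alpha>\<in>{\<alpha>. \<forall>i. \<alpha> i \<le> D}. (if \<alpha> \<in> A then c \<alpha> else 0) * monom_fun \<alpha> z)" for z
    unfolding A(2) using fin by (intro sum.mono_neutral_cong_left) auto
  then show ?thesis
    unfolding degree_le_def by (intro exI[of _ D] CollectI exI[of _ "\<lambda>\<alpha>. if \<alpha> \<in> A then c \<alpha> else 0"]) auto
qed

text \<open>
  An ideal \<open>K\<close> maximal among those containing \<open>I\<close> but no power of \<open>a\<close> is prime. If it contained no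
  \<open>z\<^sub>j - c\<close>, then for every \<open>c\<close> some \<open>a\<^bsup>N\<^esup>\<close> would be a multiple of \<open>z\<^sub>j - c\<close> modulo \<open>K\<close>. There are
  uncountably many \<open>c\<close>, so infinitely many have the same \<open>N\<close> and quotients of bounded degree; a linear
  relation among these quotients gives \<open>a\<^bsup>N\<^esup> q (z\<^sub>j) \<in> K\<close> with \<open>q \<noteq> 0\<close> in one variable, and a linear
  factor of \<open>q\<close> lies in \<open>K\<close> after all. Hence \<open>K\<close> is the ideal of a point, a common zero of \<open>I\<close>,
  where \<open>a\<close> vanishes; so \<open>a \<in> K\<close>, a contradiction.
\<close>

theorem nullstellensatz:
  fixes I :: "('n::finite cspace \<Rightarrow> complex) set"
  assumes I: "poly_ideal I" and a: "a \<in> polyfun"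
    and van: "\<And>p. (\<And>u. u \<in> I \<Longrightarrow> u p = 0) \<Longrightarrow> a p = 0"
  shows "\<exists>N. (\<lambda>z. a z ^ N) \<in> I"
proof (rule ccontr)
  assume no: "\<not> ?thesis"
  define \<F> where "\<F> = {K. poly_ideal K \<and> I \<subseteq> K \<and> (\<forall>N. (\<lambda>z. a z ^ N) \<notin> K)}"
  have "\<exists>K\<in>\<F>. \<forall>L\<in>\<F>. K \<subseteq> L \<longrightarrow> L = K"
  proof (rule subset_Zorn_nonempty)
    show "\<F> \<noteq> {}" using I no by (auto simp: \<F>_def)
  next
    fix \<C> assume C: "\<C> \<noteq> {}" "subset.chain \<F> \<C>"
    then have mem: "K \<in> \<F>" if "K \<in> \<C>" for K using that by (auto simp: subset_chain_def)
    have tot: "K \<subseteq> L \<or> L \<subseteq> K" if "K \<in> \<C>" "L \<in> \<C>" for K L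
      using that C by (auto simp: subset_chain_def)
    have "poly_ideal (\<Union>\<C>)"
      unfolding poly_ideal_def
    proof (intro conjI ballI)
      show "\<Union>\<C> \<subseteq> polyfun" using mem unfolding \<F>_def poly_ideal_def by blast
      show "(\<lambda>_. 0) \<in> \<Union>\<C>" using mem C(1) unfolding \<F>_def poly_ideal_def by blast
      fix g h :: "'n cspace \<Rightarrow> complex" assume h: "h \<in> \<Union>\<C>"
      then obtain L where L: "L \<in> \<C>" "h \<in> L" by blast
      {
        assume "g \<in> \<Union>\<C>"
        then obtain K where K: "K \<in> \<C>" "g \<in> K" by blast
        obtain M where "M \<in> \<C>" "g \<in> M" "h \<in> M" using tot[OF K(1) L(1)] K L by blast
        then show "(\<lambda>z. g z + h z) \<in> \<Union>\<C>"
          using mem[of M] poly_ideal_add[of M g h] unfolding \<F>_def by blast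
      }
      {
        assume "g \<in> polyfun"
        then show "(\<lambda>z. g z * h z) \<in> \<Union>\<C>"
          using mem[of L] poly_ideal_mult[of L g h] L unfolding \<F>_def by blast
      }
    qed
    then show "\<Union>\<C> \<in> \<F>" using mem C(1) unfolding \<F>_def by blast
  qed
  then obtain K where KF: "K \<in> \<F>" and max: "\<And>L. L \<in> \<F> \<Longrightarrow> K \<subseteq> L \<Longrightarrow> L = K" by blast
  then have K: "poly_ideal K" "I \<subseteq> K" "(\<lambda>z. a z ^ N) \<notin> K" for N
    by (auto simp: \<F>_def)
  have ext: "\<exists>N r. r \<in> polyfun \<and> (\<lambda>z. a z ^ N - u z * r z) \<in> K" if u: "u \<in> polyfun" "u \<notin> K" for u
  proof -
    let ?L = "ideal_adjoin K u"
    have sub: "K \<subseteq> ?L"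
      by (auto intro: ideal_adjoinI[of _ K "\<lambda>_. 0"])
    have "u \<in> ?L"
      by (rule ideal_adjoinI[of "\<lambda>_. 0" _ "\<lambda>_. 1"]) (use poly_ideal_zero[OF K(1)] in auto)
    then have "?L \<notin> \<F>" using u max sub by blast
    then have "\<not> (\<forall>N. (\<lambda>z. a z ^ N) \<notin> ?L)"
      using poly_ideal_adjoin[OF K(1) u(1)] sub K(2) by (auto simp: \<F>_def)
    then obtain N where "(\<lambda>z. a z ^ N) \<in> ?L" by blast
    then obtain k r where kr: "k \<in> K" "r \<in> polyfun" "\<And>z. a z ^ N = k z + u z * r z"
      by (elim ideal_adjoinE) blast
    have "(\<lambda>z. a z ^ N - u z * r z) = k" by (simp add: kr(3))
    then show ?thesis using kr by blast
  qed
  have prime: "u \<in> K \<or> v \<in> K" if uv: "(\<lambda>z. u z * v z) \<in> K" "u \<in> polyfun" "v \<in> polyfun" for u v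
  proof (rule ccontr)
    assume "\<not> ?thesis"
    then have "u \<notin> K" "v \<notin> K" by auto
    obtain N r where N: "r \<in> polyfun" "(\<lambda>z. a z ^ N - u z * r z) \<in> K"
      using ext[OF uv(2) \<open>u \<notin> K\<close>] by blast
    obtain M s where M: "s \<in> polyfun" "(\<lambda>z. a z ^ M - v z * s z) \<in> K"
      using ext[OF uv(3) \<open>v \<notin> K\<close>] by blast
    have 1: "(\<lambda>z. a z ^ M * (a z ^ N - u z * r z)) \<in> K"
      by (intro poly_ideal_mult[OF K(1) _ N(2)] polyfun_power a)
    have 2: "(\<lambda>z. (u z * r z) * (a z ^ M - v z * s z)) \<in> K"
      by (intro poly_ideal_mult[OF K(1) _ M(2)] polyfun_mult uv N)
    have 3: "(\<lambda>z. (r z * s z) * (u z * v z)) \<in> K"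
      by (intro poly_ideal_mult[OF K(1) _ uv(1)] polyfun_mult M N)
    have "(\<lambda>z. a z ^ M * (a z ^ N - u z * r z) + (u z * r z) * (a z ^ M - v z * s z) + (r z * s z) * (u z * v z)) \<in> K"
      by (intro poly_ideal_add[OF K(1)] 1 2 3)
    moreover have "(\<lambda>z. a z ^ M * (a z ^ N - u z * r z) + (u z * r z) * (a z ^ M - v z * s z) + (r z * s z) * (u z * v z))
       = (\<lambda>z. a z ^ (M + N))" by (simp add: fun_eq_iff algebra_simps power_add)
    ultimately show False using K(3) by simp
  qed
  have coord: "\<exists>c. (\<lambda>z. z $ j - c) \<in> K" for j
  proof (rule ccontr)
    assume none: "\<not> ?thesis"
    have "\<exists>x. (\<lambda>z. a z ^ fst x - (z $ j - c) * snd (snd x) z) \<in> K \<and> snd (snd x) \<in> degree_le (fst (snd x))" for c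
    proof -
      have "(\<lambda>z. z $ j - c) \<in> polyfun" by auto
      moreover have "(\<lambda>z. z $ j - c) \<notin> K" using none by blast
      ultimately obtain N r where r: "r \<in> polyfun" "(\<lambda>z. a z ^ N - (z $ j - c) * r z) \<in> K"
        using ext[of "\<lambda>z. z $ j - c"] by blast
      obtain D where "r \<in> degree_le D" using polyfun_bounded_degree[OF r(1)] by blast
      then show ?thesis using r(2) by (intro exI[of _ "(N, D, r)"]) simp
    qed
    then have "\<forall>c. \<exists>x. (\<lambda>z. a z ^ fst x - (z $ j - c) * snd (snd x) z) \<in> K \<and> snd (snd x) \<in> degree_le (fst (snd x))"
      by blast
    from choice[OF this] obtain X where
      X: "\<forall>c. (\<lambda>z. a z ^ fst (X c) - (z $ j - c) * snd (snd (X c)) z) \<in> K \<and> snd (snd (X c)) \<in> degree_le (fst (snd (X c)))"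
      by blast
    define N where "N c = fst (X c)" for c
    define D where "D c = fst (snd (X c))" for c
    define r where "r c = snd (snd (X c))" for c
    have r: "(\<lambda>z. a z ^ N c - (z $ j - c) * r c z) \<in> K" "r c \<in> degree_le (D c)" for c
      using X by (simp_all add: N_def D_def r_def)
    obtain ND where inf: "infinite ((\<lambda>c. (N c, D c)) -` {ND})"
      using uncountable_fiber[of "\<lambda>c. (N c, D c)"] by blast
    define C where "C = (\<lambda>c. (N c, D c)) -` {ND}"
    have C: "N c = fst ND" "D c = snd ND" if "c \<in> C" for c using that by (auto simp: C_def)
    have "\<exists>F l. finite F \<and> F \<subseteq> C \<and> (\<exists>c\<in>F. l c \<noteq> 0) \<and> (\<forall>z. (\<Sum>c\<in>F. l c * r c z) = 0)"
    proof (rule bounded_degree_dependent)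
      show "infinite C" using inf by (simp add: C_def)
      show "r c \<in> degree_le (snd ND)" if "c \<in> C" for c
        using r(2)[of c] C(2)[OF that] by simp
    qed
    then obtain F l where F: "finite F" "F \<subseteq> C" "\<exists>c\<in>F. l c \<noteq> 0" "\<And>z. (\<Sum>c\<in>F. l c * r c z) = 0"
      by blast
    define q where "q = (\<Sum>c\<in>F. smult (l c) (\<Prod>e\<in>F - {c}. [:- e, 1:]))"
    have pq: "poly q s = (\<Sum>c\<in>F. l c * (\<Prod>e\<in>F - {c}. s - e))" for s
      by (simp add: q_def poly_sum poly_prod)
    have "q \<noteq> 0"
    proof
      assume "q = 0"
      obtain c where c: "c \<in> F" "l c \<noteq> 0" using F by blast
      have "0 = (\<Sum>c'\<in>F. l c' * (\<Prod>e\<in>F - {c'}. c - e))"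
        using pq[of c] \<open>q = 0\<close> by simp
      also have "\<dots> = l c * (\<Prod>e\<in>F - {c}. c - e)"
      proof -
        have "(\<Prod>e\<in>F - {c'}. c - e) = 0" if "c' \<in> F" "c' \<noteq> c" for c'
          using that c F(1) by auto
        then have "(\<Sum>c'\<in>F. l c' * (\<Prod>e\<in>F - {c'}. c - e)) = (\<Sum>c'\<in>F. if c' = c then l c * (\<Prod>e\<in>F - {c}. c - e) else 0)"
          by (intro sum.cong) auto
        then show ?thesis using c F(1) by simp
      qed
      finally show False using c F(1) by auto
    qed
    let ?M = "fst ND"
    \<comment> \<open>multiplying the linear relation by \<open>\<Prod>e\<in>F. z $ j - e\<close> turns each \<open>r c\<close> into \<open>a ^ M\<close> times the other factors\<close>
    have inK: "(\<lambda>z. a z ^ ?M * poly q (z $ j)) \<in> K"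
    proof -
      have "(\<lambda>z. \<Sum>c\<in>F. (l c * (\<Prod>e\<in>F - {c}. z $ j - e)) * (a z ^ ?M - (z $ j - c) * r c z)) \<in> K"
      proof (rule poly_ideal_sum[OF K(1)])
        fix c assume "c \<in> F"
        then have "N c = ?M" using C F by blast
        then have "(\<lambda>z. a z ^ ?M - (z $ j - c) * r c z) \<in> K" using r(1)[of c] by simp
        then show "(\<lambda>z. (l c * (\<Prod>e\<in>F - {c}. z $ j - e)) * (a z ^ ?M - (z $ j - c) * r c z)) \<in> K"
          by (intro poly_ideal_mult[OF K(1)] polyfun_mult polyfun_const polyfun_prod polyfun_diff polyfun_coord)
      qed
      moreover have "(\<Sum>c\<in>F. (l c * (\<Prod>e\<in>F - {c}. z $ j - e)) * (a z ^ ?M - (z $ j - c) * r c z)) =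
          a z ^ ?M * poly q (z $ j)" for z
      proof -
        have "(\<Sum>c\<in>F. (l c * (\<Prod>e\<in>F - {c}. z $ j - e)) * (a z ^ ?M - (z $ j - c) * r c z)) =
            (\<Sum>c\<in>F. a z ^ ?M * (l c * (\<Prod>e\<in>F - {c}. z $ j - e)) - (\<Prod>e\<in>F. z $ j - e) * (l c * r c z))"
        proof (rule sum.cong[OF refl])
          fix c assume "c \<in> F"
          then have rm: "(\<Prod>e\<in>F. z $ j - e) = (z $ j - c) * (\<Prod>e\<in>F - {c}. z $ j - e)"
            using F(1) by (intro prod.remove)
          show "(l c * (\<Prod>e\<in>F - {c}. z $ j - e)) * (a z ^ ?M - (z $ j - c) * r c z) =
            a z ^ ?M * (l c * (\<Prod>e\<in>F - {c}. z $ j - e)) - (\<Prod>e\<in>F. z $ j - e) * (l c * r c z)"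
            unfolding rm by (simp add: algebra_simps)
        qed
        also have "\<dots> = a z ^ ?M * poly q (z $ j) - (\<Prod>e\<in>F. z $ j - e) * (\<Sum>c\<in>F. l c * r c z)"
          by (simp only: sum_subtractf sum_distrib_left[symmetric] pq)
        finally show ?thesis by (simp add: F(4))
      qed
      ultimately show ?thesis by simp
    qed
    have "\<exists>e. (\<lambda>z. z $ j - e) \<in> K" if "q \<noteq> 0" "(\<lambda>z. a z ^ ?M * poly q (z $ j)) \<in> K" for q
      using that
    proof (induction "degree q" arbitrary: q)
      case 0
      then obtain b where b: "q = [:b:]" "b \<noteq> 0" by (metis degree_eq_zeroE pCons_0_0)
      have "(\<lambda>z. inverse b * (a z ^ ?M * poly q (z $ j))) \<in> K"
        by (intro poly_ideal_mult[OF K(1)] 0) auto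
      moreover have "(\<lambda>z. inverse b * (a z ^ ?M * poly q (z $ j))) = (\<lambda>z. a z ^ ?M)"
        using b by (simp add: fun_eq_iff)
      ultimately have "(\<lambda>z. a z ^ ?M) \<in> K" by simp
      then show ?case using K(3) by blast
    next
      case (Suc m)
      then have "\<not> constant (poly q)" by (simp add: constant_degree)
      then obtain e where "poly q e = 0" using fundamental_theorem_of_algebra by blast
      then obtain q' where q': "q = [:-e, 1:] * q'" by (auto simp: poly_eq_0_iff_dvd dvd_def)
      have pol: "(\<lambda>z. poly q' (z $ j)) \<in> polyfun"
        by (induction q') (auto intro!: polyfun_add polyfun_mult)
      have "(\<lambda>z. (z $ j - e) * (a z ^ ?M * poly q' (z $ j))) = (\<lambda>z. a z ^ ?M * poly q (z $ j))"
        by (simp add: q' fun_eq_iff algebra_simps)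
      then have "(\<lambda>z. (z $ j - e) * (a z ^ ?M * poly q' (z $ j))) \<in> K" using Suc.prems by metis
      then have "(\<lambda>z. z $ j - e) \<in> K \<or> (\<lambda>z. a z ^ ?M * poly q' (z $ j)) \<in> K"
        by (rule prime) (intro polyfun_diff polyfun_coord polyfun_const polyfun_mult polyfun_power a pol)+
      moreover have "q' \<noteq> 0" using Suc.prems q' by auto
      moreover have "degree q = degree [:-e, 1:] + degree q'"
        unfolding q' by (rule degree_mult_eq) (use \<open>q' \<noteq> 0\<close> in auto)
      then have "m = degree q'" using Suc.hyps(2) by simp
      ultimately show ?case using Suc.hyps(1)[of q'] by blast
    qed
    then show False using none \<open>q \<noteq> 0\<close> inK by blast
  qed
  then have "\<forall>j. \<exists>c. (\<lambda>z. z $ j - c) \<in> K" by blast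
  from choice[OF this] obtain c where c: "\<forall>j. (\<lambda>z. z $ j - c j) \<in> K" by blast
  define p where "p = (\<chi> j. c j)"
  have red: "(\<lambda>z. u z - u p) \<in> K" if "u \<in> polyfun" for u
    using that
  proof (induction rule: polyfun_induct)
    case (const c)
    show ?case using poly_ideal_zero[OF K(1)] by simp
  next
    case (coord j)
    show ?case using c by (simp add: p_def)
  next
    case (add g h)
    have "(\<lambda>z. g z + h z - (g p + h p)) = (\<lambda>z. (g z - g p) + (h z - h p))"
      by (simp add: fun_eq_iff)
    with poly_ideal_add[OF K(1) add.IH] show ?case by simp
  next
    case (mult g h)
    have "(\<lambda>z. g z * h z - g p * h p) = (\<lambda>z. g z * (h z - h p) + h p * (g z - g p))"
      by (simp add: fun_eq_iff algebra_simps)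
    with poly_ideal_add[OF K(1) poly_ideal_mult[OF K(1) mult.hyps(1) mult.IH(2)]
      poly_ideal_mult[OF K(1) polyfun_const mult.IH(1)]]
    show ?case by simp
  qed
  have one: "(\<lambda>z. 1) \<notin> K" using K(3)[of 0] by simp
  have "u p = 0" if u: "u \<in> I" for u
  proof (rule ccontr)
    assume ne: "u p \<noteq> 0"
    have "u \<in> K" "u \<in> polyfun" using u K I by (auto simp: poly_ideal_def)
    then have "(\<lambda>z. u z - (u z - u p)) \<in> K" by (intro poly_ideal_diff[OF K(1)] red)
    then have "(\<lambda>z. inverse (u p) * (u z - (u z - u p))) \<in> K"
      by (intro poly_ideal_mult[OF K(1)] polyfun_const)
    moreover have "(\<lambda>z. inverse (u p) * (u z - (u z - u p))) = (\<lambda>z. 1)" using ne by simp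
    ultimately show False using one by simp
  qed
  then have "a p = 0" by (rule van)
  then have "a \<in> K" using red[OF a] by simp
  then show False using K(3)[of 1] by simp
qed

section \<open>Signs\<close>

lemma ins_sign_square [simp]: "ins_sign i I * ins_sign i I = 1"
  by (simp add: ins_sign_def flip: power_add mult_2)

lemma ins_sign_insert_self [simp]: "ins_sign i (insert i I) = ins_sign i I"
proof -
  have "{j \<in> insert i I. j < i} = {j \<in> I. j < i}" by auto
  then show ?thesis by (simp add: ins_sign_def)
qed

lemma ins_sign_remove_self [simp]: "ins_sign i (I - {i}) = ins_sign i I"
proof -
  have "{j \<in> I - {i}. j < i} = {j \<in> I. j < i}" by auto
  then show ?thesis by (simp add: ins_sign_def)
qed

lemma ins_sign_insert:
  fixes I :: "'n::{finite,linorder} set"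
  assumes "j \<notin> I"
  shows "ins_sign i (insert j I) = (if j < i then - ins_sign i I else ins_sign i I)"
proof -
  have "{k \<in> insert j I. k < i} = (if j < i then insert j {k \<in> I. k < i} else {k \<in> I. k < i})" by auto
  then show ?thesis using assms by (simp add: ins_sign_def)
qed

lemma ins_sign_swap:
  fixes I :: "'n::{finite,linorder} set"
  assumes "i \<in> I" "j \<in> I" "i \<noteq> j"
  shows "ins_sign i I * ins_sign j (I - {i}) = - (ins_sign j I * ins_sign i (I - {j}))"
proof -
  define K where "K = I - {i} - {j}"
  have K: "I = insert i (insert j K)" "I - {i} = insert j K" "I - {j} = insert i K" "i \<notin> K" "j \<notin> K"
    using assms by (auto simp: K_def)
  show ?thesis
    unfolding K(2,3) unfolding K(1) using K(4,5) \<open>i \<noteq> j\<close>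
    by (cases rule: linorder_cases[of i j]) (auto simp: ins_sign_insert)
qed

lemma ins_sign_swap_insert:
  fixes I :: "'n::{finite,linorder} set"
  assumes "i \<in> I" "j \<notin> I"
  shows "ins_sign i I * ins_sign j (I - {i}) = - (ins_sign j I * ins_sign i (insert j I))"
proof -
  define K where "K = I - {i}"
  have K: "I = insert i K" "I - {i} = K" "i \<notin> K" "j \<notin> K" "i \<noteq> j"
    using assms by (auto simp: K_def)
  show ?thesis
    unfolding K(2) unfolding K(1) using K(3-5)
    by (cases rule: linorder_cases[of i j]) (auto simp: ins_sign_insert)
qed

abbreviation double_insertion :: "'n::{finite,linorder} set \<Rightarrow> ('n \<Rightarrow> 'n \<Rightarrow> complex) \<Rightarrow> complex" where
  "double_insertion I A \<equiv> \<Sum>i\<in>I. ins_sign i I * (\<Sum>j\<in>I - {i}. ins_sign j (I - {i}) * A i j)"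

text \<open>
  Composing two of the operators \<open>d\<close> and \<open>df \<and>\<close> leads to such sums; the antisymmetry expresses
  \<open>dz\<^sub>i \<and> dz\<^sub>j = - dz\<^sub>j \<and> dz\<^sub>i\<close>.
\<close>

lemma double_insertion_antisym:
  fixes I :: "'n::{finite,linorder} set"
  shows "double_insertion I A =
    - double_insertion I (\<lambda>i j. A j i)"
proof -
  have eq: "double_insertion I B =
      (\<Sum>i\<in>I. \<Sum>j\<in>I. if i = j then 0 else ins_sign i I * ins_sign j (I - {i}) * B i j)" for B
  proof (rule sum.cong[OF refl])
    fix i assume "i \<in> I"
    show "ins_sign i I * (\<Sum>j\<in>I - {i}. ins_sign j (I - {i}) * B i j) =
      (\<Sum>j\<in>I. if i = j then 0 else ins_sign i I * ins_sign j (I - {i}) * B i j)"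
      unfolding sum_distrib_left by (rule sum.mono_neutral_cong_left) (auto simp: mult_ac)
  qed
  have "double_insertion I A =
     (\<Sum>i\<in>I. \<Sum>j\<in>I. if i = j then 0 else ins_sign i I * ins_sign j (I - {i}) * A i j)"
    by (rule eq)
  also have "\<dots> = (\<Sum>j\<in>I. \<Sum>i\<in>I. if i = j then 0 else ins_sign i I * ins_sign j (I - {i}) * A i j)"
    by (rule sum.swap)
  also have "\<dots> = (\<Sum>j\<in>I. \<Sum>i\<in>I. - (if j = i then 0 else ins_sign j I * ins_sign i (I - {j}) * A i j))"
  proof (intro sum.cong refl)
    fix i j assume "j \<in> I" "i \<in> I"
    then show "(if i = j then 0 else ins_sign i I * ins_sign j (I - {i}) * A i j) =
        - (if j = i then 0 else ins_sign j I * ins_sign i (I - {j}) * A i j)"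
      using ins_sign_swap[of i I j] by simp
  qed
  also have "\<dots> = - (\<Sum>j\<in>I. \<Sum>i\<in>I. (if j = i then 0 else ins_sign j I * ins_sign i (I - {j}) * A i j))"
    by (simp add: sum_negf)
  also have "\<dots> = - double_insertion I (\<lambda>i j. A j i)"
    unfolding eq[of "\<lambda>i j. A j i"] ..
  finally show ?thesis .
qed

corollary double_insertion_sym:
  fixes I :: "'n::{finite,linorder} set"
  assumes "\<And>i j. i \<in> I \<Longrightarrow> j \<in> I \<Longrightarrow> A i j = A j i"
  shows "double_insertion I A = 0"
proof -
  have "double_insertion I (\<lambda>i j. A j i) =
     double_insertion I A"
    by (intro sum.cong refl arg_cong2[where f = "(*)"]) (use assms in auto)
  with double_insertion_antisym[of I A] show ?thesis by simp
qed

text \<open>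
  The common source of the homotopy formulas for \<open>df \<and>\<close> and for \<open>d\<close>: in the two composites of an
  insertion \<open>i\<close> with a deletion \<open>j\<close> the terms with \<open>i \<noteq> j\<close> cancel.
\<close>

lemma insertion_deletion:
  fixes I :: "'n::{finite,linorder} set" and B :: "'n \<Rightarrow> 'n \<Rightarrow> 'n set \<Rightarrow> complex"
  shows "(\<Sum>i\<in>I. ins_sign i I * (\<Sum>j\<in>- (I - {i}). ins_sign j (I - {i}) * B i j (insert j (I - {i})))) +
    (\<Sum>j\<in>- I. ins_sign j I * (\<Sum>i\<in>insert j I. ins_sign i (insert j I) * B i j (insert j I - {i}))) =
    (\<Sum>i\<in>UNIV. B i i I)"
proof -
  let ?C = "\<lambda>i j. ins_sign j I * ins_sign i (insert j I) * B i j (insert j I - {i})"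
  have 1: "ins_sign i I * (\<Sum>j\<in>- (I - {i}). ins_sign j (I - {i}) * B i j (insert j (I - {i}))) =
     B i i I - (\<Sum>j\<in>- I. ?C i j)" if i: "i \<in> I" for i
  proof -
    have "- (I - {i}) = insert i (- I)" using i by auto
    then have "ins_sign i I * (\<Sum>j\<in>- (I - {i}). ins_sign j (I - {i}) * B i j (insert j (I - {i}))) =
        ins_sign i I * (ins_sign i I * B i i I) + (\<Sum>j\<in>- I. ins_sign i I * (ins_sign j (I - {i}) * B i j (insert j (I - {i}))))"
      using i by (simp add: insert_absorb distrib_left sum_distrib_left)
    also have "(\<Sum>j\<in>- I. ins_sign i I * (ins_sign j (I - {i}) * B i j (insert j (I - {i})))) = (\<Sum>j\<in>- I. - ?C i j)"
    proof (rule sum.cong[OF refl])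
      fix j assume j: "j \<in> - I"
      then have "insert j (I - {i}) = insert j I - {i}" using i by auto
      then show "ins_sign i I * (ins_sign j (I - {i}) * B i j (insert j (I - {i}))) = - ?C i j"
        using ins_sign_swap_insert[of i I j] i j by (simp flip: mult.assoc)
    qed
    finally show ?thesis by (simp add: sum_negf flip: mult.assoc)
  qed
  have 2: "ins_sign j I * (\<Sum>i\<in>insert j I. ins_sign i (insert j I) * B i j (insert j I - {i})) =
     B j j I + (\<Sum>i\<in>I. ?C i j)" if j: "j \<in> - I" for j
  proof -
    have "insert j I - {j} = I" using j by auto
    then have "ins_sign j I * (\<Sum>i\<in>insert j I. ins_sign i (insert j I) * B i j (insert j I - {i})) =
        ins_sign j I * (ins_sign j I * B j j I) + (\<Sum>i\<in>I. ins_sign j I * (ins_sign i (insert j I) * B i j (insert j I - {i})))"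
      using j by (simp add: distrib_left sum_distrib_left)
    then show ?thesis by (simp flip: mult.assoc)
  qed
  have "(\<Sum>i\<in>I. ins_sign i I * (\<Sum>j\<in>- (I - {i}). ins_sign j (I - {i}) * B i j (insert j (I - {i})))) =
     (\<Sum>i\<in>I. B i i I) - (\<Sum>i\<in>I. \<Sum>j\<in>- I. ?C i j)"
    using 1 by (simp add: sum_subtractf)
  moreover have "(\<Sum>j\<in>- I. ins_sign j I * (\<Sum>i\<in>insert j I. ins_sign i (insert j I) * B i j (insert j I - {i}))) =
     (\<Sum>j\<in>- I. B j j I) + (\<Sum>j\<in>- I. \<Sum>i\<in>I. ?C i j)"
    using 2 by (simp add: sum.distrib)
  moreover have "(\<Sum>j\<in>- I. \<Sum>i\<in>I. ?C i j) = (\<Sum>i\<in>I. \<Sum>j\<in>- I. ?C i j)"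
    by (rule sum.swap)
  moreover have "(\<Sum>i\<in>UNIV. B i i I) = (\<Sum>i\<in>I. B i i I) + (\<Sum>j\<in>- I. B j j I)"
    using sum.union_disjoint[of I "- I" "\<lambda>i. B i i I"] by simp
  ultimately show ?thesis by simp
qed

section \<open>Holomorphic forms\<close>

lemma an_forms_holomorphic: "\<omega> \<in> an_forms x p \<Longrightarrow> holomorphic_near x (\<omega> I)"
  unfolding an_forms_def by (cases "card I = p") (auto dest: spec[of _ I])

lemma an_forms_zero: "\<omega> \<in> an_forms x p \<Longrightarrow> card I \<noteq> p \<Longrightarrow> \<omega> I = 0"
  unfolding an_forms_def by (auto dest: spec[of _ I])

lemma an_formsI:
  "(\<And>I. card I = p \<Longrightarrow> holomorphic_near x (\<omega> I)) \<Longrightarrow> (\<And>I. card I \<noteq> p \<Longrightarrow> \<omega> I = 0) \<Longrightarrow> \<omega> \<in> an_forms x p"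
  by (simp add: an_forms_def)

lemma an_forms_cdiff:
  assumes "\<omega> \<in> an_forms x p"
  shows "\<forall>\<^sub>F z in nhds x. \<forall>I. cdiff_at (\<omega> I) z"
  using an_forms_holomorphic[OF assms] unfolding holomorphic_near_def
  by (intro eventually_all_finite)

lemma an_forms_add: "\<omega> \<in> an_forms x p \<Longrightarrow> \<omega>' \<in> an_forms x p \<Longrightarrow> \<omega> + \<omega>' \<in> an_forms x p"
  by (rule an_formsI) (simp_all add: plus_fun_def holomorphic_near_add an_forms_holomorphic an_forms_zero zero_fun_def)

lemma an_forms_diff: "\<omega> \<in> an_forms x p \<Longrightarrow> \<omega>' \<in> an_forms x p \<Longrightarrow> \<omega> - \<omega>' \<in> an_forms x p"
  by (rule an_formsI) (simp_all add: fun_diff_def holomorphic_near_diff an_forms_holomorphic an_forms_zero zero_fun_def)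

lemma an_forms_0: "0 \<in> an_forms x p"
  by (rule an_formsI) (simp_all add: zero_fun_def)

lemma card_remove: "i \<in> I \<Longrightarrow> Suc (card (I - {i})) = card (I :: 'n::finite set)"
  by (rule card_Suc_Diff1) simp_all

lemma pd_0 [simp]: "pd i 0 = 0"
  by (simp add: fun_eq_iff zero_fun_def cdiff_const)

lemma ext_d_an_forms:
  assumes "\<omega> \<in> an_forms x p"
  shows "ext_d \<omega> \<in> an_forms x (Suc p)"
proof (rule an_formsI)
  fix I :: "'a set"
  show "holomorphic_near x (ext_d \<omega> I)"
    unfolding ext_d_def
    by (intro holomorphic_near_sum holomorphic_near_mult holomorphic_near_const holomorphic_near_pd an_forms_holomorphic[OF assms])
next
  fix I :: "'a set" assume "card I \<noteq> Suc p"
  then have "\<omega> (I - {i}) = 0" if "i \<in> I" for i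
    using card_remove[OF that] by (intro an_forms_zero[OF assms]) auto
  then show "ext_d \<omega> I = 0" by (intro ext) (simp add: ext_d_def cong: sum.cong_simp)
qed

lemma df_wedge_an_forms:
  assumes "\<omega> \<in> an_forms x p" "holomorphic_near x f"
  shows "df_wedge f \<omega> \<in> an_forms x (Suc p)"
proof (rule an_formsI)
  fix I :: "'a set"
  show "holomorphic_near x (df_wedge f \<omega> I)"
    unfolding df_wedge_def
    by (intro holomorphic_near_sum holomorphic_near_mult holomorphic_near_const holomorphic_near_pd an_forms_holomorphic[OF assms(1)] assms)
next
  fix I :: "'a set" assume "card I \<noteq> Suc p"
  then have "\<omega> (I - {i}) = 0" if "i \<in> I" for i
    using card_remove[OF that] by (intro an_forms_zero[OF assms(1)]) auto
  then show "df_wedge f \<omega> I = 0" by (simp add: df_wedge_def fun_eq_iff)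
qed

lemma df_wedge_add: "df_wedge f (\<omega> + \<omega>') = df_wedge f \<omega> + df_wedge f \<omega>'"
  by (simp add: df_wedge_def fun_eq_iff algebra_simps sum.distrib)

lemma df_wedge_diff: "df_wedge f (\<omega> - \<omega>') = df_wedge f \<omega> - df_wedge f \<omega>'"
  by (simp add: df_wedge_def fun_eq_iff algebra_simps sum_subtractf)

lemma df_wedge_0 [simp]: "df_wedge f 0 = 0"
  by (simp add: df_wedge_def fun_eq_iff)

lemma ext_d_0 [simp]: "ext_d 0 = 0"
  by (simp add: ext_d_def fun_eq_iff)

lemma ext_d_add_at:
  assumes "\<And>I. cdiff_at (\<omega> I) z" "\<And>I. cdiff_at (\<omega>' I) z"
  shows "ext_d (\<omega> + \<omega>') I z = ext_d \<omega> I z + ext_d \<omega>' I z"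
proof -
  have "pd i ((\<omega> + \<omega>') J) z = pd i (\<omega> J) z + pd i (\<omega>' J) z" for i J
    using cdiff_add[OF assms, of J J i] by (simp add: plus_fun_def)
  then show ?thesis by (simp add: ext_d_def algebra_simps sum.distrib)
qed

lemma ext_d_diff_at:
  assumes "\<And>I. cdiff_at (\<omega> I) z" "\<And>I. cdiff_at (\<omega>' I) z"
  shows "ext_d (\<omega> - \<omega>') I z = ext_d \<omega> I z - ext_d \<omega>' I z"
proof -
  have "pd i ((\<omega> - \<omega>') J) z = pd i (\<omega> J) z - pd i (\<omega>' J) z" for i J
    using cdiff_diff[OF assms, of J J i] by (simp add: fun_diff_def)
  then show ?thesis by (simp add: ext_d_def right_diff_distrib sum_subtractf)
qed

lemma germ_eq_refl [simp]: "germ_eq x \<omega> \<omega>"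
  by (simp add: germ_eq_def)

lemma germ_eq_sym: "germ_eq x \<omega> \<omega>' \<Longrightarrow> germ_eq x \<omega>' \<omega>"
  unfolding germ_eq_def by (elim eventually_mono) simp

lemma germ_eq_trans [trans]: "germ_eq x \<omega> \<omega>' \<Longrightarrow> germ_eq x \<omega>' \<omega>'' \<Longrightarrow> germ_eq x \<omega> \<omega>''"
  unfolding germ_eq_def by (erule (1) eventually_elim2) simp

lemma germ_eq_add: "germ_eq x \<alpha> \<alpha>' \<Longrightarrow> germ_eq x \<beta> \<beta>' \<Longrightarrow> germ_eq x (\<alpha> + \<beta>) (\<alpha>' + \<beta>')"
  unfolding germ_eq_def by (erule (1) eventually_elim2) simp

lemma germ_eq_diff: "germ_eq x \<alpha> \<alpha>' \<Longrightarrow> germ_eq x \<beta> \<beta>' \<Longrightarrow> germ_eq x (\<alpha> - \<beta>) (\<alpha>' - \<beta>')"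
  unfolding germ_eq_def by (erule (1) eventually_elim2) simp

lemma germ_eq_df_wedge: "germ_eq x \<alpha> \<alpha>' \<Longrightarrow> germ_eq x (df_wedge f \<alpha>) (df_wedge f \<alpha>')"
  unfolding germ_eq_def by (erule eventually_mono) (simp add: df_wedge_def)

lemma germ_eq_ext_d:
  assumes "germ_eq x \<alpha> \<alpha>'"
  shows "germ_eq x (ext_d \<alpha>) (ext_d \<alpha>')"
proof -
  have "\<forall>\<^sub>F z in nhds x. \<alpha> I z = \<alpha>' I z" for I
    using assms unfolding germ_eq_def by (rule eventually_mono) simp
  then have "\<forall>\<^sub>F z in nhds x. \<forall>I i. pd i (\<alpha> I) z = pd i (\<alpha>' I) z"
    by (intro eventually_all_finite pd_cong_near)
  then show ?thesis unfolding germ_eq_def by (rule eventually_mono) (simp add: ext_d_def)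
qed

lemma ext_d_add_near:
  assumes "\<omega> \<in> an_forms x p" "\<omega>' \<in> an_forms x q"
  shows "germ_eq x (ext_d (\<omega> + \<omega>')) (ext_d \<omega> + ext_d \<omega>')"
  using an_forms_cdiff[OF assms(1)] an_forms_cdiff[OF assms(2)] unfolding germ_eq_def
  by (rule eventually_elim2) (simp add: ext_d_add_at)

lemma ext_d_diff_near:
  assumes "\<omega> \<in> an_forms x p" "\<omega>' \<in> an_forms x q"
  shows "germ_eq x (ext_d (\<omega> - \<omega>')) (ext_d \<omega> - ext_d \<omega>')"
  using an_forms_cdiff[OF assms(1)] an_forms_cdiff[OF assms(2)] unfolding germ_eq_def
  by (rule eventually_elim2) (simp add: ext_d_diff_at)

lemma ext_d_ext_d_near:
  assumes "\<omega> \<in> an_forms x p"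
  shows "germ_eq x (ext_d (ext_d \<omega>)) 0"
proof -
  have h: "holomorphic_near x (\<omega> I)" for I by (rule an_forms_holomorphic[OF assms])
  have "\<forall>\<^sub>F z in nhds x. \<forall>I i j. pd i (pd j (\<omega> I)) z = pd j (pd i (\<omega> I)) z"
    by (intro eventually_all_finite pd_commute_near h)
  moreover have "\<forall>\<^sub>F z in nhds x. \<forall>I i. cdiff_at (pd i (\<omega> I)) z"
    using holomorphic_near_pd[OF h] unfolding holomorphic_near_def by (intro eventually_all_finite)
  ultimately show ?thesis
    unfolding germ_eq_def
  proof eventually_elim
    case (elim z)
    show ?case
    proof
      fix I
      have "pd i (ext_d \<omega> (I - {i})) z = (\<Sum>j\<in>I - {i}. ins_sign j (I - {i}) * pd i (pd j (\<omega> (I - {i} - {j}))) z)" for i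
      proof -
        have "pd i (ext_d \<omega> (I - {i})) z = (\<Sum>j\<in>I - {i}. pd i (\<lambda>z. ins_sign j (I - {i}) * pd j (\<omega> (I - {i} - {j})) z) z)"
          unfolding ext_d_def by (rule conjunct2[OF cdiff_sum]) (use cdiff_cmult elim in blast)
        also have "\<dots> = (\<Sum>j\<in>I - {i}. ins_sign j (I - {i}) * pd i (pd j (\<omega> (I - {i} - {j}))) z)"
          by (intro sum.cong refl conjunct2[OF cdiff_cmult]) (use elim in blast)
        finally show ?thesis .
      qed
      then have "ext_d (ext_d \<omega>) I z =
         double_insertion I (\<lambda>i j. pd i (pd j (\<omega> (I - {i} - {j}))) z)"
        unfolding ext_d_def[of "ext_d \<omega>"] by simp
      also have "\<dots> = 0"
      proof (rule double_insertion_sym)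
        fix i j
        have "I - {i} - {j} = I - {j} - {i}" by auto
        then show "pd i (pd j (\<omega> (I - {i} - {j}))) z = pd j (pd i (\<omega> (I - {j} - {i}))) z"
          using elim(1) by simp
      qed
      finally show "ext_d (ext_d \<omega>) I z = 0 I z" by simp
    qed
  qed
qed

lemma df_wedge_df_wedge [simp]: "df_wedge f (df_wedge f \<omega>) = 0"
proof (intro ext)
  fix I z
  have "df_wedge f (df_wedge f \<omega>) I z =
      double_insertion I (\<lambda>i j. pd i f z * pd j f z * \<omega> (I - {i} - {j}) z)"
    by (simp add: df_wedge_def sum_distrib_left mult_ac)
  also have "\<dots> = 0"
  proof (rule double_insertion_sym)
    fix i j
    have "I - {i} - {j} = I - {j} - {i}" by auto
    then show "pd i f z * pd j f z * \<omega> (I - {i} - {j}) z = pd j f z * pd i f z * \<omega> (I - {j} - {i}) z" by simp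
  qed
  finally show "df_wedge f (df_wedge f \<omega>) I z = 0 I z" by simp
qed

lemma ext_d_df_wedge_near:
  assumes "\<omega> \<in> an_forms x p" and f: "holomorphic_near x f"
  shows "germ_eq x (ext_d (df_wedge f \<omega>)) (- df_wedge f (ext_d \<omega>))"
proof -
  have h: "holomorphic_near x (\<omega> I)" for I by (rule an_forms_holomorphic[OF assms(1)])
  have "\<forall>\<^sub>F z in nhds x. \<forall>i j. pd i (pd j f) z = pd j (pd i f) z"
    by (intro eventually_all_finite pd_commute_near f)
  moreover have "\<forall>\<^sub>F z in nhds x. \<forall>i. cdiff_at (pd i f) z"
    using holomorphic_near_pd[OF f] unfolding holomorphic_near_def by (intro eventually_all_finite)
  moreover note an_forms_cdiff[OF assms(1)]
  ultimately show ?thesis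
    unfolding germ_eq_def
  proof eventually_elim
    case (elim z)
    show ?case
    proof
      fix I
      have pdw: "pd i (df_wedge f \<omega> (I - {i})) z =
          (\<Sum>j\<in>I - {i}. ins_sign j (I - {i}) * (pd i (pd j f) z * \<omega> (I - {i} - {j}) z)) +
          (\<Sum>j\<in>I - {i}. ins_sign j (I - {i}) * (pd j f z * pd i (\<omega> (I - {i} - {j})) z))" for i
      proof -
        have 1: "cdiff_at (\<lambda>z. pd j f z * \<omega> J z) z \<and> pd i (\<lambda>z. pd j f z * \<omega> J z) z =
            pd j f z * pd i (\<omega> J) z + pd i (pd j f) z * \<omega> J z" for j J
          by (rule cdiff_mult) (use elim in blast)+
        have 2: "cdiff_at (\<lambda>z. c * pd j f z * \<omega> J z) z \<and> pd i (\<lambda>z. c * pd j f z * \<omega> J z) z =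
            c * (pd j f z * pd i (\<omega> J) z + pd i (pd j f) z * \<omega> J z)" for c j J
          using cdiff_cmult[of "\<lambda>z. pd j f z * \<omega> J z" z c i] 1[of j J] by (simp add: mult.assoc)
        have "pd i (df_wedge f \<omega> (I - {i})) z =
           (\<Sum>j\<in>I - {i}. pd i (\<lambda>z. ins_sign j (I - {i}) * pd j f z * \<omega> (I - {i} - {j}) z) z)"
          unfolding df_wedge_def by (rule conjunct2[OF cdiff_sum]) (rule conjunct1[OF 2])
        also have "\<dots> = (\<Sum>j\<in>I - {i}. ins_sign j (I - {i}) *
            (pd j f z * pd i (\<omega> (I - {i} - {j})) z + pd i (pd j f) z * \<omega> (I - {i} - {j}) z))"
          by (intro sum.cong refl conjunct2[OF 2])
        finally show ?thesis by (simp add: distrib_left sum.distrib)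
      qed
      have "ext_d (df_wedge f \<omega>) I z =
         double_insertion I (\<lambda>i j. pd i (pd j f) z * \<omega> (I - {i} - {j}) z) +
         double_insertion I (\<lambda>i j. pd j f z * pd i (\<omega> (I - {i} - {j})) z)"
        unfolding ext_d_def by (simp add: pdw distrib_left sum.distrib)
      also have "double_insertion I (\<lambda>i j. pd i (pd j f) z * \<omega> (I - {i} - {j}) z) = 0"
      proof (rule double_insertion_sym)
        fix i j
        have "I - {i} - {j} = I - {j} - {i}" by auto
        then show "pd i (pd j f) z * \<omega> (I - {i} - {j}) z = pd j (pd i f) z * \<omega> (I - {j} - {i}) z"
          using elim(1) by simp
      qed
      also have "double_insertion I (\<lambda>i j. pd j f z * pd i (\<omega> (I - {i} - {j})) z) =
        - double_insertion I (\<lambda>i j. pd i f z * pd j (\<omega> (I - {j} - {i})) z)"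
        by (rule double_insertion_antisym)
      also have "double_insertion I (\<lambda>i j. pd i f z * pd j (\<omega> (I - {j} - {i})) z) =
        df_wedge f (ext_d \<omega>) I z"
      proof -
        have "I - {j} - {i} = I - {i} - {j}" for i j by auto
        then show ?thesis unfolding df_wedge_def ext_d_def by (simp add: sum_distrib_left mult_ac)
      qed
      finally show "ext_d (df_wedge f \<omega>) I z = (- df_wedge f (ext_d \<omega>)) I z" by simp
    qed
  qed
qed

section \<open>Contractions and the Poincare lemma\<close>

text \<open>Interior multiplication by the vector field \<open>\<Sum>\<^sub>j c j \<partial>/\<partial>z\<^sub>j\<close>.\<close>

definition contraction :: "('n \<Rightarrow> 'n cspace \<Rightarrow> complex) \<Rightarrow> 'n::{finite,linorder} form \<Rightarrow> 'n form" where
  "contraction c \<omega> = (\<lambda>I z. \<Sum>j\<in>- I. ins_sign j I * c j z * \<omega> (insert j I) z)"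

text \<open>
  The homotopy formula of the Koszul complex: elements of the ideal of the partial derivatives of \<open>f\<close>
  act as zero on its cohomology.
\<close>

lemma df_wedge_contraction:
  "df_wedge f (contraction c \<omega>) I z + contraction c (df_wedge f \<omega>) I z = (\<Sum>i\<in>UNIV. pd i f z * c i z) * \<omega> I z"
proof -
  have "df_wedge f (contraction c \<omega>) I z + contraction c (df_wedge f \<omega>) I z =
    (\<Sum>i\<in>I. ins_sign i I * (\<Sum>j\<in>- (I - {i}). ins_sign j (I - {i}) * (pd i f z * c j z * \<omega> (insert j (I - {i})) z))) +
    (\<Sum>j\<in>- I. ins_sign j I * (\<Sum>i\<in>insert j I. ins_sign i (insert j I) * (pd i f z * c j z * \<omega> (insert j I - {i}) z)))"
    unfolding df_wedge_def contraction_def sum_distrib_left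
    by (intro arg_cong2[where f = "(+)"] sum.cong refl) (simp_all only: mult_ac)
  also have "\<dots> = (\<Sum>i\<in>UNIV. pd i f z * c i z * \<omega> I z)"
    by (rule insertion_deletion[where B = "\<lambda>i j K. pd i f z * c j z * \<omega> K z"])
  finally show ?thesis by (simp add: sum_distrib_right)
qed

text \<open>
  Cartan's formula for the Euler field centred at \<open>x\<close>, whose Lie derivative multiplies \<open>dz\<^sub>I\<close> by
  \<open>card I\<close>.
\<close>

lemma ext_d_contraction_euler:
  fixes x z :: "'n::{finite,linorder} cspace" and \<omega> :: "'n::{finite,linorder} form"
  assumes "\<And>J. cdiff_at (\<omega> J) z"
  defines "E \<equiv> \<lambda>j z. z $ j - x $ j"
  shows "ext_d (contraction E \<omega>) I z + contraction E (ext_d \<omega>) I z =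
    (\<Sum>i\<in>UNIV. (z $ i - x $ i) * pd i (\<omega> I) z) + of_nat (card I) * \<omega> I z"
proof -
  have E: "cdiff_at (E j) z \<and> pd i (E j) z = (if i = j then 1 else 0)" for i j
    using cdiff_diff[of "\<lambda>z. z $ j" z "\<lambda>_. x $ j" i] cdiff_coord[of j z i] cdiff_const[of "x $ j" z i]
    by (simp add: E_def)
  have 1: "cdiff_at (\<lambda>z. E j z * \<omega> J z) z \<and> pd i (\<lambda>z. E j z * \<omega> J z) z =
      E j z * pd i (\<omega> J) z + (if i = j then 1 else 0) * \<omega> J z" for i j J
    using cdiff_mult[of "E j" z "\<omega> J" i] E[of j i] assms(1)[of J] by simp
  have 2: "cdiff_at (\<lambda>z. c * E j z * \<omega> J z) z \<and> pd i (\<lambda>z. c * E j z * \<omega> J z) z =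
      c * (E j z * pd i (\<omega> J) z + (if i = j then 1 else 0) * \<omega> J z)" for c i j J
    using cdiff_cmult[of "\<lambda>z. E j z * \<omega> J z" z c i] 1[of j J i] by (simp add: mult.assoc)
  have pdc: "pd i (contraction E \<omega> (I - {i})) z =
      (\<Sum>j\<in>- (I - {i}). ins_sign j (I - {i}) * (E j z * pd i (\<omega> (insert j (I - {i}))) z)) + ins_sign i I * \<omega> I z"
    if i: "i \<in> I" for i
  proof -
    have "pd i (contraction E \<omega> (I - {i})) z =
      (\<Sum>j\<in>- (I - {i}). pd i (\<lambda>z. ins_sign j (I - {i}) * E j z * \<omega> (insert j (I - {i})) z) z)"
      unfolding contraction_def by (rule conjunct2[OF cdiff_sum]) (rule conjunct1[OF 2])
    also have "\<dots> = (\<Sum>j\<in>- (I - {i}). ins_sign j (I - {i}) *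
        (E j z * pd i (\<omega> (insert j (I - {i}))) z + (if i = j then 1 else 0) * \<omega> (insert j (I - {i})) z))"
      by (intro sum.cong refl conjunct2[OF 2])
    also have "\<dots> = (\<Sum>j\<in>- (I - {i}). ins_sign j (I - {i}) * (E j z * pd i (\<omega> (insert j (I - {i}))) z)) +
       (\<Sum>j\<in>- (I - {i}). if j = i then ins_sign i I * \<omega> I z else 0)"
      unfolding distrib_left sum.distrib using i
      by (intro arg_cong2[where f = "(+)"] sum.cong refl) (auto simp: insert_absorb)
    finally show ?thesis by simp
  qed
  have "ext_d (contraction E \<omega>) I z =
     (\<Sum>i\<in>I. ins_sign i I * (\<Sum>j\<in>- (I - {i}). ins_sign j (I - {i}) * (E j z * pd i (\<omega> (insert j (I - {i}))) z))) +
     (\<Sum>i\<in>I. ins_sign i I * (ins_sign i I * \<omega> I z))"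
    unfolding ext_d_def by (simp add: pdc distrib_left sum.distrib)
  also have "(\<Sum>i\<in>I. ins_sign i I * (ins_sign i I * \<omega> I z)) = of_nat (card I) * \<omega> I z"
    by (simp flip: mult.assoc)
  finally have dc: "ext_d (contraction E \<omega>) I z =
     (\<Sum>i\<in>I. ins_sign i I * (\<Sum>j\<in>- (I - {i}). ins_sign j (I - {i}) * (E j z * pd i (\<omega> (insert j (I - {i}))) z))) +
     of_nat (card I) * \<omega> I z" .
  have cd: "contraction E (ext_d \<omega>) I z =
     (\<Sum>j\<in>- I. ins_sign j I * (\<Sum>i\<in>insert j I. ins_sign i (insert j I) * (E j z * pd i (\<omega> (insert j I - {i})) z)))"
    unfolding contraction_def ext_d_def sum_distrib_left by (intro sum.cong refl) (simp only: mult_ac)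
  have "ext_d (contraction E \<omega>) I z + contraction E (ext_d \<omega>) I z =
     (\<Sum>i\<in>I. ins_sign i I * (\<Sum>j\<in>- (I - {i}). ins_sign j (I - {i}) * (E j z * pd i (\<omega> (insert j (I - {i}))) z))) +
     (\<Sum>j\<in>- I. ins_sign j I * (\<Sum>i\<in>insert j I. ins_sign i (insert j I) * (E j z * pd i (\<omega> (insert j I - {i})) z)))
     + of_nat (card I) * \<omega> I z"
    unfolding dc cd by simp
  also have "(\<Sum>i\<in>I. ins_sign i I * (\<Sum>j\<in>- (I - {i}). ins_sign j (I - {i}) * (E j z * pd i (\<omega> (insert j (I - {i}))) z))) +
     (\<Sum>j\<in>- I. ins_sign j I * (\<Sum>i\<in>insert j I. ins_sign i (insert j I) * (E j z * pd i (\<omega> (insert j I - {i})) z))) =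
     (\<Sum>i\<in>UNIV. E i z * pd i (\<omega> I) z)"
    by (rule insertion_deletion[where B = "\<lambda>i j K. E j z * pd i (\<omega> K) z"])
  finally show ?thesis by (simp add: E_def)
qed

text \<open>
  The cone operators are \<open>\<complex>\<close>-linear, and on a ball around \<open>x\<close> they only see values on that ball.
\<close>

lemma cone_int_sum_zero:
  assumes g: "\<And>i. i \<in> A \<Longrightarrow> holomorphic_near x (g i)" and "finite A"
    and zero: "\<forall>\<^sub>F z in nhds x. (\<Sum>i\<in>A. c i * g i z) = 0"
  shows "\<forall>\<^sub>F z in nhds x. (\<Sum>i\<in>A. c i * cone_int x p (g i) z) = 0"
proof -
  have "\<forall>\<^sub>F z in nhds x. \<forall>i\<in>A. cdiff_at (g i) z"
    using g \<open>finite A\<close> unfolding holomorphic_near_def by (intro eventually_ball_finite) auto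
  with zero have "\<forall>\<^sub>F z in nhds x. (\<forall>i\<in>A. cdiff_at (g i) z) \<and> (\<Sum>i\<in>A. c i * g i z) = 0"
    by eventually_elim simp
  then obtain r where r: "r > 0" "\<forall>z. dist z x < r \<longrightarrow> (\<forall>i\<in>A. cdiff_at (g i) z) \<and> (\<Sum>i\<in>A. c i * g i z) = 0"
    unfolding eventually_nhds_metric by blast
  have "\<forall>\<^sub>F z in nhds x. z \<in> ball x r" using r by (intro eventually_nhds_in_open) auto
  then show ?thesis
  proof eventually_elim
    case (elim z)
    define \<gamma> where "\<gamma> t = rescale x (\<lambda>_. complex_of_real t) z" for t
    have mem: "\<gamma> t \<in> ball x r" if "t \<in> {0..1}" for t
      unfolding \<gamma>_def by (rule rescale_ball) (use that elim in auto)
    have gac: "continuous_on {0..1} \<gamma>"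
      unfolding \<gamma>_def rescale_def by (intro continuous_intros)
    have gc: "continuous_on {0..1} (\<lambda>t. g i (\<gamma> t))" if "i \<in> A" for i
    proof (rule continuous_on_compose2[OF _ gac])
      show "continuous_on (ball x r) (g i)"
        using r(2) that by (intro continuous_at_imp_continuous_on ballI cdiff_at_imp_continuous) (auto simp: dist_commute)
    qed (use mem in auto)
    have "(\<Sum>i\<in>A. c i * cone_int x p (g i) z) = (\<Sum>i\<in>A. integral {0..1} (\<lambda>t. c i * (of_real t ^ p * g i (\<gamma> t))))"
      unfolding cone_int_def \<gamma>_def by (simp only: integral_mult_right)
    also have "\<dots> = integral {0..1} (\<lambda>t. \<Sum>i\<in>A. c i * (of_real t ^ p * g i (\<gamma> t)))"
      by (intro integral_sum[symmetric] \<open>finite A\<close> integrable_continuous_real continuous_intros gc)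
    also have "\<dots> = integral {0..1} (\<lambda>t :: real. 0 :: complex)"
    proof (rule Henstock_Kurzweil_Integration.integral_cong)
      fix t :: real assume "t \<in> {0..1}"
      then have "(\<Sum>i\<in>A. c i * g i (\<gamma> t)) = 0" using r(2) mem by (simp add: dist_commute)
      moreover have "(\<Sum>i\<in>A. c i * (of_real t ^ p * g i (\<gamma> t))) = of_real t ^ p * (\<Sum>i\<in>A. c i * g i (\<gamma> t))"
        by (simp add: sum_distrib_left mult_ac)
      ultimately show "(\<Sum>i\<in>A. c i * (of_real t ^ p * g i (\<gamma> t))) = 0" by simp
    qed
    finally show ?case by simp
  qed
qed

lemma contraction_an_forms:
  assumes "\<omega> \<in> an_forms x (Suc p)" "\<And>j. holomorphic_near x (c j)"
  shows "contraction c \<omega> \<in> an_forms x p"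
proof (rule an_formsI)
  fix I :: "'a set"
  show "holomorphic_near x (contraction c \<omega> I)"
    unfolding contraction_def
    by (intro holomorphic_near_sum holomorphic_near_mult holomorphic_near_const an_forms_holomorphic[OF assms(1)] assms(2))
next
  fix I :: "'a set" assume "card I \<noteq> p"
  then have "\<omega> (insert j I) = 0" if "j \<in> - I" for j
    using that by (intro an_forms_zero[OF assms(1)]) auto
  then show "contraction c \<omega> I = 0" by (simp add: contraction_def fun_eq_iff)
qed

lemma cone_int_0 [simp]: "cone_int x p 0 = 0"
  by (simp add: cone_int_def fun_eq_iff)

text \<open>
  For the Euler field \<open>E\<close> centred at \<open>x\<close>, Cartan's formula makes \<open>d \<iota>\<^sub>E + \<iota>\<^sub>E d\<close> act on the coefficients of
  \<open>(p+1)\<close>-forms as \<open>p + 1 + \<Sum>\<^sub>i (z\<^sub>i - x\<^sub>i) \<partial>/\<partial>z\<^sub>i\<close>, which the cone operator inverts.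
\<close>

theorem poincare_lemma:
  fixes \<omega> :: "'n::{finite,linorder} form"
  assumes \<omega>: "\<omega> \<in> an_forms x (Suc p)" and closed: "germ_eq x (ext_d \<omega>) 0"
  shows "\<exists>\<eta>\<in>an_forms x p. germ_eq x \<omega> (ext_d \<eta>)"
proof -
  define H where "H I = cone_int x p (\<omega> I)" for I
  define E where "E = (\<lambda>j z. z $ j - x $ j :: complex)"
  have h: "holomorphic_near x (\<omega> I)" for I by (rule an_forms_holomorphic[OF \<omega>])
  have H: "H \<in> an_forms x (Suc p)"
    by (rule an_formsI) (auto simp: H_def cone_int_holomorphic h an_forms_zero[OF \<omega>])
  have Eh: "holomorphic_near x (E j)" for j
    unfolding E_def by (intro holomorphic_near_diff holomorphic_near_coord holomorphic_near_const)
  have "\<forall>\<^sub>F z in nhds x. \<forall>I i. pd i (H I) z = cone_int x (Suc p) (pd i (\<omega> I)) z"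
    unfolding H_def by (intro eventually_all_finite pd_cone_int h)
  moreover have "\<forall>\<^sub>F z in nhds x. \<forall>I. (\<Sum>i\<in>I. ins_sign i I * cone_int x (Suc p) (pd i (\<omega> (I - {i}))) z) = 0"
  proof (intro eventually_all_finite cone_int_sum_zero holomorphic_near_pd h)
    fix I :: "'n set"
    show "\<forall>\<^sub>F z in nhds x. (\<Sum>i\<in>I. ins_sign i I * pd i (\<omega> (I - {i})) z) = 0"
      using closed unfolding germ_eq_def by (rule eventually_mono) (simp add: ext_d_def)
  qed simp
  ultimately have dH: "\<forall>\<^sub>F z in nhds x. \<forall>I. ext_d H I z = 0"
    by eventually_elim (simp add: ext_d_def)
  have euler: "\<forall>\<^sub>F z in nhds x. \<forall>I. (\<Sum>i\<in>UNIV. (z $ i - x $ i) * pd i (H I) z) + of_nat (Suc p) * H I z = \<omega> I z"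
    unfolding H_def by (intro eventually_all_finite cone_int_euler h)
  have "germ_eq x \<omega> (ext_d (contraction E H))"
    using dH euler an_forms_cdiff[OF H] unfolding germ_eq_def
  proof eventually_elim
    case (elim z)
    show ?case
    proof
      fix I
      have "contraction E (ext_d H) I z = 0" using elim(1) by (simp add: contraction_def)
      then have "ext_d (contraction E H) I z =
          (\<Sum>i\<in>UNIV. (z $ i - x $ i) * pd i (H I) z) + of_nat (card I) * H I z"
        using ext_d_contraction_euler[of H z x I] elim(3) unfolding E_def by simp
      also have "\<dots> = \<omega> I z"
      proof (cases "card I = Suc p")
        case True
        then show ?thesis using elim(2) by simp
      next
        case False
        then have "H I = 0" "\<omega> I = 0" by (simp_all add: an_forms_zero[OF H] an_forms_zero[OF \<omega>])
        then show ?thesis by simp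
      qed
      finally show "\<omega> I z = ext_d (contraction E H) I z" by simp
    qed
  qed
  then show ?thesis by (rule bexI[of _ "contraction E H"]) (rule contraction_an_forms[OF H Eh])
qed

section \<open>Ideals of germs generated by powers of the coordinates\<close>

definition germ_ideal :: "'n::finite cspace \<Rightarrow> ('n \<Rightarrow> nat) \<Rightarrow> 'n set \<Rightarrow> ('n cspace \<Rightarrow> complex) set" where
  "germ_ideal x v S = {g. \<exists>b. (\<forall>i. holomorphic_near x (b i)) \<and>
     (\<forall>\<^sub>F z in nhds x. g z = (\<Sum>i\<in>S. (z $ i - x $ i) ^ v i * b i z))}"

lemma germ_idealI:
  "(\<And>i. holomorphic_near x (b i)) \<Longrightarrow> \<forall>\<^sub>F z in nhds x. g z = (\<Sum>i\<in>S. (z $ i - x $ i) ^ v i * b i z) \<Longrightarrow> g \<in> germ_ideal x v S"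
  unfolding germ_ideal_def by (intro CollectI exI[of _ b] conjI allI)

lemma germ_idealE:
  assumes "g \<in> germ_ideal x v S"
  obtains b where "\<And>i. holomorphic_near x (b i)" "\<forall>\<^sub>F z in nhds x. g z = (\<Sum>i\<in>S. (z $ i - x $ i) ^ v i * b i z)"
  using assms unfolding germ_ideal_def by blast

lemma germ_ideal_zero: "(\<lambda>z. 0) \<in> germ_ideal x v S"
  by (rule germ_idealI[of x "\<lambda>_ _. 0"]) auto

lemma germ_ideal_cong:
  assumes "g \<in> germ_ideal x v S" "\<forall>\<^sub>F z in nhds x. h z = g z"
  shows "h \<in> germ_ideal x v S"
proof -
  obtain b where b: "\<And>i. holomorphic_near x (b i)" "\<forall>\<^sub>F z in nhds x. g z = (\<Sum>i\<in>S. (z $ i - x $ i) ^ v i * b i z)"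
    by (rule germ_idealE[OF assms(1)]) blast
  have "\<forall>\<^sub>F z in nhds x. h z = (\<Sum>i\<in>S. (z $ i - x $ i) ^ v i * b i z)"
    using assms(2) b(2) by eventually_elim simp
  with b(1) show ?thesis by (rule germ_idealI)
qed

lemma germ_ideal_empty: "g \<in> germ_ideal x v {} \<longleftrightarrow> (\<forall>\<^sub>F z in nhds x. g z = 0)"
proof
  assume "g \<in> germ_ideal x v {}" then show "\<forall>\<^sub>F z in nhds x. g z = 0"
    by (rule germ_idealE) simp
next
  assume "\<forall>\<^sub>F z in nhds x. g z = 0"
  then show "g \<in> germ_ideal x v {}" by (rule germ_ideal_cong[OF germ_ideal_zero])
qed

lemma germ_ideal_add:
  assumes "g \<in> germ_ideal x v S" "h \<in> germ_ideal x v S"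
  shows "(\<lambda>z. g z + h z) \<in> germ_ideal x v S"
proof -
  obtain b where b: "\<And>i. holomorphic_near x (b i)" "\<forall>\<^sub>F z in nhds x. g z = (\<Sum>i\<in>S. (z $ i - x $ i) ^ v i * b i z)"
    by (rule germ_idealE[OF assms(1)]) blast
  obtain b' where b': "\<And>i. holomorphic_near x (b' i)" "\<forall>\<^sub>F z in nhds x. h z = (\<Sum>i\<in>S. (z $ i - x $ i) ^ v i * b' i z)"
    by (rule germ_idealE[OF assms(2)]) blast
  show ?thesis
  proof (rule germ_idealI[of x "\<lambda>i z. b i z + b' i z"])
    show "\<forall>\<^sub>F z in nhds x. g z + h z = (\<Sum>i\<in>S. (z $ i - x $ i) ^ v i * (b i z + b' i z))"
      using b(2) b'(2) by eventually_elim (simp add: distrib_left sum.distrib)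
  qed (intro holomorphic_near_add b b')
qed

lemma germ_ideal_mult:
  assumes "holomorphic_near x h" "g \<in> germ_ideal x v S"
  shows "(\<lambda>z. h z * g z) \<in> germ_ideal x v S"
proof -
  obtain b where b: "\<And>i. holomorphic_near x (b i)" "\<forall>\<^sub>F z in nhds x. g z = (\<Sum>i\<in>S. (z $ i - x $ i) ^ v i * b i z)"
    by (rule germ_idealE[OF assms(2)]) blast
  show ?thesis
  proof (rule germ_idealI[of x "\<lambda>i z. h z * b i z"])
    show "\<forall>\<^sub>F z in nhds x. h z * g z = (\<Sum>i\<in>S. (z $ i - x $ i) ^ v i * (h z * b i z))"
      using b(2) by eventually_elim (simp add: sum_distrib_left mult_ac)
  qed (intro holomorphic_near_mult b assms)
qed

lemma germ_ideal_diff: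
  assumes "g \<in> germ_ideal x v S" "h \<in> germ_ideal x v S"
  shows "(\<lambda>z. g z - h z) \<in> germ_ideal x v S"
  using germ_ideal_add[OF assms(1) germ_ideal_mult[OF holomorphic_near_const[of x "-1"] assms(2)]] by simp

lemma germ_ideal_sum:
  assumes "\<And>k. k \<in> A \<Longrightarrow> g k \<in> germ_ideal x v S"
  shows "(\<lambda>z. \<Sum>k\<in>A. g k z) \<in> germ_ideal x v S"
  using assms
proof (induction A rule: infinite_finite_induct)
  case (insert k A)
  then have "(\<lambda>z. g k z + (\<Sum>k\<in>A. g k z)) \<in> germ_ideal x v S"
    by (intro germ_ideal_add) auto
  then show ?case using insert by simp
qed (simp_all add: germ_ideal_zero)

lemma germ_ideal_generator:
  fixes x :: "'n::finite cspace"
  assumes "j \<in> S" "holomorphic_near x h"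
  shows "(\<lambda>z. (z $ j - x $ j) ^ v j * h z) \<in> germ_ideal x v S"
proof (rule germ_idealI[of x "\<lambda>i. if i = j then h else (\<lambda>_. 0)"])
  have "(\<Sum>i\<in>S. (z $ i - x $ i) ^ v i * (if i = j then h else (\<lambda>_. 0)) z) =
     (\<Sum>i\<in>S. if i = j then (z $ j - x $ j) ^ v j * h z else 0)" for z
    by (intro sum.cong) auto
  then show "\<forall>\<^sub>F z in nhds x. (z $ j - x $ j) ^ v j * h z =
    (\<Sum>i\<in>S. (z $ i - x $ i) ^ v i * (if i = j then h else (\<lambda>_. 0)) z)"
    using assms(1) by simp
qed (use assms in auto)

lemma germ_ideal_mono:
  fixes x :: "'n::finite cspace"
  assumes "g \<in> germ_ideal x v S" "S \<subseteq> T"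
  shows "g \<in> germ_ideal x v T"
proof -
  obtain b where b: "\<And>i. holomorphic_near x (b i)" "\<forall>\<^sub>F z in nhds x. g z = (\<Sum>i\<in>S. (z $ i - x $ i) ^ v i * b i z)"
    by (rule germ_idealE[OF assms(1)]) blast
  have "(\<lambda>z. \<Sum>i\<in>S. (z $ i - x $ i) ^ v i * b i z) \<in> germ_ideal x v T"
  proof (rule germ_ideal_sum)
    fix i assume "i \<in> S"
    then show "(\<lambda>z. (z $ i - x $ i) ^ v i * b i z) \<in> germ_ideal x v T"
      using assms(2) by (intro germ_ideal_generator b) blast
  qed
  then show ?thesis by (rule germ_ideal_cong) (rule b(2))
qed

lemma germ_ideal_insert:
  fixes x :: "'n::finite cspace"
  assumes "g \<in> germ_ideal x v (insert j S)" "j \<notin> S"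
  shows "\<exists>h. holomorphic_near x h \<and> (\<lambda>z. g z - (z $ j - x $ j) ^ v j * h z) \<in> germ_ideal x v S"
proof -
  obtain b where b: "\<And>i. holomorphic_near x (b i)"
    "\<forall>\<^sub>F z in nhds x. g z = (\<Sum>i\<in>insert j S. (z $ i - x $ i) ^ v i * b i z)"
    by (rule germ_idealE[OF assms(1)]) blast
  have "(\<lambda>z. g z - (z $ j - x $ j) ^ v j * b j z) \<in> germ_ideal x v S"
    by (rule germ_idealI[OF b(1)]) (rule eventually_mono[OF b(2)], simp add: assms(2))
  then show ?thesis using b(1) by blast
qed

lemma germ_ideal_regular:
  fixes x :: "'n::finite cspace"
  assumes "(\<lambda>z. (z $ j - x $ j) * g z) \<in> germ_ideal x v S" "j \<notin> S" "holomorphic_near x g"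
  shows "g \<in> germ_ideal x v S"
proof -
  obtain b where b: "\<And>i. holomorphic_near x (b i)"
    "\<forall>\<^sub>F z in nhds x. (z $ j - x $ j) * g z = (\<Sum>i\<in>S. (z $ i - x $ i) ^ v i * b i z)"
    by (rule germ_idealE[OF assms(1)]) blast
  obtain b' where "\<forall>i. holomorphic_near x (b' i)"
    "\<forall>\<^sub>F z in nhds x. g z = (\<Sum>i\<in>S. (z $ i - x $ i) ^ v i * b' i z)"
    using coord_regular[OF assms(3) b(1) assms(2) b(2)] by blast
  then show ?thesis by (intro germ_idealI[of x b']) auto
qed

lemma germ_ideal_regular_power:
  fixes x :: "'n::finite cspace"
  assumes "(\<lambda>z. (z $ j - x $ j) ^ m * g z) \<in> germ_ideal x v S" "j \<notin> S" "holomorphic_near x g"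
  shows "g \<in> germ_ideal x v S"
  using assms(1)
proof (induction m)
  case (Suc m)
  have "holomorphic_near x (\<lambda>z. (z $ j - x $ j) ^ m * g z)"
    by (intro holomorphic_near_mult holomorphic_near_power holomorphic_near_diff holomorphic_near_coord holomorphic_near_const assms(3))
  moreover have "(\<lambda>z. (z $ j - x $ j) * ((z $ j - x $ j) ^ m * g z)) \<in> germ_ideal x v S"
    using Suc.prems by (simp only: power_Suc mult.assoc)
  ultimately show ?case by (intro Suc.IH) (rule germ_ideal_regular[OF _ assms(2)])
qed simp

section \<open>Exactness of the Koszul complex\<close>

text \<open>Forms of degree \<open>q - 1\<close>, so that the zero module sits in degree \<open>q = 0\<close>.\<close>

definition shifted_forms :: "'n cspace \<Rightarrow> nat \<Rightarrow> 'n::{finite,linorder} form set" where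
  "shifted_forms x q = (case q of 0 \<Rightarrow> {0} | Suc p \<Rightarrow> an_forms x p)"

lemma shifted_forms_0 [simp]: "shifted_forms x 0 = {0}"
  and shifted_forms_Suc [simp]: "shifted_forms x (Suc p) = an_forms x p"
  by (simp_all add: shifted_forms_def)

lemma shifted_forms_holomorphic: "\<omega> \<in> shifted_forms x q \<Longrightarrow> holomorphic_near x (\<omega> I)"
  by (cases q) (auto simp: an_forms_holomorphic)

lemma shifted_forms_zero: "\<omega> \<in> shifted_forms x q \<Longrightarrow> Suc (card I) \<noteq> q \<Longrightarrow> \<omega> I = 0"
  by (cases q) (auto simp: an_forms_zero)

lemma shifted_formsI:
  assumes "\<And>I. Suc (card I) = q \<Longrightarrow> holomorphic_near x (\<omega> I)" "\<And>I. Suc (card I) \<noteq> q \<Longrightarrow> \<omega> I = 0"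
  shows "\<omega> \<in> shifted_forms x q"
proof (cases q)
  case 0
  then have "\<omega> = 0" using assms(2) by (simp add: fun_eq_iff)
  with 0 show ?thesis by simp
next
  case (Suc p)
  with assms show ?thesis by (auto intro!: an_formsI)
qed

lemma shifted_forms_df_wedge:
  "\<omega> \<in> shifted_forms x q \<Longrightarrow> holomorphic_near x f \<Longrightarrow> df_wedge f \<omega> \<in> shifted_forms x (Suc q)"
  by (cases q) (auto simp: df_wedge_an_forms an_forms_0)

lemma shifted_forms_contraction:
  assumes "\<omega> \<in> shifted_forms x (Suc q)" "\<And>j. holomorphic_near x (c j)"
  shows "contraction c \<omega> \<in> shifted_forms x q"
proof (cases q)
  case 0
  have "\<omega> (insert j I) = 0" if "j \<notin> I" for j I
    by (rule shifted_forms_zero[OF assms(1)]) (use 0 that in simp)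
  then have "contraction c \<omega> = 0" by (simp add: contraction_def fun_eq_iff)
  with 0 show ?thesis by simp
next
  case (Suc p)
  with assms show ?thesis by (simp add: contraction_an_forms)
qed

lemma df_wedge_germ_ideal:
  assumes "holomorphic_near x f" "\<And>I. \<omega> I \<in> germ_ideal x v S"
  shows "df_wedge f \<omega> I \<in> germ_ideal x v S"
  unfolding df_wedge_def
  by (intro germ_ideal_sum germ_ideal_mult holomorphic_near_mult holomorphic_near_const holomorphic_near_pd assms)

lemma contraction_germ_ideal:
  assumes "\<And>j. holomorphic_near x (c j)" "\<And>I. \<omega> I \<in> germ_ideal x v S"
  shows "contraction c \<omega> I \<in> germ_ideal x v S"
  unfolding contraction_def
  by (intro germ_ideal_sum germ_ideal_mult holomorphic_near_mult holomorphic_near_const assms)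

text \<open>
  Descending induction on the number of elements \<open>(z\<^sub>j - x\<^sub>j)\<^bsup>v j\<^esup>\<close>, \<open>j \<notin> T\<close>, that are divided out:
  modulo all of them the claim concerns only \<open>q = 0\<close>. For the step, let \<open>a = (z\<^sub>j - x\<^sub>j)\<^bsup>v j\<^esup>\<close>. Modulo the
  other elements \<open>a \<alpha> = df \<and> \<kappa>\<close> for a contraction \<open>\<kappa>\<close> of \<open>\<alpha>\<close>, and \<open>\<kappa>\<close> is a cocycle modulo \<open>a\<close> and them;
  by induction \<open>\<kappa> = df \<and> \<beta> + a \<gamma>\<close>, hence \<open>a (\<alpha> - df \<and> \<gamma>) = 0\<close>, and \<open>a\<close> is a nonzerodivisor.
\<close>

lemma koszul_exact_modulo:
  fixes x :: "'n::{finite,linorder} cspace" and T :: "'n set"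
  assumes f: "holomorphic_near x f" and c: "\<And>j i. holomorphic_near x (c j i)"
    and cf: "\<And>j. \<forall>\<^sub>F z in nhds x. (z $ j - x $ j) ^ v j = (\<Sum>i\<in>UNIV. pd i f z * c j i z)"
    and q: "q + card (- T) \<le> CARD('n)" and \<alpha>: "\<alpha> \<in> shifted_forms x q"
    and closed: "\<And>I. df_wedge f \<alpha> I \<in> germ_ideal x v (- T)"
  shows "\<exists>\<beta>\<in>shifted_forms x (q - 1). \<forall>I. (\<lambda>z. \<alpha> I z - df_wedge f \<beta> I z) \<in> germ_ideal x v (- T)"
proof -
  have "finite T" by simp
  then show ?thesis using q \<alpha> closed
  proof (induction T arbitrary: q \<alpha> rule: finite_induct)
    case empty
    then have "q = 0" by simp
    then have "\<alpha> = 0" using empty by simp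
    have "(\<lambda>z. \<alpha> I z - df_wedge f 0 I z) \<in> germ_ideal x v (- {})" for I
      unfolding \<open>\<alpha> = 0\<close> df_wedge_0 using germ_ideal_zero by simp
    then show ?case using \<open>q = 0\<close> by (intro bexI[of _ 0] allI) (assumption, simp)
  next
    case (insert j T)
    define S where "S = - insert j T"
    have S: "- T = insert j S" "j \<notin> S" "- insert j T = S" using insert.hyps by (auto simp: S_def)
    show ?case
    proof (cases q)
      case 0
      then have "\<alpha> = 0" using insert.prems(2) by simp
      have "(\<lambda>z. \<alpha> I z - df_wedge f 0 I z) \<in> germ_ideal x v (- insert j T)" for I
        unfolding \<open>\<alpha> = 0\<close> df_wedge_0 using germ_ideal_zero by simp
      then show ?thesis using \<open>q = 0\<close> by (intro bexI[of _ 0] allI) (assumption, simp)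
    next
      case (Suc q')
      define \<kappa> where "\<kappa> = contraction (c j) \<alpha>"
      have \<kappa>: "\<kappa> \<in> shifted_forms x q'"
        unfolding \<kappa>_def by (rule shifted_forms_contraction[OF _ c]) (use insert.prems(2) Suc in simp)
      have \<alpha>h: "holomorphic_near x (\<alpha> I)" for I
        by (rule shifted_forms_holomorphic[OF insert.prems(2)])
      have cl: "contraction (c j) (df_wedge f \<alpha>) I \<in> germ_ideal x v S" for I
        by (rule contraction_germ_ideal[OF c]) (use insert.prems(3) S(3) in simp)
      \<comment> \<open>multiplication by \<open>(z\<^sub>j - x\<^sub>j)\<^bsup>v j\<^esup>\<close> is homotopic to zero, as it lies in the ideal of the partial derivatives\<close>
      have hom: "\<forall>\<^sub>F z in nhds x. df_wedge f \<kappa> I z =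
          (z $ j - x $ j) ^ v j * \<alpha> I z - contraction (c j) (df_wedge f \<alpha>) I z" for I
        using cf[of j]
      proof eventually_elim
        case (elim z)
        show ?case
          unfolding elim \<kappa>_def using df_wedge_contraction[of f "c j" \<alpha> I z] by (simp add: algebra_simps)
      qed
      have "df_wedge f \<kappa> I \<in> germ_ideal x v (insert j S)" for I
      proof (rule germ_ideal_cong[OF _ hom])
        show "(\<lambda>z. (z $ j - x $ j) ^ v j * \<alpha> I z - contraction (c j) (df_wedge f \<alpha>) I z) \<in> germ_ideal x v (insert j S)"
          by (intro germ_ideal_diff germ_ideal_generator germ_ideal_mono[OF cl] \<alpha>h) auto
      qed
      moreover have "q' + card (- T) \<le> CARD('n)"
        using insert.prems(1) Suc S by simp
      ultimately obtain \<beta> where \<beta>: "\<beta> \<in> shifted_forms x (q' - 1)"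
        "\<And>I. (\<lambda>z. \<kappa> I z - df_wedge f \<beta> I z) \<in> germ_ideal x v (insert j S)"
        using insert.IH[of q' \<kappa>] \<kappa> S(1) by auto
      have \<beta>0: "df_wedge f \<beta> I = 0" if "Suc (card I) \<noteq> q'" for I
      proof (cases q')
        case 0
        then show ?thesis using \<beta>(1) by simp
      next
        case (Suc q'')
        then show ?thesis using shifted_forms_zero[OF shifted_forms_df_wedge[OF \<beta>(1) f], of I] that by simp
      qed
      have "\<exists>h. holomorphic_near x h \<and> (Suc (card I) \<noteq> q' \<longrightarrow> h = 0) \<and>
          (\<lambda>z. (\<kappa> I z - df_wedge f \<beta> I z) - (z $ j - x $ j) ^ v j * h z) \<in> germ_ideal x v S" for I
      proof (cases "Suc (card I) = q'")
        case True
        then show ?thesis using germ_ideal_insert[OF \<beta>(2)[of I] S(2)] by blast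
      next
        case False
        then show ?thesis
          using shifted_forms_zero[OF \<kappa>, of I] \<beta>0[of I] germ_ideal_zero[of x v S]
          by (intro exI[of _ 0]) simp
      qed
      then have "\<forall>I. \<exists>h. holomorphic_near x h \<and> (Suc (card I) \<noteq> q' \<longrightarrow> h = 0) \<and>
          (\<lambda>z. (\<kappa> I z - df_wedge f \<beta> I z) - (z $ j - x $ j) ^ v j * h z) \<in> germ_ideal x v S" ..
      from choice[OF this] obtain \<gamma> where
        "\<forall>I. holomorphic_near x (\<gamma> I) \<and> (Suc (card I) \<noteq> q' \<longrightarrow> \<gamma> I = 0) \<and>
          (\<lambda>z. (\<kappa> I z - df_wedge f \<beta> I z) - (z $ j - x $ j) ^ v j * \<gamma> I z) \<in> germ_ideal x v S" ..
      then have \<gamma>: "holomorphic_near x (\<gamma> I)" "Suc (card I) \<noteq> q' \<Longrightarrow> \<gamma> I = 0"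
        "(\<lambda>z. (\<kappa> I z - df_wedge f \<beta> I z) - (z $ j - x $ j) ^ v j * \<gamma> I z) \<in> germ_ideal x v S" for I
        by simp_all
      have \<gamma>s: "\<gamma> \<in> shifted_forms x q'" by (rule shifted_formsI) (auto simp: \<gamma>)
      define \<delta> where "\<delta> I z = (\<kappa> I z - df_wedge f \<beta> I z) - (z $ j - x $ j) ^ v j * \<gamma> I z" for I z
      have \<delta>: "df_wedge f \<delta> I \<in> germ_ideal x v S" for I
        by (rule df_wedge_germ_ideal[OF f]) (use \<gamma>(3) in \<open>simp add: \<delta>_def[abs_def]\<close>)
      have d\<delta>: "df_wedge f \<delta> I z = df_wedge f \<kappa> I z - (z $ j - x $ j) ^ v j * df_wedge f \<gamma> I z" for I z
      proof -
        have "df_wedge f \<delta> I z = df_wedge f \<kappa> I z - df_wedge f (df_wedge f \<beta>) I z - (z $ j - x $ j) ^ v j * df_wedge f \<gamma> I z"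
          by (simp only: df_wedge_def[of f \<delta>] df_wedge_def[of f \<kappa>] df_wedge_def[of f "df_wedge f \<beta>"] df_wedge_def[of f \<gamma>] \<delta>_def
            sum_distrib_left right_diff_distrib sum_subtractf mult_ac)
        then show ?thesis by simp
      qed
      have "(\<lambda>z. \<alpha> I z - df_wedge f \<gamma> I z) \<in> germ_ideal x v S" for I
      proof (rule germ_ideal_regular_power[OF _ S(2)])
        have "(\<lambda>z. df_wedge f \<delta> I z + contraction (c j) (df_wedge f \<alpha>) I z) \<in> germ_ideal x v S"
          by (rule germ_ideal_add[OF \<delta> cl])
        then show "(\<lambda>z. (z $ j - x $ j) ^ v j * (\<alpha> I z - df_wedge f \<gamma> I z)) \<in> germ_ideal x v S"
        proof (rule germ_ideal_cong)
          show "\<forall>\<^sub>F z in nhds x. (z $ j - x $ j) ^ v j * (\<alpha> I z - df_wedge f \<gamma> I z) =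
              df_wedge f \<delta> I z + contraction (c j) (df_wedge f \<alpha>) I z"
            using hom[of I] by eventually_elim (simp add: d\<delta> algebra_simps)
        qed
        show "holomorphic_near x (\<lambda>z. \<alpha> I z - df_wedge f \<gamma> I z)"
          by (intro holomorphic_near_diff \<alpha>h shifted_forms_holomorphic[OF shifted_forms_df_wedge[OF \<gamma>s f]])
      qed
      then show ?thesis using \<gamma>s Suc S(3) by auto
    qed
  qed
qed

theorem koszul_exact:
  fixes x :: "'n::{finite,linorder} cspace"
  assumes f: "holomorphic_near x f" and c: "\<And>j i. holomorphic_near x (c j i)"
    and cf: "\<And>j. \<forall>\<^sub>F z in nhds x. (z $ j - x $ j) ^ v j = (\<Sum>i\<in>UNIV. pd i f z * c j i z)"
    and \<alpha>: "\<alpha> \<in> an_forms x (Suc p)" and p: "Suc p < CARD('n)" and closed: "germ_eq x (df_wedge f \<alpha>) 0"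
  shows "\<exists>\<beta>\<in>an_forms x p. germ_eq x \<alpha> (df_wedge f \<beta>)"
proof -
  have "\<exists>\<beta>\<in>shifted_forms x (Suc (Suc p) - 1). \<forall>I. (\<lambda>z. \<alpha> I z - df_wedge f \<beta> I z) \<in> germ_ideal x v (- UNIV)"
  proof (rule koszul_exact_modulo[OF f c cf])
    show "Suc (Suc p) + card (- UNIV :: 'n set) \<le> CARD('n)" using p by simp
    show "\<alpha> \<in> shifted_forms x (Suc (Suc p))" using \<alpha> by simp
    fix I show "df_wedge f \<alpha> I \<in> germ_ideal x v (- UNIV)"
      using closed unfolding germ_eq_def by (simp add: germ_ideal_empty eventually_mono)
  qed
  then obtain \<beta> where \<beta>: "\<beta> \<in> an_forms x p" "\<And>I. \<forall>\<^sub>F z in nhds x. \<alpha> I z - df_wedge f \<beta> I z = 0"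
    by (auto simp: germ_ideal_empty)
  have "germ_eq x \<alpha> (df_wedge f \<beta>)"
    using eventually_all_finite[OF \<beta>(2)] unfolding germ_eq_def by simp
  with \<beta>(1) show ?thesis by blast
qed

section \<open>From germs to polynomials\<close>

lemma germ_ideal_cong_exponent:
  assumes "\<And>i. i \<in> S \<Longrightarrow> v i = v' i"
  shows "germ_ideal x v S = germ_ideal x v' S"
proof -
  have "(\<Sum>i\<in>S. (z $ i - x $ i) ^ v i * b i z) = (\<Sum>i\<in>S. (z $ i - x $ i) ^ v' i * b i z)" for b z
    using assms by (intro sum.cong) auto
  then show ?thesis by (simp add: germ_ideal_def)
qed

lemma germ_ideal_shift:
  fixes x :: "'n::finite cspace"
  assumes "g \<in> germ_ideal x (v(j := v j - 1)) S" "v j \<noteq> 0"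
  shows "(\<lambda>z. (z $ j - x $ j) * g z) \<in> germ_ideal x v S"
proof -
  obtain b where b: "\<And>i. holomorphic_near x (b i)"
    "\<forall>\<^sub>F z in nhds x. g z = (\<Sum>i\<in>S. (z $ i - x $ i) ^ (v(j := v j - 1)) i * b i z)"
    by (rule germ_idealE[OF assms(1)]) blast
  define b' where "b' i = (if i = j then b i else (\<lambda>z. (z $ j - x $ j) * b i z))" for i
  show ?thesis
  proof (rule germ_idealI[of x b'])
    show "holomorphic_near x (b' i)" for i
      unfolding b'_def using b(1)
      by (auto intro!: holomorphic_near_mult holomorphic_near_diff holomorphic_near_coord)
    have "(z $ j - x $ j) * ((z $ i - x $ i) ^ (v(j := v j - 1)) i * b i z) = (z $ i - x $ i) ^ v i * b' i z" for i z
      using assms(2) by (cases "v j") (auto simp: b'_def)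
    then show "\<forall>\<^sub>F z in nhds x. (z $ j - x $ j) * g z = (\<Sum>i\<in>S. (z $ i - x $ i) ^ v i * b' i z)"
      using b(2) by (elim eventually_mono) (simp only: sum_distrib_left)
  qed
qed

text \<open>
  Lowering one exponent at a time, the coefficients in Hadamard's lemma are truncated by induction.
\<close>

lemma germ_truncation:
  fixes x :: "'n::finite cspace"
  assumes "holomorphic_near x h"
  shows "\<exists>T\<in>polyfun. (\<lambda>z. h z - T z) \<in> germ_ideal x v UNIV"
  using assms
proof (induction "sum v UNIV" arbitrary: v h rule: less_induct)
  case less
  show ?case
  proof (cases "\<exists>j. v j = 0")
    case True
    then obtain j where "v j = 0" by blast
    then have "h \<in> germ_ideal x v UNIV"
      using germ_ideal_generator[of j UNIV x h v] less.prems by simp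
    then show ?thesis by (intro bexI[of _ "\<lambda>_. 0"]) auto
  next
    case False
    define H where "H j = cone_int x 0 (pd j h)" for j
    have "\<exists>T\<in>polyfun. (\<lambda>z. H j z - T z) \<in> germ_ideal x (v(j := v j - 1)) UNIV" for j
    proof (rule less.hyps)
      show "sum (v(j := v j - 1)) UNIV < sum v UNIV"
        by (rule sum_strict_mono_ex1) (use False in \<open>auto intro!: exI[of _ j]\<close>)
      show "holomorphic_near x (H j)"
        unfolding H_def by (intro cone_int_holomorphic holomorphic_near_pd less.prems)
    qed
    then have "\<forall>j. \<exists>T. T \<in> polyfun \<and> (\<lambda>z. H j z - T z) \<in> germ_ideal x (v(j := v j - 1)) UNIV" by blast
    from choice[OF this] obtain T where
      "\<forall>j. T j \<in> polyfun \<and> (\<lambda>z. H j z - T j z) \<in> germ_ideal x (v(j := v j - 1)) UNIV" ..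
    then have T: "T j \<in> polyfun" "(\<lambda>z. H j z - T j z) \<in> germ_ideal x (v(j := v j - 1)) UNIV" for j
      by simp_all
    have "(\<lambda>z. \<Sum>j\<in>UNIV. (z $ j - x $ j) * (H j z - T j z)) \<in> germ_ideal x v UNIV"
      by (intro germ_ideal_sum germ_ideal_shift[OF T(2)]) (use False in simp)
    moreover have "\<forall>\<^sub>F z in nhds x. h z - (h x + (\<Sum>j\<in>UNIV. (z $ j - x $ j) * T j z)) =
       (\<Sum>j\<in>UNIV. (z $ j - x $ j) * (H j z - T j z))"
      using hadamard[OF less.prems] unfolding H_def[symmetric]
      by eventually_elim (simp add: right_diff_distrib sum_subtractf)
    ultimately have "(\<lambda>z. h z - (h x + (\<Sum>j\<in>UNIV. (z $ j - x $ j) * T j z))) \<in> germ_ideal x v UNIV"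
      by (rule germ_ideal_cong)
    moreover have "(\<lambda>z. h x + (\<Sum>j\<in>UNIV. (z $ j - x $ j) * T j z)) \<in> polyfun"
      by (intro polyfun_add polyfun_const polyfun_sum polyfun_mult polyfun_diff polyfun_coord T)
    ultimately show ?thesis by (rule bexI)
  qed
qed

lemma polyfun_on_line:
  assumes "g \<in> polyfun"
  shows "\<exists>P. \<forall>t. g (rescale x (\<lambda>_. t) y) = poly P t"
  using assms
proof (induction rule: polyfun_induct)
  case (const c)
  show ?case by (intro exI[of _ "[:c:]"]) simp
next
  case (coord j)
  show ?case by (intro exI[of _ "[:x $ j, y $ j - x $ j:]"]) simp
next
  case (add g h)
  then obtain P Q where "\<forall>t. g (rescale x (\<lambda>_. t) y) = poly P t" "\<forall>t. h (rescale x (\<lambda>_. t) y) = poly Q t" by blast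
  then show ?case by (intro exI[of _ "P + Q"]) simp
next
  case (mult g h)
  then obtain P Q where "\<forall>t. g (rescale x (\<lambda>_. t) y) = poly P t" "\<forall>t. h (rescale x (\<lambda>_. t) y) = poly Q t" by blast
  then show ?case by (intro exI[of _ "P * Q"]) simp
qed

lemma rescale_tendsto:
  "((\<lambda>t. rescale x (\<lambda>_. t) y) \<longlongrightarrow> x) (at 0)"
proof -
  have "((\<lambda>t. x + (\<chi> k. t * (y $ k - x $ k))) \<longlongrightarrow> x + (\<chi> k. 0 * (y $ k - x $ k))) (at 0)"
    by (intro tendsto_intros)
  moreover have "x + (\<chi> k. 0 * (y $ k - x $ k)) = x" by (simp add: vec_eq_iff)
  ultimately show ?thesis by (simp only: rescale_def)
qed

text \<open>
  On each line through \<open>x\<close> the polynomial has infinitely many zeros.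
\<close>

lemma polyfun_zero_near:
  assumes "g \<in> polyfun" "\<forall>\<^sub>F z in nhds x. g z = 0"
  shows "g y = 0"
proof -
  obtain P where P: "\<And>t. g (rescale x (\<lambda>_. t) y) = poly P t" using polyfun_on_line[OF assms(1)] by blast
  have "\<forall>\<^sub>F t in at 0. g (rescale x (\<lambda>_. t) y) = 0"
    using eventually_compose_filterlim[OF assms(2) rescale_tendsto] .
  then have ev: "\<forall>\<^sub>F t in at 0. poly P t = 0" by (simp add: P)
  have "P = 0"
  proof (rule ccontr)
    assume "P \<noteq> 0"
    then have "finite {t. poly P t = 0}" by (rule poly_roots_finite)
    then have "\<not> 0 islimpt {t. poly P t = 0}" using islimpt_finite by blast
    then have "\<forall>\<^sub>F t in at 0. t \<notin> {t. poly P t = 0}" by (simp add: islimpt_iff_eventually)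
    with ev have "\<forall>\<^sub>F t in at (0::complex). False" by eventually_elim simp
    then show False by simp
  qed
  then show ?thesis using P[of 1] by simp
qed

lemma rescale_restrict_tendsto: "((\<lambda>z. rescale x (\<lambda>k. if k = j then 0 else 1) z) \<longlongrightarrow> x) (nhds x)"
proof -
  have "((\<lambda>z. x + (\<chi> k. (if k = j then 0 else 1) * (z $ k - x $ k))) \<longlongrightarrow>
      x + (\<chi> k. (if k = j then 0 else 1) * (x $ k - x $ k))) (nhds x)"
    by (intro tendsto_intros) (auto simp: filterlim_ident)
  moreover have "x + (\<chi> k. (if k = j then 0 else 1) * (x $ k - x $ k)) = x" by (simp add: vec_eq_iff)
  ultimately show ?thesis by (simp only: rescale_def)
qed

text \<open>
  The coefficients of a germ representation need not be polynomials, so they are replaced one variable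
  at a time: the restriction of \<open>r\<close> to \<open>z\<^sub>j = x\<^sub>j\<close> involves one generator less, and the quotient of the
  remainder by \<open>z\<^sub>j - x\<^sub>j\<close> lies in the ideal with the exponent of \<open>z\<^sub>j - x\<^sub>j\<close> lowered, because that
  coordinate is regular modulo the others.
\<close>

lemma polyfun_in_germ_ideal:
  fixes x :: "'n::finite cspace"
  assumes "r \<in> polyfun" "r \<in> germ_ideal x v S"
  shows "\<exists>q. (\<forall>i. q i \<in> polyfun) \<and> (\<forall>z. r z = (\<Sum>i\<in>S. (z $ i - x $ i) ^ v i * q i z))"
  using assms
proof (induction "card S + sum v S" arbitrary: S v r rule: less_induct)
  case less
  show ?case
  proof (cases "S = {}")
    case True
    then have "r z = 0" for z using polyfun_zero_near less.prems by (simp add: germ_ideal_empty)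
    then show ?thesis using True by (intro exI[of _ "\<lambda>_ _. 0"]) simp
  next
    case False
    then obtain j where j: "j \<in> S" by blast
    define S' where "S' = S - {j}"
    have S': "S = insert j S'" "j \<notin> S'" using j by (auto simp: S'_def)
    show ?thesis
    proof (cases "v j = 0")
      case True
      have "(\<Sum>i\<in>S. (z $ i - x $ i) ^ v i * (if i = j then r else (\<lambda>_. 0)) z) = r z" for z
      proof -
        have "(\<Sum>i\<in>S. (z $ i - x $ i) ^ v i * (if i = j then r else (\<lambda>_. 0)) z) = (\<Sum>i\<in>S. if i = j then r z else 0)"
          by (intro sum.cong) (auto simp: True)
        then show ?thesis using j by simp
      qed
      then show ?thesis
        using less.prems(1) by (intro exI[of _ "\<lambda>i. if i = j then r else (\<lambda>_. 0)"] conjI allI) auto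
    next
      case False
      let ?s = "rescale x (\<lambda>k. if k = j then 0 else 1)"
      define v' where "v' = v(j := v j - 1)"
      obtain b where b: "\<And>i. holomorphic_near x (b i)" "\<forall>\<^sub>F z in nhds x. r z = (\<Sum>i\<in>S. (z $ i - x $ i) ^ v i * b i z)"
        by (rule germ_idealE[OF less.prems(2)]) blast
      have "\<forall>\<^sub>F z in nhds x. r (?s z) = (\<Sum>i\<in>S. (?s z $ i - x $ i) ^ v i * b i (?s z))"
        by (rule eventually_compose_filterlim[OF b(2) rescale_restrict_tendsto])
      then have "\<forall>\<^sub>F z in nhds x. r (?s z) = (\<Sum>i\<in>S'. (z $ i - x $ i) ^ v i * b i (?s z))"
      proof eventually_elim
        case (elim z)
        have "(\<Sum>i\<in>S'. (?s z $ i - x $ i) ^ v i * b i (?s z)) = (\<Sum>i\<in>S'. (z $ i - x $ i) ^ v i * b i (?s z))"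
          using S'(2) by (intro sum.cong) auto
        then show ?case using elim S' False by simp
      qed
      then have "(\<lambda>z. r (?s z)) \<in> germ_ideal x v S'"
        by (rule germ_idealI[rotated]) (rule holomorphic_near_restrict[OF b(1)])
      moreover have "card S' + sum v S' < card S + sum v S" using S' by simp
      moreover have "(\<lambda>z. r (?s z)) \<in> polyfun" by (rule polyfun_restrict[OF less.prems(1)])
      ultimately obtain q where q: "\<And>i. q i \<in> polyfun" "\<And>z. r (?s z) = (\<Sum>i\<in>S'. (z $ i - x $ i) ^ v i * q i z)"
        using less.hyps by blast
      obtain r' where r': "r' \<in> polyfun" "\<And>z. r z = r (?s z) + (z $ j - x $ j) * r' z"
        using polyfun_divide_coord[OF less.prems(1)] by blast
      have jh: "holomorphic_near x (\<lambda>z. (z $ j - x $ j) ^ (v j - 1) * b j z)"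
        by (intro holomorphic_near_mult holomorphic_near_power holomorphic_near_diff holomorphic_near_coord holomorphic_near_const b)
      have "(\<lambda>z. (z $ j - x $ j) * (r' z - (z $ j - x $ j) ^ (v j - 1) * b j z)) \<in> germ_ideal x v S'"
      proof (rule germ_idealI[of x "\<lambda>i z. b i z - q i z"])
        show "holomorphic_near x (\<lambda>z. b i z - q i z)" for i
          by (intro holomorphic_near_diff b polyfun_holomorphic_near q)
        show "\<forall>\<^sub>F z in nhds x. (z $ j - x $ j) * (r' z - (z $ j - x $ j) ^ (v j - 1) * b j z) =
            (\<Sum>i\<in>S'. (z $ i - x $ i) ^ v i * (b i z - q i z))"
          using b(2)
        proof eventually_elim
          case (elim z)
          have "(z $ j - x $ j) * r' z = r z - r (?s z)" using r'(2)[of z] by simp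
          moreover have "(z $ j - x $ j) * (z $ j - x $ j) ^ (v j - 1) = (z $ j - x $ j) ^ v j"
            using False by (cases "v j") auto
          moreover have "r z = (z $ j - x $ j) ^ v j * b j z + (\<Sum>i\<in>S'. (z $ i - x $ i) ^ v i * b i z)"
            using elim S' by simp
          ultimately show ?case
            by (simp add: right_diff_distrib sum_subtractf q(2) flip: mult.assoc)
        qed
      qed
      then have "(\<lambda>z. r' z - (z $ j - x $ j) ^ (v j - 1) * b j z) \<in> germ_ideal x v S'"
        by (rule germ_ideal_regular[OF _ S'(2)])
          (intro holomorphic_near_diff polyfun_holomorphic_near r' jh)
      also have "germ_ideal x v S' = germ_ideal x v' S'"
        by (rule germ_ideal_cong_exponent) (use S'(2) in \<open>auto simp: v'_def\<close>)
      finally have 1: "(\<lambda>z. r' z - (z $ j - x $ j) ^ (v j - 1) * b j z) \<in> germ_ideal x v' S"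
        by (rule germ_ideal_mono) (use S' in auto)
      have 2: "(\<lambda>z. (z $ j - x $ j) ^ v' j * b j z) \<in> germ_ideal x v' S"
        by (rule germ_ideal_generator[OF j b(1)])
      have "r' \<in> germ_ideal x v' S"
        using germ_ideal_add[OF 1 2] by (simp add: v'_def)
      moreover have "sum v' S < sum v S"
        by (rule sum_strict_mono_ex1) (use False j in \<open>auto simp: v'_def intro!: bexI[of _ j]\<close>)
      ultimately obtain q' where q': "\<And>i. q' i \<in> polyfun" "\<And>z. r' z = (\<Sum>i\<in>S. (z $ i - x $ i) ^ v' i * q' i z)"
        using less.hyps[of S v' r'] r'(1) by auto
      define Q where "Q i = (if i = j then q' j else (\<lambda>z. q i z + (z $ j - x $ j) * q' i z))" for i
      have "r z = (\<Sum>i\<in>S. (z $ i - x $ i) ^ v i * Q i z)" for z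
      proof -
        have "(z $ j - x $ j) * ((z $ j - x $ j) ^ v' j * q' j z) = (z $ j - x $ j) ^ v j * Q j z"
          using False by (cases "v j") (auto simp: Q_def v'_def)
        moreover have "(\<Sum>i\<in>S'. (z $ i - x $ i) ^ v i * q i z) + (z $ j - x $ j) * (\<Sum>i\<in>S'. (z $ i - x $ i) ^ v' i * q' i z) =
            (\<Sum>i\<in>S'. (z $ i - x $ i) ^ v i * Q i z)"
          unfolding sum_distrib_left sum.distrib[symmetric] using S'(2)
          by (intro sum.cong) (auto simp: Q_def v'_def algebra_simps)
        ultimately show ?thesis
          using S' by (subst r'(2)) (simp add: q(2) q'(2) distrib_left)
      qed
      moreover have "Q i \<in> polyfun" for i
        unfolding Q_def using q(1) q'(1)
        by (auto intro!: polyfun_add polyfun_mult polyfun_diff polyfun_coord)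
      ultimately show ?thesis by blast
    qed
  qed
qed

section \<open>The Jacobian ideal\<close>

definition jacobian_ideal :: "('n::finite cspace \<Rightarrow> complex) \<Rightarrow> ('n cspace \<Rightarrow> complex) set" where
  "jacobian_ideal f = {g. \<exists>r. (\<forall>i. r i \<in> polyfun) \<and> g = (\<lambda>z. \<Sum>i\<in>UNIV. pd i f z * r i z)}"

lemma jacobian_idealI:
  "(\<And>i. r i \<in> polyfun) \<Longrightarrow> (\<And>z. g z = (\<Sum>i\<in>UNIV. pd i f z * r i z)) \<Longrightarrow> g \<in> jacobian_ideal f"
  unfolding jacobian_ideal_def by blast

lemma jacobian_idealE:
  assumes "g \<in> jacobian_ideal f"
  obtains r where "\<And>i. r i \<in> polyfun" "\<And>z. g z = (\<Sum>i\<in>UNIV. pd i f z * r i z)"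
  using assms unfolding jacobian_ideal_def by blast

lemma jacobian_poly_ideal:
  assumes "f \<in> polyfun"
  shows "poly_ideal (jacobian_ideal f)"
  unfolding poly_ideal_def
proof (intro conjI ballI subsetI)
  fix g assume "g \<in> jacobian_ideal f"
  then obtain r where r: "\<And>i. r i \<in> polyfun" "\<And>z. g z = (\<Sum>i\<in>UNIV. pd i f z * r i z)"
    by (elim jacobian_idealE) blast
  have "(\<lambda>z. \<Sum>i\<in>UNIV. pd i f z * r i z) \<in> polyfun"
    by (intro polyfun_sum polyfun_mult polyfun_pd assms r)
  then show "g \<in> polyfun" using r(2) by presburger
next
  show "(\<lambda>_. 0) \<in> jacobian_ideal f" by (rule jacobian_idealI[of "\<lambda>_ _. 0"]) simp_all
next
  fix g h assume "g \<in> jacobian_ideal f" "h \<in> jacobian_ideal f"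
  then obtain r s where r: "\<And>i. r i \<in> polyfun" "\<And>z. g z = (\<Sum>i\<in>UNIV. pd i f z * r i z)"
    and s: "\<And>i. s i \<in> polyfun" "\<And>z. h z = (\<Sum>i\<in>UNIV. pd i f z * s i z)"
    by (elim jacobian_idealE) blast
  show "(\<lambda>z. g z + h z) \<in> jacobian_ideal f"
    by (rule jacobian_idealI[of "\<lambda>i z. r i z + s i z"]) (intro polyfun_add r s, simp add: r s distrib_left sum.distrib)
next
  fix g h :: "'a cspace \<Rightarrow> complex" assume g: "g \<in> polyfun" and "h \<in> jacobian_ideal f"
  then obtain s where s: "\<And>i. s i \<in> polyfun" "\<And>z. h z = (\<Sum>i\<in>UNIV. pd i f z * s i z)"
    by (elim jacobian_idealE) blast
  show "(\<lambda>z. g z * h z) \<in> jacobian_ideal f"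
    by (rule jacobian_idealI[of "\<lambda>i z. g z * s i z"]) (intro polyfun_mult g s, simp add: s sum_distrib_left mult_ac)
qed

lemma jacobian_common_zero:
  assumes "\<And>u. u \<in> jacobian_ideal f \<Longrightarrow> u p = 0"
  shows "p \<in> Sing f"
proof -
  have "pd i f p = 0" for i
  proof -
    have "pd i f \<in> jacobian_ideal f"
    proof (rule jacobian_idealI[of "\<lambda>k _. if k = i then 1 else 0"])
      fix z
      have "(\<Sum>k\<in>UNIV. pd k f z * (if k = i then 1 else 0)) = (\<Sum>k\<in>UNIV. if k = i then pd i f z else 0)"
        by (intro sum.cong) auto
      then show "pd i f z = (\<Sum>k\<in>UNIV. pd k f z * (if k = i then 1 else 0))" by simp
    qed auto
    then show ?thesis by (rule assms)
  qed
  then show ?thesis by (simp add: Sing_def)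
qed

text \<open>
  Apply the Nullstellensatz to \<open>(z\<^sub>j - p\<^sub>j) e\<close>, where the polynomial \<open>e\<close> vanishes at the critical points
  other than \<open>p\<close>.
\<close>

lemma jacobian_coord_power:
  fixes f :: "'n::finite cspace \<Rightarrow> complex"
  assumes f: "f \<in> polyfun" and fin: "finite (Sing f)"
  shows "\<exists>s v. s \<in> polyfun \<and> s p \<noteq> 0 \<and> (\<lambda>z. s z * (z $ j - p $ j) ^ v) \<in> jacobian_ideal f"
proof -
  have "\<exists>i. p $ i \<noteq> q $ i" if "q \<noteq> p" for q using that by (metis vec_eq_iff)
  then obtain i where i: "\<And>q. q \<noteq> p \<Longrightarrow> p $ i q \<noteq> q $ i q" by metis
  define e where "e z = (\<Prod>q\<in>Sing f - {p}. z $ i q - q $ i q)" for z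
  have e: "e \<in> polyfun"
    unfolding e_def[abs_def] by (intro polyfun_prod polyfun_diff polyfun_coord polyfun_const)
  have ep: "e p \<noteq> 0" using i fin by (auto simp: e_def)
  have e0: "e q = 0" if "q \<in> Sing f" "q \<noteq> p" for q
    unfolding e_def by (rule prod_zero) (use that fin in \<open>auto intro!: bexI[of _ q]\<close>)
  have "\<exists>N. (\<lambda>z. ((z $ j - p $ j) * e z) ^ N) \<in> jacobian_ideal f"
  proof (rule nullstellensatz[OF jacobian_poly_ideal[OF f]])
    show "(\<lambda>z. (z $ j - p $ j) * e z) \<in> polyfun"
      by (intro polyfun_mult polyfun_diff polyfun_coord polyfun_const e)
    fix q assume "\<And>u. u \<in> jacobian_ideal f \<Longrightarrow> u q = 0"
    then have "q \<in> Sing f" by (rule jacobian_common_zero)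
    then show "(q $ j - p $ j) * e q = 0" using e0 by (cases "q = p") auto
  qed
  then obtain N where "(\<lambda>z. ((z $ j - p $ j) * e z) ^ N) \<in> jacobian_ideal f" by blast
  then have "(\<lambda>z. e z ^ N * (z $ j - p $ j) ^ N) \<in> jacobian_ideal f"
    by (simp add: power_mult_distrib mult.commute)
  moreover have "(\<lambda>z. e z ^ N) \<in> polyfun" by (rule polyfun_power[OF e])
  ultimately show ?thesis using ep by (intro exI[of _ "\<lambda>z. e z ^ N"] exI[of _ N]) simp
qed

lemma coord_power_near:
  fixes f :: "'n::finite cspace \<Rightarrow> complex"
  assumes f: "f \<in> polyfun" and fin: "finite (Sing f)"
  shows "\<exists>v c. (\<forall>j i. holomorphic_near p (c j i)) \<and>
    (\<forall>j. \<forall>\<^sub>F z in nhds p. (z $ j - p $ j) ^ v j = (\<Sum>i\<in>UNIV. pd i f z * c j i z))"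
proof -
  have "\<exists>v c. (\<forall>i. holomorphic_near p (c i)) \<and>
    (\<forall>\<^sub>F z in nhds p. (z $ j - p $ j) ^ v = (\<Sum>i\<in>UNIV. pd i f z * c i z))" for j
  proof -
    obtain s v where s: "s \<in> polyfun" "s p \<noteq> 0" "(\<lambda>z. s z * (z $ j - p $ j) ^ v) \<in> jacobian_ideal f"
      using jacobian_coord_power[OF f fin] by blast
    obtain r where r: "\<And>i. r i \<in> polyfun" "\<And>z. s z * (z $ j - p $ j) ^ v = (\<Sum>i\<in>UNIV. pd i f z * r i z)"
      using s(3) by (elim jacobian_idealE) blast
    note inv = holomorphic_near_inverse[OF polyfun_holomorphic_near[OF s(1)] s(2)]
    have "\<forall>\<^sub>F z in nhds p. (z $ j - p $ j) ^ v = (\<Sum>i\<in>UNIV. pd i f z * (inverse (s z) * r i z))"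
      using inv(2)
    proof eventually_elim
      case (elim z)
      have "(\<Sum>i\<in>UNIV. pd i f z * (inverse (s z) * r i z)) = inverse (s z) * (s z * (z $ j - p $ j) ^ v)"
        unfolding r(2) sum_distrib_left by (simp add: mult_ac)
      then show ?case using elim by simp
    qed
    moreover have "holomorphic_near p (\<lambda>z. inverse (s z) * r i z)" for i
      by (intro holomorphic_near_mult inv polyfun_holomorphic_near r)
    ultimately show ?thesis
      by (intro exI[of _ v] exI[of _ "\<lambda>i z. inverse (s z) * r i z"] conjI allI)
  qed
  then have "\<forall>j. \<exists>v c. (\<forall>i. holomorphic_near p (c i)) \<and>
    (\<forall>\<^sub>F z in nhds p. (z $ j - p $ j) ^ v = (\<Sum>i\<in>UNIV. pd i f z * c i z))" ..
  from choice[OF this] obtain v where "\<forall>j. \<exists>c. (\<forall>i. holomorphic_near p (c i)) \<and>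
    (\<forall>\<^sub>F z in nhds p. (z $ j - p $ j) ^ v j = (\<Sum>i\<in>UNIV. pd i f z * c i z))" ..
  from choice[OF this] obtain c where "\<forall>j. (\<forall>i. holomorphic_near p (c j i)) \<and>
    (\<forall>\<^sub>F z in nhds p. (z $ j - p $ j) ^ v j = (\<Sum>i\<in>UNIV. pd i f z * c j i z))" ..
  then show ?thesis by (intro exI[of _ v] exI[of _ c]) simp
qed

text \<open>
  Consider the ideal of all \<open>u\<close> with \<open>u g \<in> J\<close>, for \<open>J\<close> the Jacobian ideal. If it is proper, it has a
  zero \<open>p\<close>, which is a critical point. Truncating the local coefficients \<open>h i\<close> gives \<open>g = r\<close> modulo \<open>J\<close>
  with a polynomial \<open>r\<close> in the ideal of the powers \<open>(z\<^sub>j - p\<^sub>j)\<^bsup>v j\<^esup>\<close>. Some \<open>S\<close> with \<open>S p \<noteq> 0\<close> multiplies all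
  these powers into \<open>J\<close>, so \<open>S g \<in> J\<close>, a contradiction.
\<close>

theorem jacobian_local_global:
  fixes f :: "'n::finite cspace \<Rightarrow> complex"
  assumes f: "f \<in> polyfun" and fin: "finite (Sing f)" and g: "g \<in> polyfun"
    and loc: "\<And>p. p \<in> Sing f \<Longrightarrow> \<exists>h. (\<forall>i. holomorphic_near p (h i)) \<and>
      (\<forall>\<^sub>F z in nhds p. g z = (\<Sum>i\<in>UNIV. pd i f z * h i z))"
  shows "g \<in> jacobian_ideal f"
proof (rule ccontr)
  assume no: "g \<notin> jacobian_ideal f"
  note J = jacobian_poly_ideal[OF f]
  define I where "I = {u \<in> polyfun. (\<lambda>z. u z * g z) \<in> jacobian_ideal f}"
  have I: "poly_ideal I"
    unfolding poly_ideal_def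
  proof (intro conjI ballI subsetI)
    show "u \<in> polyfun" if "u \<in> I" for u using that by (simp add: I_def)
    show "(\<lambda>_. 0) \<in> I" using poly_ideal_zero[OF J] by (simp add: I_def)
  next
    fix u w :: "'n cspace \<Rightarrow> complex" assume "u \<in> I" "w \<in> I"
    then have "u \<in> polyfun" "w \<in> polyfun" "(\<lambda>z. u z * g z + w z * g z) \<in> jacobian_ideal f"
      by (auto simp: I_def intro!: poly_ideal_add[OF J])
    then show "(\<lambda>z. u z + w z) \<in> I" by (simp add: I_def distrib_right polyfun_add)
  next
    fix u w :: "'n cspace \<Rightarrow> complex" assume "u \<in> polyfun" "w \<in> I"
    then have "u \<in> polyfun" "w \<in> polyfun" "(\<lambda>z. u z * (w z * g z)) \<in> jacobian_ideal f"
      by (auto simp: I_def intro!: poly_ideal_mult[OF J])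
    then show "(\<lambda>z. u z * w z) \<in> I" by (simp add: I_def mult.assoc polyfun_mult)
  qed
  have "\<exists>p. \<forall>u\<in>I. u p = 0"
  proof (rule ccontr)
    assume "\<not> ?thesis"
    then have "\<exists>N. (\<lambda>z. 1 ^ N) \<in> I"
      by (intro nullstellensatz[OF I]) auto
    then show False using no by (simp add: I_def)
  qed
  then obtain p where p: "\<And>u. u \<in> I \<Longrightarrow> u p = 0" by blast
  have "jacobian_ideal f \<subseteq> I"
  proof
    fix u assume u: "u \<in> jacobian_ideal f"
    have "(\<lambda>z. g z * u z) \<in> jacobian_ideal f" by (rule poly_ideal_mult[OF J g u])
    then show "u \<in> I" using u J by (auto simp: I_def mult.commute poly_ideal_def)
  qed
  then have sing: "p \<in> Sing f" using p jacobian_common_zero by blast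
  have "\<forall>j. \<exists>s v. s \<in> polyfun \<and> s p \<noteq> 0 \<and> (\<lambda>z. s z * (z $ j - p $ j) ^ v) \<in> jacobian_ideal f"
    using jacobian_coord_power[OF f fin] by blast
  from choice[OF this] obtain s where
    "\<forall>j. \<exists>v. s j \<in> polyfun \<and> s j p \<noteq> 0 \<and> (\<lambda>z. s j z * (z $ j - p $ j) ^ v) \<in> jacobian_ideal f" ..
  from choice[OF this] obtain v where
    "\<forall>j. s j \<in> polyfun \<and> s j p \<noteq> 0 \<and> (\<lambda>z. s j z * (z $ j - p $ j) ^ v j) \<in> jacobian_ideal f" ..
  then have s: "s j \<in> polyfun" "s j p \<noteq> 0" "(\<lambda>z. s j z * (z $ j - p $ j) ^ v j) \<in> jacobian_ideal f" for j
    by simp_all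
  obtain h where h: "\<And>i. holomorphic_near p (h i)" "\<forall>\<^sub>F z in nhds p. g z = (\<Sum>i\<in>UNIV. pd i f z * h i z)"
    using loc[OF sing] by blast
  have "\<forall>i. \<exists>T. T \<in> polyfun \<and> (\<lambda>z. h i z - T z) \<in> germ_ideal p v UNIV"
    using germ_truncation[OF h(1)] by blast
  from choice[OF this] obtain T where
    "\<forall>i. T i \<in> polyfun \<and> (\<lambda>z. h i z - T i z) \<in> germ_ideal p v UNIV" ..
  then have T: "T i \<in> polyfun" "(\<lambda>z. h i z - T i z) \<in> germ_ideal p v UNIV" for i
    by simp_all
  define r where "r z = g z - (\<Sum>i\<in>UNIV. pd i f z * T i z)" for z
  have TJ: "(\<lambda>z. \<Sum>i\<in>UNIV. pd i f z * T i z) \<in> jacobian_ideal f"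
    by (rule jacobian_idealI[OF T(1) refl])
  have rp: "r \<in> polyfun"
    unfolding r_def[abs_def] by (intro polyfun_diff polyfun_sum polyfun_mult polyfun_pd f g T)
  have "r \<in> germ_ideal p v UNIV"
  proof (rule germ_ideal_cong)
    show "(\<lambda>z. \<Sum>i\<in>UNIV. pd i f z * (h i z - T i z)) \<in> germ_ideal p v UNIV"
      by (intro germ_ideal_sum germ_ideal_mult T holomorphic_near_pd polyfun_holomorphic_near f)
    show "\<forall>\<^sub>F z in nhds p. r z = (\<Sum>i\<in>UNIV. pd i f z * (h i z - T i z))"
      using h(2) by eventually_elim (simp add: r_def right_diff_distrib sum_subtractf)
  qed
  then obtain q where q: "\<And>i. q i \<in> polyfun" "\<And>z. r z = (\<Sum>j\<in>UNIV. (z $ j - p $ j) ^ v j * q j z)"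
    using polyfun_in_germ_ideal[OF rp] by blast
  define S where "S z = (\<Prod>j\<in>UNIV. s j z)" for z
  have Sp: "S \<in> polyfun" unfolding S_def[abs_def] by (intro polyfun_prod s)
  have "(\<lambda>z. \<Sum>j\<in>UNIV. ((\<Prod>k\<in>UNIV - {j}. s k z) * q j z) * (s j z * (z $ j - p $ j) ^ v j)) \<in> jacobian_ideal f"
    by (intro poly_ideal_sum[OF J] poly_ideal_mult[OF J] polyfun_mult polyfun_prod s q)
  moreover have "(\<Sum>j\<in>UNIV. ((\<Prod>k\<in>UNIV - {j}. s k z) * q j z) * (s j z * (z $ j - p $ j) ^ v j)) = S z * r z" for z
  proof -
    have Sj: "S z = s j z * (\<Prod>k\<in>UNIV - {j}. s k z)" for j
      unfolding S_def by (rule prod.remove) auto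
    have "((\<Prod>k\<in>UNIV - {j}. s k z) * q j z) * (s j z * (z $ j - p $ j) ^ v j) = S z * ((z $ j - p $ j) ^ v j * q j z)" for j
      unfolding Sj[of j] by (simp only: mult_ac)
    then show ?thesis by (simp only: q(2) sum_distrib_left)
  qed
  ultimately have "(\<lambda>z. S z * r z) \<in> jacobian_ideal f" by simp
  moreover have "(\<lambda>z. S z * (\<Sum>i\<in>UNIV. pd i f z * T i z)) \<in> jacobian_ideal f"
    by (rule poly_ideal_mult[OF J Sp TJ])
  ultimately have "(\<lambda>z. S z * r z + S z * (\<Sum>i\<in>UNIV. pd i f z * T i z)) \<in> jacobian_ideal f"
    by (rule poly_ideal_add[OF J])
  then have "(\<lambda>z. S z * g z) \<in> jacobian_ideal f"
    by (simp add: r_def right_diff_distrib)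
  then have "S \<in> I" using Sp by (simp add: I_def)
  then have "S p = 0" by (rule p)
  then show False using s(2) by (simp add: S_def)
qed

section \<open>Quotients of additive groups\<close>

locale additive_quotient =
  fixes M R :: "'a::ab_group_add set"
  assumes M_zero: "0 \<in> M" and M_diff: "a \<in> M \<Longrightarrow> b \<in> M \<Longrightarrow> a - b \<in> M"
    and R_sub: "R \<subseteq> M" and R_zero: "0 \<in> R" and R_diff: "a \<in> R \<Longrightarrow> b \<in> R \<Longrightarrow> a - b \<in> R"
begin

abbreviation Q where "Q \<equiv> add_grp M Mod R"
abbreviation cls where "cls a \<equiv> R #>\<^bsub>add_grp M\<^esub> a"

lemma M_uminus: "a \<in> M \<Longrightarrow> - a \<in> M"
  using M_diff[OF M_zero, of a] by simp

lemma M_add: "a \<in> M \<Longrightarrow> b \<in> M \<Longrightarrow> a + b \<in> M"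
  using M_diff[of a "- b"] M_uminus[of b] by simp

lemma R_uminus: "a \<in> R \<Longrightarrow> - a \<in> R"
  using R_diff[OF R_zero, of a] by simp

lemma R_add: "a \<in> R \<Longrightarrow> b \<in> R \<Longrightarrow> a + b \<in> R"
  using R_diff[of a "- b"] R_uminus[of b] by simp

lemma cls_image: "cls a = (\<lambda>r. r + a) ` R"
  by (auto simp: r_coset_def add_grp_def)

lemma cls_eq_iff: "cls a = cls b \<longleftrightarrow> a - b \<in> R"
proof
  assume "cls a = cls b"
  moreover have "a \<in> cls a" unfolding cls_image using R_zero by (intro image_eqI[of _ _ 0]) auto
  ultimately obtain r where "r \<in> R" "a = r + b" unfolding cls_image by auto
  then show "a - b \<in> R" by simp
next
  assume ab: "a - b \<in> R"
  have "r + a \<in> cls b" if "r \<in> R" for r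
    unfolding cls_image using R_add[OF that ab] by (intro image_eqI[of _ _ "r + (a - b)"]) auto
  moreover have "r + b \<in> cls a" if "r \<in> R" for r
    unfolding cls_image using R_diff[OF that ab] by (intro image_eqI[of _ _ "r - (a - b)"]) auto
  ultimately show "cls a = cls b" unfolding cls_image by blast
qed

lemma carrier_Q: "carrier Q = cls ` M"
  by (auto simp: FactGroup_def RCOSETS_def add_grp_def)

lemma one_Q: "\<one>\<^bsub>Q\<^esub> = cls 0"
  by (simp add: FactGroup_def cls_image)

lemma mult_Q: "cls a \<otimes>\<^bsub>Q\<^esub> cls b = cls (a + b)"
proof -
  have "cls a \<otimes>\<^bsub>Q\<^esub> cls b = (\<Union>r\<in>R. \<Union>s\<in>R. {(r + a) + (s + b)})"
    by (simp add: FactGroup_def set_mult_def cls_image) (simp add: add_grp_def)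
  also have "\<dots> = cls (a + b)"
  proof (intro equalityI subsetI)
    fix y assume "y \<in> (\<Union>r\<in>R. \<Union>s\<in>R. {(r + a) + (s + b)})"
    then obtain r s where "r \<in> R" "s \<in> R" "y = (r + s) + (a + b)" by (auto simp: algebra_simps)
    then show "y \<in> cls (a + b)" unfolding cls_image using R_add by blast
  next
    fix y assume "y \<in> cls (a + b)"
    then obtain r where "r \<in> R" "y = (r + a) + (0 + b)" unfolding cls_image by (auto simp: algebra_simps)
    then show "y \<in> (\<Union>r\<in>R. \<Union>s\<in>R. {(r + a) + (s + b)})" using R_zero by blast
  qed
  finally show ?thesis .
qed

lemma comm_group_Q: "comm_group Q"
proof (rule comm_groupI)
  fix x y assume "x \<in> carrier Q" "y \<in> carrier Q"
  then obtain a b where ab: "a \<in> M" "b \<in> M" "x = cls a" "y = cls b" unfolding carrier_Q by blast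
  then show "x \<otimes>\<^bsub>Q\<^esub> y \<in> carrier Q" unfolding carrier_Q ab(3,4) mult_Q using M_add by blast
  show "x \<otimes>\<^bsub>Q\<^esub> y = y \<otimes>\<^bsub>Q\<^esub> x" by (simp only: ab mult_Q add.commute)
  fix z assume "z \<in> carrier Q"
  then obtain c where "z = cls c" unfolding carrier_Q by blast
  then show "x \<otimes>\<^bsub>Q\<^esub> y \<otimes>\<^bsub>Q\<^esub> z = x \<otimes>\<^bsub>Q\<^esub> (y \<otimes>\<^bsub>Q\<^esub> z)" by (simp only: ab mult_Q add.assoc)
next
  show "\<one>\<^bsub>Q\<^esub> \<in> carrier Q" unfolding carrier_Q one_Q using M_zero by blast
next
  fix x assume "x \<in> carrier Q"
  then obtain a where a: "a \<in> M" "x = cls a" unfolding carrier_Q by blast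
  then show "\<one>\<^bsub>Q\<^esub> \<otimes>\<^bsub>Q\<^esub> x = x" by (simp only: one_Q mult_Q add_0_left)
  have "cls (- a) \<otimes>\<^bsub>Q\<^esub> x = \<one>\<^bsub>Q\<^esub>" by (simp only: a mult_Q one_Q left_minus)
  then show "\<exists>y\<in>carrier Q. y \<otimes>\<^bsub>Q\<^esub> x = \<one>\<^bsub>Q\<^esub>" unfolding carrier_Q using M_uminus[OF a(1)] by blast
qed

lemma induced_cls:
  assumes "\<And>r. r \<in> R \<Longrightarrow> \<phi> (r + a) = \<phi> a"
  shows "induced \<phi> (cls a) = \<phi> a"
proof -
  have "\<phi> ` cls a = {\<phi> a}"
    unfolding cls_image image_image using assms R_zero by auto
  then show ?thesis by (simp add: induced_def)
qed

end

section \<open>Localization by an injective endomorphism\<close>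

locale injective_endomorphism = comm_group L for L (structure) +
  fixes \<sigma> :: "'a \<Rightarrow> 'a"
  assumes hom: "\<sigma> \<in> hom L L" and inj: "inj_on \<sigma> (carrier L)"
begin

abbreviation loc where "loc \<equiv> localization L \<sigma>"

lemma pow_closed [simp]: "a \<in> carrier L \<Longrightarrow> (\<sigma> ^^ n) a \<in> carrier L"
  using hom by (induction n) (auto simp: hom_def Pi_def)

lemma pow_mult: "a \<in> carrier L \<Longrightarrow> b \<in> carrier L \<Longrightarrow> (\<sigma> ^^ n) (a \<otimes> b) = (\<sigma> ^^ n) a \<otimes> (\<sigma> ^^ n) b"
  using hom by (induction n) (auto simp: hom_def)

lemma pow_one: "(\<sigma> ^^ n) \<one> = \<one>"
  using hom_one[OF hom is_group is_group] by (induction n) simp_all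

lemma pow_eq_iff: "a \<in> carrier L \<Longrightarrow> b \<in> carrier L \<Longrightarrow> (\<sigma> ^^ n) a = (\<sigma> ^^ n) b \<longleftrightarrow> a = b"
proof (induction n)
  case (Suc n)
  then show ?case using inj_onD[OF inj, of "(\<sigma> ^^ n) a" "(\<sigma> ^^ n) b"] by auto
qed simp

lemma pow_pow: "(\<sigma> ^^ m) ((\<sigma> ^^ n) a) = (\<sigma> ^^ (m + n)) a"
  by (simp add: funpow_add)

lemma loc_rel_iff:
  "((a, k), (b, l)) \<in> loc_rel L \<sigma> \<longleftrightarrow> a \<in> carrier L \<and> b \<in> carrier L \<and> (\<sigma> ^^ l) a = (\<sigma> ^^ k) b"
  unfolding loc_rel_def by (auto simp: pow_eq_iff simp flip: pow_pow)

lemma in_frac: "(b, l) \<in> frac L \<sigma> a k \<longleftrightarrow> a \<in> carrier L \<and> b \<in> carrier L \<and> (\<sigma> ^^ l) a = (\<sigma> ^^ k) b"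
  by (simp add: frac_def loc_rel_iff)

lemma frac_eq_iff:
  assumes "a \<in> carrier L" "b \<in> carrier L"
  shows "frac L \<sigma> a k = frac L \<sigma> b l \<longleftrightarrow> (\<sigma> ^^ l) a = (\<sigma> ^^ k) b"
proof
  assume "frac L \<sigma> a k = frac L \<sigma> b l"
  moreover have "(b, l) \<in> frac L \<sigma> b l" using assms by (simp add: in_frac)
  ultimately have "(b, l) \<in> frac L \<sigma> a k" by simp
  then show "(\<sigma> ^^ l) a = (\<sigma> ^^ k) b" by (simp add: in_frac)
next
  assume eq: "(\<sigma> ^^ l) a = (\<sigma> ^^ k) b"
  have "(c, m) \<in> frac L \<sigma> a k \<longleftrightarrow> (c, m) \<in> frac L \<sigma> b l" for c m
  proof (cases "c \<in> carrier L")
    case True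
    have "(\<sigma> ^^ m) a = (\<sigma> ^^ k) c \<longleftrightarrow> (\<sigma> ^^ l) ((\<sigma> ^^ m) a) = (\<sigma> ^^ l) ((\<sigma> ^^ k) c)"
      using assms True by (simp only: pow_eq_iff pow_closed)
    also have "(\<sigma> ^^ l) ((\<sigma> ^^ m) a) = (\<sigma> ^^ k) ((\<sigma> ^^ m) b)"
      using arg_cong[OF eq, of "\<sigma> ^^ m"] by (simp only: pow_pow add.commute)
    also have "(\<sigma> ^^ l) ((\<sigma> ^^ k) c) = (\<sigma> ^^ k) ((\<sigma> ^^ l) c)"
      by (simp only: pow_pow add.commute)
    also have "(\<sigma> ^^ k) ((\<sigma> ^^ m) b) = (\<sigma> ^^ k) ((\<sigma> ^^ l) c) \<longleftrightarrow> (\<sigma> ^^ m) b = (\<sigma> ^^ l) c"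
      using assms True by (simp only: pow_eq_iff pow_closed)
    finally show ?thesis using assms True by (simp add: in_frac)
  qed (simp add: in_frac)
  then show "frac L \<sigma> a k = frac L \<sigma> b l" by (auto simp: set_eq_iff)
qed

lemma carrier_loc: "carrier loc = {frac L \<sigma> a k | a k. a \<in> carrier L}"
  by (auto simp: localization_def quotient_def frac_def)

lemma frac_closed [simp]: "a \<in> carrier L \<Longrightarrow> frac L \<sigma> a k \<in> carrier loc"
  unfolding carrier_loc by blast

lemma one_loc: "\<one>\<^bsub>loc\<^esub> = frac L \<sigma> \<one> 0"
  by (simp add: localization_def)

lemma Union_frac_const:
  assumes "a \<in> carrier L" "\<And>b l. b \<in> carrier L \<Longrightarrow> (\<sigma> ^^ l) a = (\<sigma> ^^ k) b \<Longrightarrow> F b l = X"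
  shows "(\<Union>(b, l)\<in>frac L \<sigma> a k. F b l) = X"
proof -
  have "(a, k) \<in> frac L \<sigma> a k" using assms(1) by (simp add: in_frac)
  moreover have "F b l = X" if "(b, l) \<in> frac L \<sigma> a k" for b l
    using that assms(2) by (simp add: in_frac)
  ultimately show ?thesis by fastforce
qed

lemma mult_loc:
  assumes a: "a \<in> carrier L" and b: "b \<in> carrier L"
  shows "frac L \<sigma> a k \<otimes>\<^bsub>loc\<^esub> frac L \<sigma> b l = frac L \<sigma> ((\<sigma> ^^ l) a \<otimes> (\<sigma> ^^ k) b) (k + l)"
proof -
  have "frac L \<sigma> a k \<otimes>\<^bsub>loc\<^esub> frac L \<sigma> b l =
     (\<Union>(a', k')\<in>frac L \<sigma> a k. \<Union>(b', l')\<in>frac L \<sigma> b l. frac L \<sigma> ((\<sigma> ^^ l') a' \<otimes> (\<sigma> ^^ k') b') (k' + l'))"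
    by (simp add: localization_def)
  also have "\<dots> = frac L \<sigma> ((\<sigma> ^^ l) a \<otimes> (\<sigma> ^^ k) b) (k + l)"
  proof (intro Union_frac_const a b)
    fix a' b' k' l' assume *: "a' \<in> carrier L" "b' \<in> carrier L"
      "(\<sigma> ^^ k') a = (\<sigma> ^^ k) a'" "(\<sigma> ^^ l') b = (\<sigma> ^^ l) b'"
    have "(\<sigma> ^^ (k + l)) ((\<sigma> ^^ l') a') = (\<sigma> ^^ (l + l')) ((\<sigma> ^^ k) a')"
      by (simp only: pow_pow ac_simps)
    also have "\<dots> = (\<sigma> ^^ (k' + l')) ((\<sigma> ^^ l) a)"
      unfolding *(3)[symmetric] by (simp only: pow_pow ac_simps)
    finally have 1: "(\<sigma> ^^ (k + l)) ((\<sigma> ^^ l') a') = (\<sigma> ^^ (k' + l')) ((\<sigma> ^^ l) a)" .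
    have "(\<sigma> ^^ (k + l)) ((\<sigma> ^^ k') b') = (\<sigma> ^^ (k + k')) ((\<sigma> ^^ l) b')"
      by (simp only: pow_pow ac_simps)
    also have "\<dots> = (\<sigma> ^^ (k' + l')) ((\<sigma> ^^ k) b)"
      unfolding *(4)[symmetric] by (simp only: pow_pow ac_simps)
    finally have 2: "(\<sigma> ^^ (k + l)) ((\<sigma> ^^ k') b') = (\<sigma> ^^ (k' + l')) ((\<sigma> ^^ k) b)" .
    show "frac L \<sigma> ((\<sigma> ^^ l') a' \<otimes> (\<sigma> ^^ k') b') (k' + l') = frac L \<sigma> ((\<sigma> ^^ l) a \<otimes> (\<sigma> ^^ k) b) (k + l)"
      using a b * by (simp add: frac_eq_iff pow_mult 1 2)
  qed
  finally show ?thesis .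
qed

lemma frac_eqI:
  assumes "a \<in> carrier L" "b \<in> carrier L" "(\<sigma> ^^ l) a = (\<sigma> ^^ k) b"
  shows "frac L \<sigma> a k = frac L \<sigma> b l"
  using frac_eq_iff assms by blast

lemma frac_raise: "a \<in> carrier L \<Longrightarrow> frac L \<sigma> ((\<sigma> ^^ m) a) (m + k) = frac L \<sigma> a k"
  by (rule frac_eqI) (simp_all only: pow_closed pow_pow ac_simps)

lemma mult_loc_same:
  assumes "a \<in> carrier L" "b \<in> carrier L"
  shows "frac L \<sigma> a k \<otimes>\<^bsub>loc\<^esub> frac L \<sigma> b k = frac L \<sigma> (a \<otimes> b) k"
  using assms frac_raise[of "a \<otimes> b" k k] by (simp add: mult_loc pow_mult)

lemma loc_common_denominator:
  assumes "x \<in> carrier loc" "y \<in> carrier loc"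
  obtains a b k where "a \<in> carrier L" "b \<in> carrier L" "x = frac L \<sigma> a k" "y = frac L \<sigma> b k"
proof -
  obtain a k b l where *: "a \<in> carrier L" "b \<in> carrier L" "x = frac L \<sigma> a k" "y = frac L \<sigma> b l"
    using assms unfolding carrier_loc by blast
  show ?thesis
  proof (rule that)
    show "x = frac L \<sigma> ((\<sigma> ^^ l) a) (k + l)"
      using frac_raise[of a l k] * by (simp add: add.commute)
    show "y = frac L \<sigma> ((\<sigma> ^^ k) b) (k + l)"
      using frac_raise[of b k l] * by simp
  qed (use * in simp_all)
qed

lemma one_loc': "\<one>\<^bsub>loc\<^esub> = frac L \<sigma> \<one> k"
  unfolding one_loc by (rule frac_eqI) (simp_all add: pow_one)

lemma comm_group_loc: "comm_group loc"
proof (rule comm_groupI)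
  fix x y assume xy: "x \<in> carrier loc" "y \<in> carrier loc"
  then obtain a b k where ab: "a \<in> carrier L" "b \<in> carrier L" "x = frac L \<sigma> a k" "y = frac L \<sigma> b k"
    by (rule loc_common_denominator)
  then show "x \<otimes>\<^bsub>loc\<^esub> y \<in> carrier loc" by (simp add: mult_loc_same)
  show "x \<otimes>\<^bsub>loc\<^esub> y = y \<otimes>\<^bsub>loc\<^esub> x" by (simp add: ab mult_loc_same m_comm)
next
  fix x y z assume "x \<in> carrier loc" "y \<in> carrier loc" "z \<in> carrier loc"
  then obtain a b c k l m where *: "a \<in> carrier L" "b \<in> carrier L" "c \<in> carrier L"
    "x = frac L \<sigma> a k" "y = frac L \<sigma> b l" "z = frac L \<sigma> c m"
    unfolding carrier_loc by blast
  have "x = frac L \<sigma> ((\<sigma> ^^ (l + m)) a) (l + m + k)" "y = frac L \<sigma> ((\<sigma> ^^ (k + m)) b) (l + m + k)"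
    "z = frac L \<sigma> ((\<sigma> ^^ (k + l)) c) (l + m + k)"
    using frac_raise[of a "l + m" k] frac_raise[of b "k + m" l] frac_raise[of c "k + l" m] *
    by (simp_all add: ac_simps)
  then show "x \<otimes>\<^bsub>loc\<^esub> y \<otimes>\<^bsub>loc\<^esub> z = x \<otimes>\<^bsub>loc\<^esub> (y \<otimes>\<^bsub>loc\<^esub> z)"
    using * by (simp add: mult_loc_same m_assoc)
next
  show "\<one>\<^bsub>loc\<^esub> \<in> carrier loc" by (simp add: one_loc)
next
  fix x assume "x \<in> carrier loc"
  then obtain a k where a: "a \<in> carrier L" "x = frac L \<sigma> a k" unfolding carrier_loc by blast
  then show "\<one>\<^bsub>loc\<^esub> \<otimes>\<^bsub>loc\<^esub> x = x" by (simp add: one_loc'[of k] mult_loc_same)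
  have "frac L \<sigma> (inv a) k \<otimes>\<^bsub>loc\<^esub> x = \<one>\<^bsub>loc\<^esub>"
    using a by (simp add: one_loc'[of k] mult_loc_same)
  then show "\<exists>y\<in>carrier loc. y \<otimes>\<^bsub>loc\<^esub> x = \<one>\<^bsub>loc\<^esub>" using a by (intro bexI) auto
qed

lemma loc_inv_frac:
  assumes "a \<in> carrier L"
  shows "loc_inv L \<sigma> (frac L \<sigma> a k) = frac L \<sigma> a (Suc k)"
  unfolding loc_inv_def
proof (rule Union_frac_const[OF assms])
  fix b l assume "b \<in> carrier L" "(\<sigma> ^^ l) a = (\<sigma> ^^ k) b"
  then show "frac L \<sigma> b (Suc l) = frac L \<sigma> a (Suc k)"
    using assms by (intro frac_eqI) simp_all
qed

lemma loc_inv_pow_frac: "a \<in> carrier L \<Longrightarrow> (loc_inv L \<sigma> ^^ j) (frac L \<sigma> a k) = frac L \<sigma> a (j + k)"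
  by (induction j) (simp_all add: loc_inv_frac)

lemma lattice_subgroup: "subgroup ((\<lambda>a. frac L \<sigma> a 0) ` carrier L) loc"
proof -
  interpret l: comm_group loc by (rule comm_group_loc)
  show ?thesis
  proof (rule l.subgroupI)
    fix x assume "x \<in> (\<lambda>a. frac L \<sigma> a 0) ` carrier L"
    then obtain a where a: "a \<in> carrier L" "x = frac L \<sigma> a 0" by blast
    have "frac L \<sigma> (inv a) 0 \<otimes>\<^bsub>loc\<^esub> x = \<one>\<^bsub>loc\<^esub>"
      using a by (simp add: one_loc mult_loc_same)
    then have "inv\<^bsub>loc\<^esub> x = frac L \<sigma> (inv a) 0"
      using a by (intro l.inv_equality) auto
    then show "inv\<^bsub>loc\<^esub> x \<in> (\<lambda>a. frac L \<sigma> a 0) ` carrier L" using a by auto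
  qed (auto simp: mult_loc_same)
qed

text \<open>The numerator of \<open>\<Sum>\<^sub>j\<^sub>\<le>\<^sub>N \<sigma>\<^sup>-\<^sup>j (c j)\<close> over the denominator \<open>\<sigma>\<^sup>N\<close>.\<close>

fun numer :: "(nat \<Rightarrow> 'a) \<Rightarrow> nat \<Rightarrow> 'a" where
  "numer c 0 = c 0"
| "numer c (Suc N) = \<sigma> (numer c N) \<otimes> c (Suc N)"

lemma sigma_closed [simp]: "a \<in> carrier L \<Longrightarrow> \<sigma> a \<in> carrier L"
  using pow_closed[of a 1] by simp

lemma numer_closed [simp]: "(\<And>j. c j \<in> carrier L) \<Longrightarrow> numer c N \<in> carrier L"
  by (induction N) simp_all

lemma finprod_frac:
  assumes c: "\<And>j. c j \<in> carrier L"
  shows "finprod loc (\<lambda>j. frac L \<sigma> (c j) j) {..N} = frac L \<sigma> (numer c N) N"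
proof -
  interpret l: comm_group loc by (rule comm_group_loc)
  show ?thesis
  proof (induction N)
    case 0
    then show ?case using l.finprod_0[of "\<lambda>j. frac L \<sigma> (c j) j"] c by simp
  next
    case (Suc N)
    have "finprod loc (\<lambda>j. frac L \<sigma> (c j) j) {..Suc N} = frac L \<sigma> (c (Suc N)) (Suc N) \<otimes>\<^bsub>loc\<^esub> frac L \<sigma> (numer c N) N"
      using c Suc by (subst l.finprod_Suc) auto
    also have "frac L \<sigma> (numer c N) N = frac L \<sigma> (\<sigma> (numer c N)) (Suc N)"
      using frac_raise[of "numer c N" 1 N] c by simp
    finally show ?case using c by (simp add: mult_loc_same m_comm)
  qed
qed

lemma numer_mult:
  assumes "\<And>j. c j \<in> carrier L" "\<And>j. d j \<in> carrier L"
  shows "numer (\<lambda>j. c j \<otimes> d j) N = numer c N \<otimes> numer d N"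
proof (induction N)
  case (Suc N)
  have "\<sigma> (numer c N \<otimes> numer d N) = \<sigma> (numer c N) \<otimes> \<sigma> (numer d N)"
    using pow_mult[of "numer c N" "numer d N" 1] assms by simp
  then show ?case using assms Suc by (simp add: m_ac)
qed simp

lemma numer_frac_extend:
  assumes c: "\<And>j. c j \<in> carrier L" and z: "\<And>j. j > N \<Longrightarrow> c j = \<one>" and "N \<le> M"
  shows "frac L \<sigma> (numer c M) M = frac L \<sigma> (numer c N) N"
  using \<open>N \<le> M\<close>
proof (induction M rule: dec_induct)
  case (step M)
  then show ?case using frac_raise[of "numer c M" 1 M] c z by simp
qed simp

end

section \<open>The local Brieskorn lattice\<close>

lemma loc_brieskorn_rel_iff:
  "\<omega> \<in> loc_brieskorn_rel f x \<longleftrightarrow> \<omega> \<in> an_forms x CARD('n) \<and>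
     (\<exists>\<eta>\<in>an_forms x (CARD('n) - 2). germ_eq x \<omega> (df_wedge f (ext_d \<eta>)))"
  for \<omega> :: "'n::{finite,linorder} form"
  by (simp add: loc_brieskorn_rel_def)

lemma loc_brieskorn_quotient:
  fixes x :: "'n::{finite,linorder} cspace"
  shows "additive_quotient (an_forms x CARD('n)) (loc_brieskorn_rel f x)"
proof
  fix a b :: "'n form" assume "a \<in> loc_brieskorn_rel f x" "b \<in> loc_brieskorn_rel f x"
  then obtain \<eta> \<theta> where ab: "a \<in> an_forms x CARD('n)" "b \<in> an_forms x CARD('n)"
    "\<eta> \<in> an_forms x (CARD('n) - 2)" "\<theta> \<in> an_forms x (CARD('n) - 2)"
    "germ_eq x a (df_wedge f (ext_d \<eta>))" "germ_eq x b (df_wedge f (ext_d \<theta>))"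
    unfolding loc_brieskorn_rel_iff by blast
  have "germ_eq x (a - b) (df_wedge f (ext_d \<eta> - ext_d \<theta>))"
    using germ_eq_diff[OF ab(5,6)] by (simp add: df_wedge_diff)
  also have "germ_eq x (df_wedge f (ext_d \<eta> - ext_d \<theta>)) (df_wedge f (ext_d (\<eta> - \<theta>)))"
    by (intro germ_eq_df_wedge germ_eq_sym[OF ext_d_diff_near[OF ab(3,4)]])
  finally show "a - b \<in> loc_brieskorn_rel f x"
    unfolding loc_brieskorn_rel_iff using an_forms_diff ab by blast
next
  show "0 \<in> loc_brieskorn_rel f x"
    unfolding loc_brieskorn_rel_iff using an_forms_0 by (intro conjI bexI[of _ 0]) auto
qed (auto simp: an_forms_0 an_forms_diff loc_brieskorn_rel_def)

lemma top_form_closed: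
  fixes x :: "'n::{finite,linorder} cspace"
  assumes "\<omega> \<in> an_forms x CARD('n)"
  shows "ext_d \<omega> = 0"
proof
  fix I :: "'n set"
  have "card I \<le> CARD('n)" by (rule card_mono) auto
  then show "ext_d \<omega> I = 0 I" using an_forms_zero[OF ext_d_an_forms[OF assms], of I] by (simp add: zero_fun_def)
qed

locale isolated_germ =
  fixes f :: "'n::{finite,linorder} cspace \<Rightarrow> complex" and x :: "'n cspace"
  assumes dim: "CARD('n) \<ge> 2" and f: "f \<in> polyfun" and fin: "finite (Sing f)"
begin

abbreviation "B \<equiv> loc_brieskorn f x"
abbreviation "c \<equiv> loc_class f x"

lemma f_hol: "holomorphic_near x f"
  by (rule polyfun_holomorphic_near[OF f])

sublocale q: additive_quotient "an_forms x CARD('n)" "loc_brieskorn_rel f x"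
  by (rule loc_brieskorn_quotient)

lemma B_def: "B = q.Q" and c_def: "c \<omega> = q.cls \<omega>"
  by (simp_all add: loc_brieskorn_def loc_class_def)

lemma n_Suc: "CARD('n) = Suc (CARD('n) - 1)" "CARD('n) - 1 = Suc (CARD('n) - 2)"
  using dim by auto

lemma d_form: "\<eta> \<in> an_forms x (CARD('n) - 1) \<Longrightarrow> ext_d \<eta> \<in> an_forms x CARD('n)"
  and df_form: "\<eta> \<in> an_forms x (CARD('n) - 1) \<Longrightarrow> df_wedge f \<eta> \<in> an_forms x CARD('n)"
  using ext_d_an_forms[of \<eta> x "CARD('n) - 1"] df_wedge_an_forms[of \<eta> x "CARD('n) - 1", OF _ f_hol] n_Suc by auto

lemma c_germ_eq:
  assumes "a \<in> an_forms x CARD('n)" "b \<in> an_forms x CARD('n)" "germ_eq x a b"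
  shows "c a = c b"
proof -
  have "germ_eq x (a - b) (df_wedge f (ext_d 0))"
    using germ_eq_diff[OF assms(3) germ_eq_refl[of x b]] by simp
  then have "a - b \<in> loc_brieskorn_rel f x"
    unfolding loc_brieskorn_rel_iff using an_forms_diff[OF assms(1,2)] an_forms_0 by blast
  then show ?thesis by (simp add: c_def q.cls_eq_iff)
qed

lemma c_eqE:
  assumes "c a = c b"
  obtains \<xi> where "\<xi> \<in> an_forms x (CARD('n) - 2)" "germ_eq x (a - b) (df_wedge f (ext_d \<xi>))"
  using assms unfolding c_def q.cls_eq_iff loc_brieskorn_rel_iff by blast

lemma d_surj:
  assumes "u \<in> carrier B"
  obtains \<eta> where "\<eta> \<in> an_forms x (CARD('n) - 1)" "u = c (ext_d \<eta>)"
proof -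
  obtain \<omega> where \<omega>: "\<omega> \<in> an_forms x CARD('n)" "u = c \<omega>"
    using assms unfolding B_def q.carrier_Q c_def by blast
  have "\<omega> \<in> an_forms x (Suc (CARD('n) - 1))" using \<omega>(1) n_Suc(1) by simp
  moreover have "germ_eq x (ext_d \<omega>) 0" by (simp add: top_form_closed[OF \<omega>(1)])
  ultimately obtain \<eta> where \<eta>: "\<eta> \<in> an_forms x (CARD('n) - 1)" "germ_eq x \<omega> (ext_d \<eta>)"
    using poincare_lemma by blast
  then have "u = c (ext_d \<eta>)" using \<omega> c_germ_eq[OF \<omega>(1) d_form[OF \<eta>(1)]] by simp
  with \<eta>(1) show ?thesis by (rule that)
qed

text \<open>
  If \<open>d\<eta> - d\<theta> = df \<and> d\<xi>\<close>, then \<open>\<eta> - \<theta> + df \<and> \<xi>\<close> is closed, hence equal to some \<open>d\<zeta>\<close>, and wedging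
  with \<open>df\<close> gives \<open>df \<and> \<eta> - df \<and> \<theta> = df \<and> d\<zeta>\<close>.
\<close>

lemma df_class_unique:
  assumes \<eta>: "\<eta> \<in> an_forms x (CARD('n) - 1)" and \<theta>: "\<theta> \<in> an_forms x (CARD('n) - 1)" and eq: "c (ext_d \<eta>) = c (ext_d \<theta>)"
  shows "c (df_wedge f \<eta>) = c (df_wedge f \<theta>)"
proof -
  obtain \<xi> where \<xi>: "\<xi> \<in> an_forms x (CARD('n) - 2)" "germ_eq x (ext_d \<eta> - ext_d \<theta>) (df_wedge f (ext_d \<xi>))"
    using eq by (rule c_eqE)
  define \<alpha> where "\<alpha> = \<eta> - \<theta> + df_wedge f \<xi>"
  have dfx: "df_wedge f \<xi> \<in> an_forms x (CARD('n) - 1)" "ext_d \<xi> \<in> an_forms x (CARD('n) - 1)"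
    using df_wedge_an_forms[OF \<xi>(1) f_hol] ext_d_an_forms[OF \<xi>(1)] n_Suc(2) by simp_all
  have et: "\<eta> - \<theta> \<in> an_forms x (CARD('n) - 1)" by (rule an_forms_diff[OF \<eta> \<theta>])
  have \<alpha>: "\<alpha> \<in> an_forms x (Suc (CARD('n) - 2))"
    using an_forms_add[OF et dfx(1)] n_Suc(2) by (simp add: \<alpha>_def)
  \<comment> \<open>\<open>d (\<eta> - \<theta> + df \<and> \<xi>) = d\<eta> - d\<theta> - df \<and> d\<xi> = 0\<close>\<close>
  have "germ_eq x (ext_d \<alpha>) (ext_d (\<eta> - \<theta>) + ext_d (df_wedge f \<xi>))"
    unfolding \<alpha>_def by (rule ext_d_add_near[OF et dfx(1)])
  also have "germ_eq x \<dots> (df_wedge f (ext_d \<xi>) + - df_wedge f (ext_d \<xi>))"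
    by (intro germ_eq_add ext_d_df_wedge_near[OF \<xi>(1) f_hol] germ_eq_trans[OF ext_d_diff_near[OF \<eta> \<theta>] \<xi>(2)])
  finally have "germ_eq x (ext_d \<alpha>) 0" by simp
  then obtain \<zeta> where \<zeta>: "\<zeta> \<in> an_forms x (CARD('n) - 2)" "germ_eq x \<alpha> (ext_d \<zeta>)"
    using poincare_lemma[OF \<alpha>] by blast
  have "germ_eq x (df_wedge f \<alpha>) (df_wedge f (ext_d \<zeta>))" by (rule germ_eq_df_wedge[OF \<zeta>(2)])
  then have "germ_eq x (df_wedge f \<eta> - df_wedge f \<theta>) (df_wedge f (ext_d \<zeta>))"
    by (simp add: \<alpha>_def df_wedge_add df_wedge_diff)
  then have "df_wedge f \<eta> - df_wedge f \<theta> \<in> loc_brieskorn_rel f x"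
    unfolding loc_brieskorn_rel_iff using \<zeta>(1) an_forms_diff[OF df_form[OF \<eta>] df_form[OF \<theta>]] by blast
  then show ?thesis by (simp add: c_def q.cls_eq_iff)
qed

lemma dt_inv_class:
  assumes "\<eta> \<in> an_forms x (CARD('n) - 1)"
  shows "dt_inv f x (c (ext_d \<eta>)) = c (df_wedge f \<eta>)"
  unfolding dt_inv_def
proof (rule the_equality)
  show "\<exists>\<theta>\<in>an_forms x (CARD('n) - 1). c (ext_d \<eta>) = c (ext_d \<theta>) \<and> c (df_wedge f \<eta>) = c (df_wedge f \<theta>)"
    using assms by blast
  fix c' assume "\<exists>\<theta>\<in>an_forms x (CARD('n) - 1). c (ext_d \<eta>) = c (ext_d \<theta>) \<and> c' = c (df_wedge f \<theta>)"
  then show "c' = c (df_wedge f \<eta>)" using df_class_unique assms by metis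
qed

lemma c_closed [simp]: "\<omega> \<in> an_forms x CARD('n) \<Longrightarrow> c \<omega> \<in> carrier B"
  unfolding B_def q.carrier_Q c_def by blast

lemma c_add: "c a \<otimes>\<^bsub>B\<^esub> c b = c (a + b)"
  unfolding B_def c_def by (rule q.mult_Q)

lemma one_B: "\<one>\<^bsub>B\<^esub> = c 0"
  unfolding B_def c_def by (rule q.one_Q)

lemma dt_inv_hom: "dt_inv f x \<in> hom B B"
proof (rule homI)
  fix u assume "u \<in> carrier B"
  then obtain \<eta> where \<eta>: "\<eta> \<in> an_forms x (CARD('n) - 1)" "u = c (ext_d \<eta>)" by (rule d_surj)
  then show "dt_inv f x u \<in> carrier B" using dt_inv_class[OF \<eta>(1)] df_form[OF \<eta>(1)] by simp
  fix w assume "w \<in> carrier B"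
  then obtain \<theta> where \<theta>: "\<theta> \<in> an_forms x (CARD('n) - 1)" "w = c (ext_d \<theta>)" by (rule d_surj)
  have et: "\<eta> + \<theta> \<in> an_forms x (CARD('n) - 1)" by (rule an_forms_add[OF \<eta>(1) \<theta>(1)])
  have "u \<otimes>\<^bsub>B\<^esub> w = c (ext_d (\<eta> + \<theta>))"
    unfolding \<eta>(2) \<theta>(2) c_add
    by (intro c_germ_eq an_forms_add d_form \<eta> \<theta> et germ_eq_sym[OF ext_d_add_near[OF \<eta>(1) \<theta>(1)]])
  then have "dt_inv f x (u \<otimes>\<^bsub>B\<^esub> w) = c (df_wedge f (\<eta> + \<theta>))" by (simp add: dt_inv_class[OF et])
  then show "dt_inv f x (u \<otimes>\<^bsub>B\<^esub> w) = dt_inv f x u \<otimes>\<^bsub>B\<^esub> dt_inv f x w"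
    by (simp only: \<eta>(2) \<theta>(2) dt_inv_class[OF \<eta>(1)] dt_inv_class[OF \<theta>(1)] c_add df_wedge_add)
qed

text \<open>
  If \<open>df \<and> (\<eta> - \<theta> - d\<xi>) = 0\<close>, exactness of the Koszul complex gives \<open>\<eta> - \<theta> - d\<xi> = df \<and> \<zeta>\<close>, and
  taking \<open>d\<close> gives \<open>d\<eta> - d\<theta> = - df \<and> d\<zeta>\<close>.
\<close>

lemma dt_inv_inj: "inj_on (dt_inv f x) (carrier B)"
proof (rule inj_onI)
  fix u w assume u: "u \<in> carrier B" and w: "w \<in> carrier B" and eq: "dt_inv f x u = dt_inv f x w"
  obtain \<eta> where \<eta>: "\<eta> \<in> an_forms x (CARD('n) - 1)" "u = c (ext_d \<eta>)" using u by (rule d_surj)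
  obtain \<theta> where \<theta>: "\<theta> \<in> an_forms x (CARD('n) - 1)" "w = c (ext_d \<theta>)" using w by (rule d_surj)
  have "c (df_wedge f \<eta>) = c (df_wedge f \<theta>)"
    using eq by (simp only: \<eta>(2) \<theta>(2) dt_inv_class[OF \<eta>(1)] dt_inv_class[OF \<theta>(1)])
  then obtain \<xi> where \<xi>: "\<xi> \<in> an_forms x (CARD('n) - 2)"
    "germ_eq x (df_wedge f \<eta> - df_wedge f \<theta>) (df_wedge f (ext_d \<xi>))" by (rule c_eqE)
  have dx: "ext_d \<xi> \<in> an_forms x (CARD('n) - 1)" using ext_d_an_forms[OF \<xi>(1)] n_Suc(2) by simp
  have et: "\<eta> - \<theta> \<in> an_forms x (CARD('n) - 1)" by (rule an_forms_diff[OF \<eta>(1) \<theta>(1)])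
  define \<alpha> where "\<alpha> = \<eta> - \<theta> - ext_d \<xi>"
  have \<alpha>: "\<alpha> \<in> an_forms x (Suc (CARD('n) - 2))"
    using an_forms_diff[OF et dx] n_Suc(2) by (simp add: \<alpha>_def)
  have \<alpha>0: "germ_eq x (df_wedge f \<alpha>) 0"
    using germ_eq_diff[OF \<xi>(2) germ_eq_refl[of x "df_wedge f (ext_d \<xi>)"]]
    by (simp add: \<alpha>_def df_wedge_diff)
  obtain v cc where cc: "\<forall>j i. holomorphic_near x (cc j i)"
    "\<forall>j. \<forall>\<^sub>F z in nhds x. (z $ j - x $ j) ^ v j = (\<Sum>i\<in>UNIV. pd i f z * cc j i z)"
    using coord_power_near[OF f fin, of x] by blast
  have lt: "Suc (CARD('n) - 2) < CARD('n)" using dim by linarith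
  have "\<exists>\<beta>\<in>an_forms x (CARD('n) - 2). germ_eq x \<alpha> (df_wedge f \<beta>)"
    by (rule koszul_exact[where c = cc and v = v, OF f_hol cc(1)[rule_format] cc(2)[rule_format] \<alpha> lt \<alpha>0])
  then obtain \<zeta> where \<zeta>: "\<zeta> \<in> an_forms x (CARD('n) - 2)" "germ_eq x \<alpha> (df_wedge f \<zeta>)"
    by blast
  have "germ_eq x (ext_d \<eta> - ext_d \<theta>) (ext_d (\<eta> - \<theta>) - 0)"
    using germ_eq_sym[OF ext_d_diff_near[OF \<eta>(1) \<theta>(1)]] by simp
  also have "germ_eq x \<dots> (ext_d (\<eta> - \<theta>) - ext_d (ext_d \<xi>))"
    by (intro germ_eq_diff germ_eq_refl germ_eq_sym[OF ext_d_ext_d_near[OF \<xi>(1)]])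
  also have "germ_eq x \<dots> (ext_d \<alpha>)"
    unfolding \<alpha>_def by (rule germ_eq_sym[OF ext_d_diff_near[OF et dx]])
  also have "germ_eq x (ext_d \<alpha>) (ext_d (df_wedge f \<zeta>))" by (rule germ_eq_ext_d[OF \<zeta>(2)])
  also have "germ_eq x \<dots> (- df_wedge f (ext_d \<zeta>))" by (rule ext_d_df_wedge_near[OF \<zeta>(1) f_hol])
  also have "germ_eq x \<dots> (df_wedge f (ext_d (0 - \<zeta>)))"
  proof -
    have "germ_eq x (df_wedge f (ext_d (0 - \<zeta>))) (df_wedge f (ext_d 0 - ext_d \<zeta>))"
      by (rule germ_eq_df_wedge[OF ext_d_diff_near[OF an_forms_0 \<zeta>(1)]])
    also have "df_wedge f (ext_d 0 - ext_d \<zeta>) = - df_wedge f (ext_d \<zeta>)" by (simp add: df_wedge_diff del: diff_0)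
    finally show ?thesis by (rule germ_eq_sym)
  qed
  finally have "ext_d \<eta> - ext_d \<theta> \<in> loc_brieskorn_rel f x"
    unfolding loc_brieskorn_rel_iff
    using an_forms_diff[OF an_forms_0 \<zeta>(1)] an_forms_diff[OF d_form[OF \<eta>(1)] d_form[OF \<theta>(1)]] by blast
  then show "u = w" by (simp add: \<eta> \<theta> c_def q.cls_eq_iff)
qed

sublocale loc: injective_endomorphism B "dt_inv f x"
proof -
  interpret comm_group B unfolding B_def by (rule q.comm_group_Q)
  show "injective_endomorphism B (dt_inv f x)"
    by unfold_locales (rule dt_inv_hom, rule dt_inv_inj)
qed

end

section \<open>Algebraic forms\<close>

lemma alg_formsD: "\<omega> \<in> alg_forms p \<Longrightarrow> \<omega> I \<in> polyfun"
  unfolding alg_forms_def by (cases "card I = p") (auto dest: spec[of _ I])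

lemma alg_formsI:
  "(\<And>I. card I = p \<Longrightarrow> \<omega> I \<in> polyfun) \<Longrightarrow> (\<And>I. card I \<noteq> p \<Longrightarrow> \<omega> I = 0) \<Longrightarrow> \<omega> \<in> alg_forms p"
  by (simp add: alg_forms_def)

lemma alg_forms_an_forms: "\<omega> \<in> alg_forms p \<Longrightarrow> \<omega> \<in> an_forms x p"
  unfolding alg_forms_def an_forms_def by (auto intro: polyfun_holomorphic_near)

lemma alg_formsI_an:
  assumes "\<And>I. \<omega> I \<in> polyfun" "\<omega> \<in> an_forms x p"
  shows "\<omega> \<in> alg_forms p"
  using assms by (intro alg_formsI) (auto intro: an_forms_zero)

lemma alg_forms_0: "0 \<in> alg_forms p"
  by (rule alg_formsI) (simp_all add: zero_fun_def)

lemma alg_forms_diff: "\<omega> \<in> alg_forms p \<Longrightarrow> \<theta> \<in> alg_forms p \<Longrightarrow> \<omega> - \<theta> \<in> alg_forms p"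
  by (rule alg_formsI_an[OF _ an_forms_diff[OF alg_forms_an_forms alg_forms_an_forms]])
    (simp_all add: fun_diff_def polyfun_diff alg_formsD)

lemma alg_forms_ext_d:
  assumes "\<omega> \<in> alg_forms p"
  shows "ext_d \<omega> \<in> alg_forms (Suc p)"
proof (rule alg_formsI_an[OF _ ext_d_an_forms[OF alg_forms_an_forms[OF assms]]])
  fix I
  show "ext_d \<omega> I \<in> polyfun"
    unfolding ext_d_def by (intro polyfun_sum polyfun_mult polyfun_const polyfun_pd alg_formsD[OF assms])
qed

lemma alg_forms_df_wedge:
  assumes "\<omega> \<in> alg_forms p" "f \<in> polyfun"
  shows "df_wedge f \<omega> \<in> alg_forms (Suc p)"
proof (rule alg_formsI_an[OF _ df_wedge_an_forms[OF alg_forms_an_forms[OF assms(1)] polyfun_holomorphic_near[OF assms(2)]]])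
  fix I
  show "df_wedge f \<omega> I \<in> polyfun"
    unfolding df_wedge_def by (intro polyfun_sum polyfun_mult polyfun_const polyfun_pd assms(2) alg_formsD[OF assms(1)])
qed

lemma germ_eq_everywhere:
  assumes "\<And>z. germ_eq z \<alpha> \<beta>"
  shows "\<alpha> = \<beta>"
proof (intro ext)
  fix I z
  have "\<forall>I. \<alpha> I z = \<beta> I z"
    using assms[of z] unfolding germ_eq_def by (rule eventually_nhds_x_imp_x)
  then show "\<alpha> I z = \<beta> I z" by simp
qed

lemma ext_d_diff_alg: "\<omega> \<in> alg_forms p \<Longrightarrow> \<theta> \<in> alg_forms q \<Longrightarrow> ext_d (\<omega> - \<theta>) = ext_d \<omega> - ext_d \<theta>"
  by (rule germ_eq_everywhere) (rule ext_d_diff_near[OF alg_forms_an_forms alg_forms_an_forms])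

lemma ext_d_df_wedge_alg: "\<omega> \<in> alg_forms p \<Longrightarrow> f \<in> polyfun \<Longrightarrow> ext_d (df_wedge f \<omega>) = - df_wedge f (ext_d \<omega>)"
  by (rule germ_eq_everywhere) (rule ext_d_df_wedge_near[OF alg_forms_an_forms polyfun_holomorphic_near])

text \<open>The twisted de Rham differential \<open>d - \<partial>\<^sub>t df \<and>\<close>, whose image in top degree is \<open>gm_rel f\<close>.\<close>

definition twisted_d :: "('n cspace \<Rightarrow> complex) \<Rightarrow> 'n::{finite,linorder} form poly \<Rightarrow> 'n form poly" where
  "twisted_d f \<eta> = map_poly ext_d \<eta> - pCons 0 (map_poly (df_wedge f) \<eta>)"

lemma coeff_twisted_d:
  "coeff (twisted_d f \<eta>) j = ext_d (coeff \<eta> j) - (case j of 0 \<Rightarrow> 0 | Suc i \<Rightarrow> df_wedge f (coeff \<eta> i))"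
  by (cases j) (simp_all add: twisted_d_def coeff_map_poly)

lemma gm_rel_twisted_d: "gm_rel f = twisted_d f ` alg_forms_dt (CARD('n) - 1)"
  for f :: "'n::{finite,linorder} cspace \<Rightarrow> complex"
  by (auto simp: gm_rel_def twisted_d_def)

lemma alg_forms_dtD: "P \<in> alg_forms_dt p \<Longrightarrow> coeff P j \<in> alg_forms p"
  by (simp add: alg_forms_dt_def)

lemma alg_forms_dt_diff: "P \<in> alg_forms_dt p \<Longrightarrow> Q \<in> alg_forms_dt p \<Longrightarrow> P - Q \<in> alg_forms_dt p"
  by (simp add: alg_forms_dt_def alg_forms_diff)

lemma alg_forms_dt_0: "0 \<in> alg_forms_dt p"
  by (simp add: alg_forms_dt_def alg_forms_0)

lemma alg_forms_dt_monom: "\<omega> \<in> alg_forms p \<Longrightarrow> monom \<omega> k \<in> alg_forms_dt p"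
  by (simp add: alg_forms_dt_def alg_forms_0)

lemma twisted_d_diff:
  assumes "\<eta> \<in> alg_forms_dt p" "\<theta> \<in> alg_forms_dt p"
  shows "twisted_d f (\<eta> - \<theta>) = twisted_d f \<eta> - twisted_d f \<theta>"
proof (rule poly_eqI)
  fix j
  have "ext_d (coeff \<eta> j - coeff \<theta> j) = ext_d (coeff \<eta> j) - ext_d (coeff \<theta> j)"
    by (rule ext_d_diff_alg[OF alg_forms_dtD[OF assms(1)] alg_forms_dtD[OF assms(2)]])
  then show "coeff (twisted_d f (\<eta> - \<theta>)) j = coeff (twisted_d f \<eta> - twisted_d f \<theta>) j"
    by (cases j) (simp_all add: coeff_twisted_d df_wedge_diff)
qed

lemma twisted_d_alg_forms:
  assumes "\<eta> \<in> alg_forms_dt p" "f \<in> polyfun"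
  shows "twisted_d f \<eta> \<in> alg_forms_dt (Suc p)"
  unfolding alg_forms_dt_def
proof (intro CollectI allI)
  fix j
  have "(case j of 0 \<Rightarrow> 0 | Suc i \<Rightarrow> df_wedge f (coeff \<eta> i)) \<in> alg_forms (Suc p)"
    using alg_forms_df_wedge[OF alg_forms_dtD[OF assms(1)] assms(2)] by (cases j) (simp_all add: alg_forms_0)
  then show "coeff (twisted_d f \<eta>) j \<in> alg_forms (Suc p)"
    unfolding coeff_twisted_d by (intro alg_forms_diff alg_forms_ext_d alg_forms_dtD[OF assms(1)])
qed

lemma gauss_manin_quotient:
  fixes f :: "'n::{finite,linorder} cspace \<Rightarrow> complex"
  assumes "f \<in> polyfun"
  shows "additive_quotient (alg_forms_dt CARD('n)) (gm_rel f)"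
proof
  have "CARD('n) = Suc (CARD('n) - 1)" by simp
  then show "gm_rel f \<subseteq> alg_forms_dt CARD('n)"
    unfolding gm_rel_twisted_d using twisted_d_alg_forms[OF _ assms, of _ "CARD('n) - 1"] by auto
  have "twisted_d f 0 = 0" by (simp add: twisted_d_def)
  then show "0 \<in> gm_rel f"
    unfolding gm_rel_twisted_d using alg_forms_dt_0 by (metis imageI)
  fix a b assume "a \<in> gm_rel f" "b \<in> gm_rel f"
  then obtain \<eta> \<theta> where "\<eta> \<in> alg_forms_dt (CARD('n) - 1)" "\<theta> \<in> alg_forms_dt (CARD('n) - 1)"
    "a = twisted_d f \<eta>" "b = twisted_d f \<theta>" unfolding gm_rel_twisted_d by blast
  then show "a - b \<in> gm_rel f"
    unfolding gm_rel_twisted_d using twisted_d_diff alg_forms_dt_diff by (metis imageI)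
qed (simp_all add: alg_forms_dt_0 alg_forms_dt_diff)

text \<open>
  The relation attached to \<open>- df \<and> \<xi>\<close> is \<open>df \<and> d\<xi>\<close>, in degree zero with respect to \<open>\<partial>\<^sub>t\<close>.
\<close>

lemma brieskorn_rel_gm_rel:
  fixes f :: "'n::{finite,linorder} cspace \<Rightarrow> complex"
  assumes dim: "CARD('n) \<ge> 2" and f: "f \<in> polyfun" and "\<omega> \<in> brieskorn_rel f"
  shows "[:\<omega>:] \<in> gm_rel f"
proof -
  obtain \<xi> where \<xi>: "\<xi> \<in> alg_forms (CARD('n) - 2)" "\<omega> = df_wedge f (ext_d \<xi>)"
    using assms(3) by (auto simp: brieskorn_rel_def)
  define \<eta> where "\<eta> = 0 - df_wedge f \<xi>"
  have n: "Suc (CARD('n) - 2) = CARD('n) - 1" using dim by linarith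
  have dfx: "df_wedge f \<xi> \<in> alg_forms (CARD('n) - 1)"
    using alg_forms_df_wedge[OF \<xi>(1) f] n by simp
  have "\<eta> \<in> alg_forms (CARD('n) - 1)" unfolding \<eta>_def by (rule alg_forms_diff[OF alg_forms_0 dfx])
  then have "monom \<eta> 0 \<in> alg_forms_dt (CARD('n) - 1)" by (rule alg_forms_dt_monom)
  moreover have "twisted_d f (monom \<eta> 0) = [:\<omega>:]"
  proof (rule poly_eqI)
    fix j
    have "ext_d \<eta> = \<omega>"
      using ext_d_diff_alg[OF alg_forms_0 dfx] ext_d_df_wedge_alg[OF \<xi>(1) f] by (simp add: \<eta>_def \<xi>(2))
    moreover have "df_wedge f \<eta> = 0" by (simp add: \<eta>_def df_wedge_diff del: diff_0)
    ultimately show "coeff (twisted_d f (monom \<eta> 0)) j = coeff [:\<omega>:] j"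
      by (cases j) (auto simp: coeff_twisted_d split: nat.splits)
  qed
  ultimately show ?thesis unfolding gm_rel_twisted_d by (metis imageI)
qed

text \<open>For a top form, membership in \<open>df \<and> \<Omega>\<^sup>n\<^sup>-\<^sup>1\<close> is membership of its coefficient in the Jacobian ideal.\<close>

lemma df_wedge_local_global:
  fixes f :: "'n::{finite,linorder} cspace \<Rightarrow> complex"
  assumes f: "f \<in> polyfun" and fin: "finite (Sing f)" and \<omega>: "\<omega> \<in> alg_forms CARD('n)"
    and loc: "\<And>x. x \<in> Sing f \<Longrightarrow> \<exists>\<eta>\<in>an_forms x (CARD('n) - 1). germ_eq x \<omega> (df_wedge f \<eta>)"
  shows "\<exists>\<eta>\<in>alg_forms (CARD('n) - 1). \<omega> = df_wedge f \<eta>"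
proof -
  have "\<omega> UNIV \<in> jacobian_ideal f"
  proof (rule jacobian_local_global[OF f fin alg_formsD[OF \<omega>]])
    fix p assume "p \<in> Sing f"
    then obtain \<eta> where \<eta>: "\<eta> \<in> an_forms p (CARD('n) - 1)" "germ_eq p \<omega> (df_wedge f \<eta>)"
      using loc by blast
    have "holomorphic_near p (\<lambda>z. ins_sign i UNIV * \<eta> (UNIV - {i}) z)" for i
      by (intro holomorphic_near_mult holomorphic_near_const an_forms_holomorphic[OF \<eta>(1)])
    moreover have "\<forall>\<^sub>F z in nhds p. \<omega> UNIV z = (\<Sum>i\<in>UNIV. pd i f z * (ins_sign i UNIV * \<eta> (UNIV - {i}) z))"
      using \<eta>(2) unfolding germ_eq_def by (rule eventually_mono) (simp add: df_wedge_def mult_ac)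
    ultimately show "\<exists>h. (\<forall>i. holomorphic_near p (h i)) \<and> (\<forall>\<^sub>F z in nhds p. \<omega> UNIV z = (\<Sum>i\<in>UNIV. pd i f z * h i z))"
      by (intro exI[of _ "\<lambda>i z. ins_sign i UNIV * \<eta> (UNIV - {i}) z"] conjI allI)
  qed
  then obtain r where r: "\<And>i. r i \<in> polyfun" "\<And>z. \<omega> UNIV z = (\<Sum>i\<in>UNIV. pd i f z * r i z)"
    by (elim jacobian_idealE) blast
  define \<eta> where "\<eta> J = (if card J = CARD('n) - 1
    then (\<lambda>z. ins_sign (the_elem (- J)) UNIV * r (the_elem (- J)) z) else 0)" for J :: "'n set"
  have \<eta>: "\<eta> \<in> alg_forms (CARD('n) - 1)"
    by (rule alg_formsI) (simp_all add: \<eta>_def polyfun_mult r)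
  have "\<omega> I z = df_wedge f \<eta> I z" for I z
  proof (cases "I = UNIV")
    case True
    have "\<eta> (UNIV - {i}) = (\<lambda>z. ins_sign i UNIV * r i z)" for i
    proof -
      have "- (UNIV - {i}) = {i}" by auto
      then show ?thesis by (simp add: \<eta>_def card_Diff_singleton)
    qed
    then have "df_wedge f \<eta> UNIV z = (\<Sum>i\<in>UNIV. (ins_sign i UNIV * ins_sign i UNIV) * (pd i f z * r i z))"
      unfolding df_wedge_def by (simp only: mult_ac)
    then show ?thesis using True r(2) by simp
  next
    case False
    then have "card I < CARD('n)" by (intro psubset_card_mono) auto
    then have "\<omega> I = 0" "df_wedge f \<eta> I = 0"
      using an_forms_zero[OF alg_forms_an_forms[OF \<omega>, of z], of I]
        an_forms_zero[OF alg_forms_an_forms[OF alg_forms_df_wedge[OF \<eta> f], of z], of I] by auto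
    then show ?thesis by simp
  qed
  then have "\<omega> = df_wedge f \<eta>" by (intro ext)
  with \<eta> show ?thesis by blast
qed

section \<open>The map to the local Gauss-Manin system\<close>

text \<open>
  On representatives, the map \<open>gm_to_loc_gm f x\<close>.
\<close>

definition loc_sum :: "('n cspace \<Rightarrow> complex) \<Rightarrow> 'n cspace \<Rightarrow>
    'n::{finite,linorder} form poly \<Rightarrow> ('n form set \<times> nat) set" where
  "loc_sum f x P = finprod (loc_gauss_manin f x)
      (\<lambda>j. (loc_dt f x ^^ j) (lattice_to_loc_gm f x (loc_class f x (coeff P j)))) {..degree P}"

definition coeff_class :: "('n cspace \<Rightarrow> complex) \<Rightarrow> 'n cspace \<Rightarrow>
    'n::{finite,linorder} form poly \<Rightarrow> nat \<Rightarrow> 'n form set" where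
  "coeff_class f x P j = loc_class f x (coeff P j)"

context isolated_germ
begin

lemma coeff_class_closed [simp]: "P \<in> alg_forms_dt CARD('n) \<Longrightarrow> coeff_class f x P j \<in> carrier B"
  unfolding coeff_class_def by (rule c_closed[OF alg_forms_an_forms[OF alg_forms_dtD]])

text \<open>
  Enlarging \<open>N\<close> beyond the degree is what allows polynomials of different degrees to be compared.
\<close>

lemma loc_sum_eq:
  assumes P: "P \<in> alg_forms_dt CARD('n)" and "degree P \<le> N"
  shows "loc_sum f x P = frac B (dt_inv f x) (loc.numer (coeff_class f x P) N) N"
proof -
  have "(loc_dt f x ^^ j) (lattice_to_loc_gm f x (loc_class f x (coeff P j))) = frac B (dt_inv f x) (coeff_class f x P j) j" for j
    using loc.loc_inv_pow_frac[OF coeff_class_closed[OF P], of j j 0]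
    unfolding loc_dt_def lattice_to_loc_gm_def coeff_class_def by simp
  then have "loc_sum f x P = finprod loc.loc (\<lambda>j. frac B (dt_inv f x) (coeff_class f x P j) j) {..degree P}"
    unfolding loc_sum_def loc_gauss_manin_def by simp
  also have "\<dots> = frac B (dt_inv f x) (loc.numer (coeff_class f x P) (degree P)) (degree P)"
    by (rule loc.finprod_frac) (rule coeff_class_closed[OF P])
  also have "\<dots> = frac B (dt_inv f x) (loc.numer (coeff_class f x P) N) N"
  proof (rule loc.numer_frac_extend[symmetric, OF coeff_class_closed[OF P] _ assms(2)])
    fix j assume "degree P < j"
    then show "coeff_class f x P j = \<one>\<^bsub>B\<^esub>" by (simp add: coeff_class_def one_B coeff_eq_0)
  qed
  finally show ?thesis .
qed

text \<open>
  The sum over \<open>j \<le> N\<close> of \<open>\<partial>\<^sub>t\<^sup>j [d\<eta>\<^sub>j] - \<partial>\<^sub>t\<^sup>j [df \<and> \<eta>\<^sub>j\<^sub>-\<^sub>1]\<close> telescopes to its last term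
  \<open>\<partial>\<^sub>t\<^sup>N [d\<eta>\<^sub>N]\<close>.
\<close>

lemma numer_twisted_d:
  assumes "\<eta> \<in> alg_forms_dt (CARD('n) - 1)"
  shows "loc.numer (coeff_class f x (twisted_d f \<eta>)) N = c (ext_d (coeff \<eta> N))"
proof (induction N)
  case 0
  show ?case by (simp add: coeff_class_def coeff_twisted_d)
next
  case (Suc N)
  have "coeff \<eta> N \<in> an_forms x (CARD('n) - 1)"
    by (rule alg_forms_an_forms[OF alg_forms_dtD[OF assms]])
  moreover have "coeff_class f x (twisted_d f \<eta>) (Suc N) = c (ext_d (coeff \<eta> (Suc N)) - df_wedge f (coeff \<eta> N))"
    by (simp add: coeff_class_def coeff_twisted_d)
  ultimately have "loc.numer (coeff_class f x (twisted_d f \<eta>)) (Suc N) =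
      c (df_wedge f (coeff \<eta> N)) \<otimes>\<^bsub>B\<^esub> c (ext_d (coeff \<eta> (Suc N)) - df_wedge f (coeff \<eta> N))"
    by (simp only: loc.numer.simps Suc.IH dt_inv_class)
  then show ?case by (simp add: c_add)
qed

lemma loc_sum_gm_rel:
  assumes R: "R \<in> gm_rel f" and P: "P \<in> alg_forms_dt CARD('n)"
  shows "loc_sum f x (R + P) = loc_sum f x P"
proof -
  interpret g: additive_quotient "alg_forms_dt CARD('n)" "gm_rel f" by (rule gauss_manin_quotient[OF f])
  obtain \<eta> where \<eta>: "\<eta> \<in> alg_forms_dt (CARD('n) - 1)" "R = twisted_d f \<eta>"
    using R unfolding gm_rel_twisted_d by blast
  have Rm: "R \<in> alg_forms_dt CARD('n)" using R g.R_sub by blast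
  define N where "N = Suc (max (degree (R + P)) (max (degree P) (degree \<eta>)))"
  have "coeff_class f x (R + P) = (\<lambda>j. coeff_class f x R j \<otimes>\<^bsub>B\<^esub> coeff_class f x P j)"
    by (simp add: fun_eq_iff coeff_class_def c_add)
  then have "loc.numer (coeff_class f x (R + P)) N = loc.numer (coeff_class f x R) N \<otimes>\<^bsub>B\<^esub> loc.numer (coeff_class f x P) N"
    using loc.numer_mult[OF coeff_class_closed[OF Rm] coeff_class_closed[OF P]] by simp
  also have "loc.numer (coeff_class f x R) N = \<one>\<^bsub>B\<^esub>"
    unfolding \<eta>(2) numer_twisted_d[OF \<eta>(1)] one_B by (simp add: N_def coeff_eq_0)
  finally have "loc.numer (coeff_class f x (R + P)) N = loc.numer (coeff_class f x P) N"
    using loc.numer_closed[OF coeff_class_closed[OF P]] by simp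
  then show ?thesis
    using loc_sum_eq[OF g.M_add[OF Rm P], of N] loc_sum_eq[OF P, of N] by (simp add: N_def)
qed

lemma loc_lattice_eq: "loc_lattice f x = (\<lambda>a. frac B (dt_inv f x) a 0) ` carrier B"
  unfolding loc_lattice_def by (auto simp: lattice_to_loc_gm_def)

lemma loc_lattice_coset:
  assumes "P \<in> alg_forms_dt CARD('n)"
  shows "loc_lattice f x #>\<^bsub>loc_gauss_manin f x\<^esub> loc_sum f x P = loc_lattice f x \<longleftrightarrow> loc_sum f x P \<in> loc_lattice f x"
proof -
  interpret l: comm_group "loc_gauss_manin f x"
    unfolding loc_gauss_manin_def by (rule loc.comm_group_loc)
  have sub: "subgroup (loc_lattice f x) (loc_gauss_manin f x)"
    unfolding loc_lattice_eq loc_gauss_manin_def by (rule loc.lattice_subgroup)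
  have "loc_sum f x P \<in> carrier (loc_gauss_manin f x)"
    unfolding loc_sum_eq[OF assms order_refl] loc_gauss_manin_def
    by (intro loc.frac_closed loc.numer_closed coeff_class_closed[OF assms])
  then show ?thesis using l.coset_join1 l.coset_join2 sub by blast
qed

lemma loc_sum_const:
  assumes "\<omega> \<in> alg_forms CARD('n)"
  shows "loc_sum f x [:\<omega>:] \<in> loc_lattice f x"
proof -
  have P: "[:\<omega>:] \<in> alg_forms_dt CARD('n)"
    using alg_forms_dt_monom[OF assms, of 0] by (simp add: monom_0)
  show ?thesis
    unfolding loc_lattice_eq using loc_sum_eq[OF P, of 0] coeff_class_closed[OF P, of 0] by simp
qed

text \<open>
  Clearing denominators, membership in the lattice says that \<open>\<sigma> D\<close> plus the class of the top
  coefficient is in the image of \<open>\<sigma> = \<partial>\<^sub>t\<^sup>-\<^sup>1\<close>; so the top coefficient itself has its class in that image.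
\<close>

lemma top_coeff_in_df_wedge:
  assumes P: "P \<in> alg_forms_dt CARD('n)" and deg: "degree P \<le> Suc k" and lat: "loc_sum f x P \<in> loc_lattice f x"
  shows "\<exists>\<eta>\<in>an_forms x (CARD('n) - 1). germ_eq x (coeff P (Suc k)) (df_wedge f \<eta>)"
proof -
  let ?\<sigma> = "dt_inv f x"
  define D where "D = loc.numer (coeff_class f x P) k"
  have D: "D \<in> carrier B" unfolding D_def by (intro loc.numer_closed coeff_class_closed[OF P])
  obtain a where a: "a \<in> carrier B" "loc_sum f x P = frac B ?\<sigma> a 0"
    using lat unfolding loc_lattice_eq by blast
  have cl: "?\<sigma> D \<otimes>\<^bsub>B\<^esub> coeff_class f x P (Suc k) \<in> carrier B" using D P by simp
  have "frac B ?\<sigma> (?\<sigma> D \<otimes>\<^bsub>B\<^esub> coeff_class f x P (Suc k)) (Suc k) = frac B ?\<sigma> a 0"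
    using loc_sum_eq[OF P deg] a(2) by (simp add: D_def)
  then have eq: "?\<sigma> D \<otimes>\<^bsub>B\<^esub> coeff_class f x P (Suc k) = ?\<sigma> ((?\<sigma> ^^ k) a)"
    using loc.frac_eq_iff[OF cl a(1)] by simp
  define u where "u = inv\<^bsub>B\<^esub> D \<otimes>\<^bsub>B\<^esub> (?\<sigma> ^^ k) a"
  have u: "u \<in> carrier B" using D a by (simp add: u_def)
  have Du: "D \<otimes>\<^bsub>B\<^esub> u = (?\<sigma> ^^ k) a"
    using D a loc.m_assoc[of D "inv\<^bsub>B\<^esub> D" "(?\<sigma> ^^ k) a"] by (simp add: u_def)
  have "?\<sigma> D \<otimes>\<^bsub>B\<^esub> coeff_class f x P (Suc k) = ?\<sigma> D \<otimes>\<^bsub>B\<^esub> ?\<sigma> u"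
    unfolding eq Du[symmetric] using loc.pow_mult[OF D u, of 1] by simp
  then have "coeff_class f x P (Suc k) = ?\<sigma> u"
    using D P u by (metis coeff_class_closed loc.sigma_closed loc.inv_solve_left loc.m_closed)
  moreover obtain \<eta> where \<eta>: "\<eta> \<in> an_forms x (CARD('n) - 1)" "u = c (ext_d \<eta>)"
    using u by (rule d_surj)
  ultimately have "c (coeff P (Suc k)) = c (df_wedge f \<eta>)"
    using dt_inv_class[OF \<eta>(1)] by (simp only: coeff_class_def)
  then obtain \<xi> where \<xi>: "\<xi> \<in> an_forms x (CARD('n) - 2)"
    "germ_eq x (coeff P (Suc k) - df_wedge f \<eta>) (df_wedge f (ext_d \<xi>))"
    by (rule c_eqE)
  have "germ_eq x (coeff P (Suc k)) (df_wedge f (ext_d \<xi> + \<eta>))"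
    using germ_eq_add[OF \<xi>(2) germ_eq_refl[of x "df_wedge f \<eta>"]] by (simp add: df_wedge_add)
  moreover have "ext_d \<xi> + \<eta> \<in> an_forms x (CARD('n) - 1)"
    using an_forms_add[OF _ \<eta>(1)] ext_d_an_forms[OF \<xi>(1)] n_Suc(2) by simp
  ultimately show ?thesis by blast
qed

end

text \<open>
  Adding the relation \<open>d\<eta> \<partial>\<^sub>t\<^sup>k - (df \<and> \<eta>) \<partial>\<^sub>t\<^bsup>k + 1\<^esup>\<close> removes the coefficient \<open>df \<and> \<eta>\<close> of \<open>\<partial>\<^sub>t\<^bsup>k + 1\<^esup>\<close> and
  does not change the local images.
\<close>

theorem degree_reduction:
  fixes f :: "'n::{finite,linorder} cspace \<Rightarrow> complex"
  assumes dim: "CARD('n) \<ge> 2" and f: "f \<in> polyfun" and fin: "finite (Sing f)"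
    and "P \<in> alg_forms_dt CARD('n)" "degree P \<le> k"
    and "\<And>x. x \<in> Sing f \<Longrightarrow> loc_sum f x P \<in> loc_lattice f x"
  shows "\<exists>\<omega>\<in>alg_forms CARD('n). P - [:\<omega>:] \<in> gm_rel f"
  using assms(4-6)
proof (induction k arbitrary: P)
  case 0
  interpret g: additive_quotient "alg_forms_dt CARD('n)" "gm_rel f" by (rule gauss_manin_quotient[OF f])
  obtain \<omega> where "P = [:\<omega>:]" using 0(2) degree_eq_zeroE by blast
  moreover from this have "\<omega> \<in> alg_forms CARD('n)" using alg_forms_dtD[OF 0(1), of 0] by simp
  ultimately show ?case using g.R_zero by (intro bexI[of _ \<omega>]) simp_all
next
  case (Suc k)
  interpret g: additive_quotient "alg_forms_dt CARD('n)" "gm_rel f" by (rule gauss_manin_quotient[OF f])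
  have ig: "isolated_germ f" by (unfold_locales) (rule dim f fin)+
  have "\<exists>\<eta>\<in>alg_forms (CARD('n) - 1). coeff P (Suc k) = df_wedge f \<eta>"
  proof (rule df_wedge_local_global[OF f fin alg_forms_dtD[OF Suc.prems(1)]])
    fix x assume "x \<in> Sing f"
    then show "\<exists>\<eta>\<in>an_forms x (CARD('n) - 1). germ_eq x (coeff P (Suc k)) (df_wedge f \<eta>)"
      by (intro isolated_germ.top_coeff_in_df_wedge[OF ig Suc.prems(1,2)] Suc.prems(3))
  qed
  then obtain \<eta> where \<eta>: "\<eta> \<in> alg_forms (CARD('n) - 1)" "coeff P (Suc k) = df_wedge f \<eta>" by blast
  define R where "R = twisted_d f (monom \<eta> k)"
  have R: "R \<in> gm_rel f"
    unfolding R_def gm_rel_twisted_d by (intro imageI alg_forms_dt_monom \<eta>)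
  have RP: "R + P \<in> alg_forms_dt CARD('n)" using g.M_add[OF _ Suc.prems(1)] g.R_sub R by blast
  have deg: "degree (R + P) \<le> k"
  proof (rule degree_le, intro allI impI)
    fix j assume j: "k < j"
    then obtain i where i: "j = Suc i" "k \<le> i" by (cases j) auto
    show "coeff (R + P) j = 0"
    proof (cases "i = k")
      case True
      then show ?thesis using i \<eta>(2) by (simp add: R_def coeff_twisted_d)
    next
      case False
      then have "coeff P j = 0" using i Suc.prems(2) by (intro coeff_eq_0) auto
      then show ?thesis using i False by (simp add: R_def coeff_twisted_d)
    qed
  qed
  have "loc_sum f x (R + P) \<in> loc_lattice f x" if "x \<in> Sing f" for x
    using isolated_germ.loc_sum_gm_rel[OF ig R Suc.prems(1)] Suc.prems(3)[OF that] by simp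
  from Suc.IH[OF RP deg this] obtain \<omega> where \<omega>: "\<omega> \<in> alg_forms CARD('n)" "R + P - [:\<omega>:] \<in> gm_rel f" by blast
  have "(R + P - [:\<omega>:]) - R \<in> gm_rel f" by (rule g.R_diff[OF \<omega>(2) R])
  moreover have "(R + P - Q) - R = P - Q" for Q by (simp add: algebra_simps)
  ultimately show ?case using \<omega>(1) by (intro bexI[of _ \<omega>]) (simp_all only:)
qed

theorem theorem0p3:
  fixes f :: "complex ^ 'n::{finite,linorder} \<Rightarrow> complex"
  assumes "CARD('n) \<ge> 2"
    and "f \<in> polyfun"
    and "\<not> f constant_on UNIV"
    and "finite (Sing f)"
  shows "brieskorn_to_gm f ` carrier (brieskorn f) =
    kernel (gauss_manin f) (polar_parts f) (gm_to_polar_parts f)"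
proof -
  note dim = assms(1) and f = assms(2) and fin = assms(4)
  interpret g: additive_quotient "alg_forms_dt CARD('n)" "gm_rel f" by (rule gauss_manin_quotient[OF f])
  have ig: "isolated_germ f" by (unfold_locales) (rule dim f fin)+
  have const: "[:\<omega>:] \<in> alg_forms_dt CARD('n)" if "\<omega> \<in> alg_forms CARD('n)" for \<omega> :: "'n form"
    using alg_forms_dt_monom[OF that, of 0] by (simp add: monom_0)
  have zero: "0 \<in> brieskorn_rel f"
    unfolding brieskorn_rel_def using alg_forms_0[of "CARD('n) - 2"] by (auto intro!: exI[of _ 0])
  have to_gm: "brieskorn_to_gm f (brieskorn_rel f #>\<^bsub>add_grp (alg_forms CARD('n))\<^esub> \<omega>) = g.cls [:\<omega>:]" for \<omega>
  proof -
    have "g.cls [:r + \<omega>:] = g.cls [:\<omega>:]" if "r \<in> brieskorn_rel f" for r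
      using brieskorn_rel_gm_rel[OF dim f that] by (simp add: g.cls_eq_iff)
    moreover have "brieskorn_rel f #>\<^bsub>add_grp (alg_forms CARD('n))\<^esub> \<omega> = (\<lambda>r. r + \<omega>) ` brieskorn_rel f"
      by (auto simp: r_coset_def add_grp_def)
    ultimately have "(\<lambda>\<omega>. g.cls [:\<omega>:]) ` (brieskorn_rel f #>\<^bsub>add_grp (alg_forms CARD('n))\<^esub> \<omega>) = {g.cls [:\<omega>:]}"
      using zero by auto
    then show ?thesis by (simp add: brieskorn_to_gm_def induced_def)
  qed
  have "carrier (brieskorn f) = (\<lambda>\<omega>. brieskorn_rel f #>\<^bsub>add_grp (alg_forms CARD('n))\<^esub> \<omega>) ` alg_forms CARD('n)"
    by (auto simp: brieskorn_def FactGroup_def RCOSETS_def add_grp_def)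
  then have lhs: "brieskorn_to_gm f ` carrier (brieskorn f) = (\<lambda>\<omega>. g.cls [:\<omega>:]) ` alg_forms CARD('n)"
    by (simp add: image_image to_gm)
  have to_loc: "gm_to_loc_gm f x (g.cls P) = loc_sum f x P" if "P \<in> alg_forms_dt CARD('n)" for x P
  proof -
    have "gm_to_loc_gm f x = induced (loc_sum f x)"
      by (simp add: gm_to_loc_gm_def loc_sum_def[abs_def])
    then show ?thesis
      using g.induced_cls[of "loc_sum f x" P] isolated_germ.loc_sum_gm_rel[OF ig _ that] by simp
  qed
  have polar: "gm_to_polar_parts f (g.cls P) = \<one>\<^bsub>polar_parts f\<^esub> \<longleftrightarrow> (\<forall>x\<in>Sing f. loc_sum f x P \<in> loc_lattice f x)"
    if P: "P \<in> alg_forms_dt CARD('n)" for P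
  proof -
    have "gm_to_polar_parts f (g.cls P) = \<one>\<^bsub>polar_parts f\<^esub> \<longleftrightarrow>
      (\<forall>x\<in>Sing f. loc_lattice f x #>\<^bsub>loc_gauss_manin f x\<^esub> loc_sum f x P = loc_lattice f x)"
      by (auto simp: gm_to_polar_parts_def polar_parts_def to_loc[OF P] FactGroup_def restrict_def fun_eq_iff)
    then show ?thesis using isolated_germ.loc_lattice_coset[OF ig P] by simp
  qed
  have ker: "u \<in> kernel (gauss_manin f) (polar_parts f) (gm_to_polar_parts f) \<longleftrightarrow>
      (\<exists>P\<in>alg_forms_dt CARD('n). u = g.cls P \<and> (\<forall>x\<in>Sing f. loc_sum f x P \<in> loc_lattice f x))" for u
    unfolding kernel_def gauss_manin_def g.carrier_Q using polar by auto
  have im: "u \<in> (\<lambda>\<omega>. g.cls [:\<omega>:]) ` alg_forms CARD('n) \<longleftrightarrow>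
      (\<exists>P\<in>alg_forms_dt CARD('n). u = g.cls P \<and> (\<forall>x\<in>Sing f. loc_sum f x P \<in> loc_lattice f x))" for u
  proof
    assume "u \<in> (\<lambda>\<omega>. g.cls [:\<omega>:]) ` alg_forms CARD('n)"
    then obtain \<omega> where "\<omega> \<in> alg_forms CARD('n)" "u = g.cls [:\<omega>:]" by blast
    then show "\<exists>P\<in>alg_forms_dt CARD('n). u = g.cls P \<and> (\<forall>x\<in>Sing f. loc_sum f x P \<in> loc_lattice f x)"
      using const isolated_germ.loc_sum_const[OF ig] by blast
  next
    assume "\<exists>P\<in>alg_forms_dt CARD('n). u = g.cls P \<and> (\<forall>x\<in>Sing f. loc_sum f x P \<in> loc_lattice f x)"
    then obtain P where P: "P \<in> alg_forms_dt CARD('n)" "u = g.cls P" "\<forall>x\<in>Sing f. loc_sum f x P \<in> loc_lattice f x"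
      by blast
    obtain \<omega> where "\<omega> \<in> alg_forms CARD('n)" "P - [:\<omega>:] \<in> gm_rel f"
      using degree_reduction[OF dim f fin P(1) order_refl] P(3) by blast
    then show "u \<in> (\<lambda>\<omega>. g.cls [:\<omega>:]) ` alg_forms CARD('n)"
      using P(2) g.cls_eq_iff by blast
  qed
  show ?thesis unfolding lhs by (rule Set.set_eqI) (simp only: ker im)
qed

end
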